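(* There is an algorithm that, given a graph $G=(V,E)$ (not necessarily bipartite) in which every node has a strict preference order over its neighbours, runs in time $O(|V|+|E|)$ and decides whether $G$ admits a strongly dominant matching, returning one if it exists.
   Context: A matching is a set of pairwise disjoint edges; $M(u)$ is the partner of $u$ in $M$. An unmatched node prefers any neighbour to being unmatched. For a matching $M$ and an edge $(u,v)\in E\setminus M$, the label of $(u,v)$ at $u$ is $+$ if $u$ is unmatched in $M$ or prefers $v$ to $M(u)$, and $-$ if $u$ prefers $M(u)$ to $v$; the edge is a $(+,+)$ edge if its labels at both endpoints are $+$, and a $(-,-)$ edge if both are $-$. A matching $M$ is strongly dominant in $G$ if there is a partition $(L,R)$ of $V$ such that (i) every edge of $M$ has one endpoint in $L$ and the other in $R$, (ii) every node of $R$ is matched in $M$, (iii) every $(+,+)$ edge has both endpoints in $R$, and (iv) every edge of $G$ with both endpoints in $L$ is a $(-,-)$ edge. *)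

theory Defs
  imports Main
begin

section \<open>Strongly dominant matchings\<close>

definition simple_graph :: "'a set \<Rightarrow> 'a set set \<Rightarrow> bool" where
  "simple_graph V E \<longleftrightarrow>
     finite V \<and> E \<subseteq> {{u, v} | u v. u \<in> V \<and> v \<in> V \<and> u \<noteq> v}"

definition neighbours :: "'a set set \<Rightarrow> 'a \<Rightarrow> 'a set" where
  "neighbours E u = {v. {u, v} \<in> E}"

text \<open>\<open>pref u v w\<close> means that node \<open>u\<close> prefers \<open>v\<close> to \<open>w\<close>.\<close>

definition strict_preferences ::
  "'a set \<Rightarrow> 'a set set \<Rightarrow> ('a \<Rightarrow> 'a \<Rightarrow> 'a \<Rightarrow> bool) \<Rightarrow> bool" where
  "strict_preferences V E pref \<longleftrightarrow>
     (\<forall>u\<in>V. irreflp_on (neighbours E u) (pref u) \<and>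
            transp_on (neighbours E u) (pref u) \<and>
            totalp_on (neighbours E u) (pref u))"

definition matching :: "'a set set \<Rightarrow> 'a set set \<Rightarrow> bool" where
  "matching E M \<longleftrightarrow> M \<subseteq> E \<and> pairwise disjnt M"

definition matched :: "'a set set \<Rightarrow> 'a \<Rightarrow> bool" where
  "matched M u \<longleftrightarrow> u \<in> \<Union>M"

definition partner :: "'a set set \<Rightarrow> 'a \<Rightarrow> 'a" where
  "partner M u = (THE v. {u, v} \<in> M)"

text \<open>The label of the edge \<open>{u, v}\<close> at its endpoint \<open>u\<close>.\<close>

definition plus_label ::
  "('a \<Rightarrow> 'a \<Rightarrow> 'a \<Rightarrow> bool) \<Rightarrow> 'a set set \<Rightarrow> 'a \<Rightarrow> 'a \<Rightarrow> bool" where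
  "plus_label pref M u v \<longleftrightarrow> \<not> matched M u \<or> pref u v (partner M u)"

definition minus_label ::
  "('a \<Rightarrow> 'a \<Rightarrow> 'a \<Rightarrow> bool) \<Rightarrow> 'a set set \<Rightarrow> 'a \<Rightarrow> 'a \<Rightarrow> bool" where
  "minus_label pref M u v \<longleftrightarrow> matched M u \<and> pref u (partner M u) v"

definition plus_plus_edge ::
  "'a set set \<Rightarrow> ('a \<Rightarrow> 'a \<Rightarrow> 'a \<Rightarrow> bool) \<Rightarrow> 'a set set \<Rightarrow> 'a \<Rightarrow> 'a \<Rightarrow> bool" where
  "plus_plus_edge E pref M u v \<longleftrightarrow>
     {u, v} \<in> E - M \<and> plus_label pref M u v \<and> plus_label pref M v u"

definition minus_minus_edge ::
  "'a set set \<Rightarrow> ('a \<Rightarrow> 'a \<Rightarrow> 'a \<Rightarrow> bool) \<Rightarrow> 'a set set \<Rightarrow> 'a \<Rightarrow> 'a \<Rightarrow> bool" where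
  "minus_minus_edge E pref M u v \<longleftrightarrow>
     {u, v} \<in> E - M \<and> minus_label pref M u v \<and> minus_label pref M v u"

definition strongly_dominant ::
  "'a set \<Rightarrow> 'a set set \<Rightarrow> ('a \<Rightarrow> 'a \<Rightarrow> 'a \<Rightarrow> bool) \<Rightarrow> 'a set set \<Rightarrow> bool" where
  "strongly_dominant V E pref M \<longleftrightarrow>
     matching E M \<and>
     (\<exists>L R. L \<union> R = V \<and> L \<inter> R = {} \<and>
        (\<forall>e\<in>M. \<exists>u\<in>L. \<exists>v\<in>R. e = {u, v}) \<and>
        (\<forall>v\<in>R. matched M v) \<and>
        (\<forall>u v. plus_plus_edge E pref M u v \<longrightarrow> u \<in> R \<and> v \<in> R) \<and>
        (\<forall>u\<in>L. \<forall>v\<in>L. {u, v} \<in> E \<longrightarrow> minus_minus_edge E pref M u v))"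


section \<open>Random access programs with running time\<close>

text \<open>
  The machine model is a uniform-cost RAM over natural numbers with addition and truncated
  subtraction as its only arithmetic, presented as a while language. A program is a finite
  piece of syntax, so it uses a fixed finite number of scalar registers and of one-way infinite
  arrays. Every operation, array access, comparison, and assignment costs one time unit.
\<close>

type_synonym name = string

datatype aexp =
    Const nat
  | Reg name
  | Load name aexp
  | Plus aexp aexp
  | Minus aexp aexp

datatype bexp =
    Less aexp aexp
  | Equal aexp aexp
  | Neg bexp
  | Conj bexp bexp

datatype com =
    Skip
  | Assign name aexp
  | Store name aexp aexp
  | Seq com com
  | Cond bexp com com
  | While bexp com

datatype state = State (reg: "name \<Rightarrow> nat") (arr: "name \<Rightarrow> nat \<Rightarrow> nat")

fun aval :: "aexp \<Rightarrow> state \<Rightarrow> nat" where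
  "aval (Const k) s = k"
| "aval (Reg x) s = reg s x"
| "aval (Load a e) s = arr s a (aval e s)"
| "aval (Plus e1 e2) s = aval e1 s + aval e2 s"
| "aval (Minus e1 e2) s = aval e1 s - aval e2 s"

fun bval :: "bexp \<Rightarrow> state \<Rightarrow> bool" where
  "bval (Less e1 e2) s \<longleftrightarrow> aval e1 s < aval e2 s"
| "bval (Equal e1 e2) s \<longleftrightarrow> aval e1 s = aval e2 s"
| "bval (Neg b) s \<longleftrightarrow> \<not> bval b s"
| "bval (Conj b1 b2) s \<longleftrightarrow> bval b1 s \<and> bval b2 s"

fun acost :: "aexp \<Rightarrow> nat" where
  "acost (Const k) = 1"
| "acost (Reg x) = 1"
| "acost (Load a e) = acost e + 1"
| "acost (Plus e1 e2) = acost e1 + acost e2 + 1"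
| "acost (Minus e1 e2) = acost e1 + acost e2 + 1"

fun bcost :: "bexp \<Rightarrow> nat" where
  "bcost (Less e1 e2) = acost e1 + acost e2 + 1"
| "bcost (Equal e1 e2) = acost e1 + acost e2 + 1"
| "bcost (Neg b) = bcost b + 1"
| "bcost (Conj b1 b2) = bcost b1 + bcost b2 + 1"

fun assign :: "name \<Rightarrow> nat \<Rightarrow> state \<Rightarrow> state" where
  "assign x k (State r h) = State (r(x := k)) h"

fun store :: "name \<Rightarrow> nat \<Rightarrow> nat \<Rightarrow> state \<Rightarrow> state" where
  "store a i k (State r h) = State r (h(a := (h a)(i := k)))"

text \<open>\<open>exec c s t s'\<close>: program \<open>c\<close> started in \<open>s\<close> halts in \<open>s'\<close> after exactly \<open>t\<close> time units.\<close>

inductive exec :: "com \<Rightarrow> state \<Rightarrow> nat \<Rightarrow> state \<Rightarrow> bool" where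
  Skip: "exec Skip s 1 s"
| Assign: "exec (Assign x e) s (acost e + 1) (assign x (aval e s) s)"
| Store: "exec (Store a i e) s (acost i + acost e + 1) (store a (aval i s) (aval e s) s)"
| Seq: "exec c1 s1 t1 s2 \<Longrightarrow> exec c2 s2 t2 s3 \<Longrightarrow> exec (Seq c1 c2) s1 (t1 + t2) s3"
| CondTrue: "bval b s \<Longrightarrow> exec c1 s t s' \<Longrightarrow> exec (Cond b c1 c2) s (bcost b + t) s'"
| CondFalse: "\<not> bval b s \<Longrightarrow> exec c2 s t s' \<Longrightarrow> exec (Cond b c1 c2) s (bcost b + t) s'"
| WhileFalse: "\<not> bval b s \<Longrightarrow> exec (While b c) s (bcost b) s"
| WhileTrue: "bval b s1 \<Longrightarrow> exec c s1 t1 s2 \<Longrightarrow> exec (While b c) s2 t2 s3 \<Longrightarrow>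
    exec (While b c) s1 (bcost b + t1 + t2) s3"

inductive_cases exec_elims:
  "exec Skip s t s'" "exec (Assign x e) s t s'" "exec (Store a i e) s t s'"
  "exec (Seq c1 c2) s t s'" "exec (Cond b c1 c2) s t s'" "exec (While b c) s t s'"

lemma exec_deterministic:
  "exec c s t s' \<Longrightarrow> exec c s t2 s2 \<Longrightarrow> t2 = t \<and> s2 = s'"
proof (induction arbitrary: t2 s2 rule: exec.induct)
  case (Seq c1 s1 t1 s2' c2 t2' s3)
  from Seq.prems show ?case
    by (rule exec_elims(4)) (use Seq.IH in blast)
next
  case (WhileTrue b s1 c t1 s2' t2' s3)
  from WhileTrue.prems show ?case
    by (rule exec_elims(6)) (use WhileTrue.hyps WhileTrue.IH in blast)+
next
  case (CondTrue b s c1 t s' c2)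
  from CondTrue.prems show ?case
    by (rule exec_elims(5)) (use CondTrue.hyps CondTrue.IH in blast)+
next
  case (CondFalse b s c2 t s' c1)
  from CondFalse.prems show ?case
    by (rule exec_elims(5)) (use CondFalse.hyps CondFalse.IH in blast)+
next
  case (WhileFalse b s c)
  from WhileFalse.prems show ?case
    by (rule exec_elims(6)) (use WhileFalse.hyps in blast)+
qed (erule exec_elims, simp)+


section \<open>Input and output format\<close>

text \<open>
  The nodes are \<open>0, \<dots>, n - 1\<close> and \<open>adj u\<close> lists the neighbours of \<open>u\<close> from most to least preferred.
  The lists are given one after the other in the array \<open>adj\<close>; the list of \<open>u\<close>
  occupies the cells from \<open>off u\<close> up to, but excluding, \<open>off (u + 1)\<close>. All other memory is zero.
\<close>

definition preference_lists ::
  "nat \<Rightarrow> nat set set \<Rightarrow> (nat \<Rightarrow> nat \<Rightarrow> nat \<Rightarrow> bool) \<Rightarrow> (nat \<Rightarrow> nat list) \<Rightarrow> bool" where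
  "preference_lists n E pref adj \<longleftrightarrow>
     (\<forall>u<n. set (adj u) = neighbours E u \<and> distinct (adj u) \<and> sorted_wrt (pref u) (adj u))"

definition input_state :: "nat \<Rightarrow> (nat \<Rightarrow> nat list) \<Rightarrow> state" where
  "input_state n adj =
     State ((\<lambda>_. 0)(''n'' := n))
       ((\<lambda>_ _. 0)
         (''off'' := (\<lambda>u. if u \<le> n then length (concat (map adj [0..<u])) else 0),
          ''adj'' := (\<lambda>i. let xs = concat (map adj [0..<n]) in if i < length xs then xs ! i else 0)))"

text \<open>Partners are shifted by one so that \<open>0\<close> can stand for an unmatched node.\<close>

definition output_matching :: "nat \<Rightarrow> state \<Rightarrow> nat set set \<Rightarrow> bool" where
  "output_matching n s M \<longleftrightarrow>
     (\<forall>u<n. arr s ''mate'' u = (if matched M u then partner M u + 1 else 0))"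

definition correct_output ::
  "nat \<Rightarrow> nat set set \<Rightarrow> (nat \<Rightarrow> nat \<Rightarrow> nat \<Rightarrow> bool) \<Rightarrow> state \<Rightarrow> bool" where
  "correct_output n E pref s \<longleftrightarrow>
     (if \<exists>M. strongly_dominant {..<n} E pref M
      then reg s ''answer'' = 1 \<and>
           (\<exists>M. strongly_dominant {..<n} E pref M \<and> output_matching n s M)
      else reg s ''answer'' = 0)"

end

theory Submission imports Defs begin

text \<open>
  A strongly dominant matching is a stable matching of a roommates instance. Replace each edge by two
  parallel ones, one for each way to put one of its endpoints into \<open>L\<close> and the other into \<open>R\<close>. Every
  node ranks all its options with itself in \<open>R\<close> above those with itself in \<open>L\<close>, the options of each
  kind in the given order, and staying unmatched last. An option with \<open>u\<close> in \<open>L\<close> and \<open>v\<close> in \<open>R\<close> cannot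
  block if \<open>u\<close> is already in \<open>R\<close>. If both nodes are on the wanted sides, it blocks iff the edge is
  \<open>(+,+)\<close>, and if both are in \<open>L\<close>, it blocks iff \<open>u\<close> labels the edge with \<open>+\<close>.

  Irving's algorithm solves this instance. Each node \<open>u\<close> has a pointer \<open>F u\<close> to its best and a pointer
  \<open>B u\<close> to its worst option that is still possible. Proposals move these pointers towards each other
  until every node makes and holds exactly one proposal. Then rotations are found by following
  \<open>u \<mapsto>\<close> (the proposer held by the second choice of \<open>u\<close>), and they are eliminated until \<open>F = B\<close>, which is
  a stable matching, or until \<open>F u > B u\<close> for some \<open>u\<close>, and then there is none. The part of the search
  path that does not belong to the rotation is kept, so the total work is bounded by the total
  movement of the pointers.
\<close>

text \<open>No entry of a list is ever deleted. An entry at \<open>u\<close> counts as removed once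
  the other endpoint has a bound better than this entry, which takes one comparison of
  \<open>B\<close> with \<open>opp\<close>; removal at the near end is expressed by
  \<open>F u\<close> and \<open>B u\<close>. Each pointer therefore moves in one direction only, and
  its movement can serve as a potential. The loop for staying unmatched gives every list a last
  entry, so the proposal phase never gets stuck; unsolvability can show up only when a rotation is
  eliminated. An elimination may discard stable matchings, hence the invariant promises only that
  one of them survives if there was any. Two points are delicate. Keeping the search path after an
  elimination requires a description of what happens to the second choices of the nodes left on it.
  Computing \<open>opp\<close> in linear time requires the position of a node in the lists of its
  neighbours, on a machine without multiplication.\<close>

section \<open>Weakest preconditions with running time\<close>

lemma reg_assign [simp]: "reg (assign x k s) = (reg s)(x := k)"
  by (cases s) simp

lemma arr_assign [simp]: "arr (assign x k s) = arr s"
  by (cases s) simp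

lemma reg_store [simp]: "reg (store a i k s) = reg s"
  by (cases s) simp

lemma arr_store [simp]: "arr (store a i k s) = (arr s)(a := (arr s a)(i := k))"
  by (cases s) simp

text \<open>The running time is an argument of the postcondition, so that correctness and cost are
  proved together. As \<open>exec\<close> is deterministic, the existential quantifier speaks of the
  only run.\<close>

definition wp :: "com \<Rightarrow> (nat \<Rightarrow> state \<Rightarrow> bool) \<Rightarrow> state \<Rightarrow> bool" where
  "wp c Q s \<longleftrightarrow> (\<exists>t s'. exec c s t s' \<and> Q t s')"

lemma wp_mono: "wp c Q s \<Longrightarrow> (\<And>t s'. Q t s' \<Longrightarrow> Q' t s') \<Longrightarrow> wp c Q' s"
  by (auto simp: wp_def)

lemma wp_Skip [simp]: "wp Skip Q s \<longleftrightarrow> Q 1 s"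
  unfolding wp_def by (metis exec.Skip exec_deterministic)

lemma wp_Assign [simp]: "wp (Assign x e) Q s \<longleftrightarrow> Q (acost e + 1) (assign x (aval e s) s)"
  unfolding wp_def by (metis exec.Assign exec_deterministic)

lemma wp_Store [simp]:
  "wp (Store a i e) Q s \<longleftrightarrow> Q (acost i + acost e + 1) (store a (aval i s) (aval e s) s)"
  unfolding wp_def by (metis exec.Store exec_deterministic)

lemma wp_Seq [simp]: "wp (Seq c1 c2) Q s \<longleftrightarrow> wp c1 (\<lambda>t1. wp c2 (\<lambda>t2. Q (t1 + t2))) s"
  unfolding wp_def by (blast intro: exec.Seq elim: exec_elims(4))

text \<open>For sequences nested inside a postcondition, where the state argument is still missing
  and \<open>wp_Seq\<close> does not match.\<close>

lemma wp_Seq_fun: "wp (Seq c1 c2) Q = wp c1 (\<lambda>t1. wp c2 (\<lambda>t2. Q (t1 + t2)))"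
  by (rule ext) simp

lemma wp_Cond [simp]:
  "wp (Cond b c1 c2) Q s \<longleftrightarrow>
     (if bval b s then wp c1 (\<lambda>t. Q (bcost b + t)) s else wp c2 (\<lambda>t. Q (bcost b + t)) s)"
proof -
  have "(\<exists>t s'. exec (Cond b c1 c2) s t s' \<and> Q t s') \<longleftrightarrow>
      (\<exists>t s'. exec (if bval b s then c1 else c2) s t s' \<and> Q (bcost b + t) s')"
    by (auto elim!: exec_elims(5)) (metis exec.CondTrue exec.CondFalse)+
  then show ?thesis by (simp add: wp_def)
qed

lemma bcost_pos: "0 < bcost b"
  by (induction b) auto

text \<open>One potential yields both termination and the time bound: each round is paid from
  \<open>\<Phi>\<close>, and since a test costs at least one unit, \<open>\<Phi>\<close> drops
  strictly. The extra \<open>bcost b\<close> is the final failing test.\<close>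

lemma wp_While:
  assumes "I s"
    and step: "\<And>s. I s \<Longrightarrow> bval b s \<Longrightarrow> wp c (\<lambda>t s'. I s' \<and> bcost b + t + \<Phi> s' \<le> \<Phi> s) s"
  shows "wp (While b c) (\<lambda>t s'. I s' \<and> \<not> bval b s' \<and> t + \<Phi> s' \<le> \<Phi> s + bcost b) s"
  using assms(1)
proof (induction "\<Phi> s" arbitrary: s rule: less_induct)
  case less
  show ?case
  proof (cases "bval b s")
    case True
    from step[OF less.prems True] obtain t s' where
      c: "exec c s t s'" "I s'" "bcost b + t + \<Phi> s' \<le> \<Phi> s" by (auto simp: wp_def)
    with bcost_pos[of b] have "\<Phi> s' < \<Phi> s" by linarith
    from less.hyps[OF this c(2)] obtain t' s'' where
      w: "exec (While b c) s' t' s''" "I s''" "\<not> bval b s''" "t' + \<Phi> s'' \<le> \<Phi> s' + bcost b"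
      by (auto simp: wp_def)
    have "exec (While b c) s (bcost b + t + t') s''"
      using exec.WhileTrue[OF True c(1) w(1)] .
    moreover have "bcost b + t + t' + \<Phi> s'' \<le> \<Phi> s + bcost b" using w(4) c(3) by linarith
    ultimately show ?thesis using w unfolding wp_def by blast
  next
    case False
    then have "exec (While b c) s (bcost b) s" by (rule exec.WhileFalse)
    moreover have "bcost b + \<Phi> s \<le> \<Phi> s + bcost b" by simp
    ultimately show ?thesis using False less.prems unfolding wp_def by blast
  qed
qed

lemma wp_While_strong:
  assumes "I s"
    and "\<And>s. I s \<Longrightarrow> bval b s \<Longrightarrow> wp c (\<lambda>t s'. I s' \<and> bcost b + t + \<Phi> s' \<le> \<Phi> s) s"
    and "\<And>t s'. I s' \<Longrightarrow> \<not> bval b s' \<Longrightarrow> t + \<Phi> s' \<le> \<Phi> s + bcost b \<Longrightarrow> Q t s'"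
  shows "wp (While b c) Q s"
  by (rule wp_mono[OF wp_While[of I s b c \<Phi>, OF assms(1,2)]]) (use assms(3) in auto)

section \<open>Stable roommates\<close>

text \<open>
  The options of node \<open>u\<close> are the slots \<open>lo u, \<dots>, hi u\<close> in order of preference, and \<open>opp i\<close> is the slot of the
  other endpoint for the same edge. Staying unmatched is the loop \<open>hi u\<close>, which makes every matching
  perfect.
\<close>

locale roommates =
  fixes n :: nat and lo hi own opp :: "nat \<Rightarrow> nat"
  assumes own_eq: "\<lbrakk>u < n; lo u \<le> i; i \<le> hi u\<rbrakk> \<Longrightarrow> own i = u"
    and opp_slot: "\<lbrakk>u < n; lo u \<le> i; i \<le> hi u\<rbrakk> \<Longrightarrow>
      own (opp i) < n \<and> lo (own (opp i)) \<le> opp i \<and> opp i \<le> hi (own (opp i)) \<and> opp (opp i) = i"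
    and lo_le_hi: "u < n \<Longrightarrow> lo u \<le> hi u"
    and opp_hi: "u < n \<Longrightarrow> opp (hi u) = hi u"
begin

definition slot :: "nat \<Rightarrow> nat \<Rightarrow> bool" where
  "slot u i \<longleftrightarrow> u < n \<and> lo u \<le> i \<and> i \<le> hi u"

definition peer :: "nat \<Rightarrow> nat" where
  "peer i = own (opp i)"

text \<open>A matching is given by slots and not by partners because two parallel edges join the
  same nodes. The loop needs no special treatment: \<open>m u \<le> hi u\<close>, so it never
  blocks.\<close>

definition stable :: "(nat \<Rightarrow> nat) \<Rightarrow> bool" where
  "stable m \<longleftrightarrow>
     (\<forall>u<n. slot u (m u) \<and> m (peer (m u)) = opp (m u)) \<and>
     (\<forall>u i. slot u i \<longrightarrow> m u \<le> i \<or> m (peer i) \<le> opp i)"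

text \<open>Lazy deletion, tested at the far end of the edge only. As bounds only improve, a dead
  slot stays dead.\<close>

definition dead :: "(nat \<Rightarrow> nat) \<Rightarrow> nat \<Rightarrow> bool" where
  "dead B i \<longleftrightarrow> B (peer i) < opp i"

text \<open>The second part asks for one surviving stable matching instead of all of them, because
  eliminating a rotation can lose some.\<close>

definition pruned :: "(nat \<Rightarrow> nat) \<Rightarrow> (nat \<Rightarrow> nat) \<Rightarrow> bool" where
  "pruned F B \<longleftrightarrow>
     (\<forall>u<n. slot u (F u) \<and> slot u (B u) \<and> (\<forall>i. lo u \<le> i \<longrightarrow> i < F u \<longrightarrow> dead B i)) \<and>
     ((\<exists>m. stable m) \<longrightarrow> (\<exists>m. stable m \<and> (\<forall>u<n. m u \<le> B u)))"

definition settled :: "(nat \<Rightarrow> nat) \<Rightarrow> (nat \<Rightarrow> nat) \<Rightarrow> nat \<Rightarrow> bool" where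
  "settled F B u \<longleftrightarrow> B (peer (F u)) = opp (F u)"

lemma slot_own: "slot u i \<Longrightarrow> own i = u"
  by (simp add: slot_def own_eq)

lemma slot_node: "slot u i \<Longrightarrow> u < n"
  by (simp add: slot_def)

lemma slot_peer: "slot u i \<Longrightarrow> slot (peer i) (opp i)"
  by (auto simp: slot_def peer_def opp_slot)

lemma slot_opp_opp: "slot u i \<Longrightarrow> opp (opp i) = i"
  using opp_slot[of u i] by (simp add: slot_def)

lemma slot_peer_opp: "slot u i \<Longrightarrow> peer (opp i) = u"
  by (simp add: peer_def slot_opp_opp slot_own)

lemma peer_less: "slot u i \<Longrightarrow> peer i < n"
  using slot_peer slot_node by blast

lemma slot_hi: "u < n \<Longrightarrow> slot u (hi u)"
  by (simp add: slot_def lo_le_hi)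

lemma peer_hi: "u < n \<Longrightarrow> peer (hi u) = u"
  using slot_hi slot_own by (simp add: peer_def opp_hi)

lemma pruned_first: "pruned F B \<Longrightarrow> u < n \<Longrightarrow> slot u (F u)"
  by (simp add: pruned_def)

lemma pruned_worst: "pruned F B \<Longrightarrow> u < n \<Longrightarrow> slot u (B u)"
  by (simp add: pruned_def)

lemma pruned_dead: "pruned F B \<Longrightarrow> slot u i \<Longrightarrow> i < F u \<Longrightarrow> dead B i"
  by (auto simp: pruned_def slot_def)

text \<open>A match below \<open>F u\<close> would be along a dead slot and so put the other
  endpoint beyond its bound.\<close>

lemma first_le_stable:
  assumes "pruned F B" "stable m" "\<And>u. u < n \<Longrightarrow> m u \<le> B u" "u < n"
  shows "F u \<le> m u"
proof (rule ccontr)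
  assume "\<not> F u \<le> m u"
  moreover have m: "slot u (m u)" "m (peer (m u)) = opp (m u)"
    using assms by (auto simp: stable_def)
  ultimately have "B (peer (m u)) < m (peer (m u))"
    using pruned_dead[OF assms(1), of u "m u"] by (simp add: dead_def)
  with assms(3)[OF peer_less[OF m(1)]] show False by simp
qed

lemma pruned_infeasible:
  assumes "pruned F B" "u < n" "B u < F u"
  shows "\<not> stable m"
proof
  assume "stable m"
  with assms(1) obtain m' where "stable m'" "\<And>u. u < n \<Longrightarrow> m' u \<le> B u"
    unfolding pruned_def by blast
  with first_le_stable[OF assms(1)] assms(2,3) show False
    by (meson leD le_trans)
qed

lemma stable_first:
  assumes "pruned F B" "\<And>u. u < n \<Longrightarrow> settled F B u" "\<And>u. u < n \<Longrightarrow> F u = B u"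
  shows "stable F"
  unfolding stable_def
proof (intro conjI allI impI)
  fix u assume u: "u < n"
  show s: "slot u (F u)" using pruned_first[OF assms(1) u] .
  show "F (peer (F u)) = opp (F u)"
    using assms(2)[OF u] assms(3)[OF peer_less[OF s]] by (simp add: settled_def)
next
  fix u i assume s: "slot u i"
  show "F u \<le> i \<or> F (peer i) \<le> opp i"
    using pruned_dead[OF assms(1) s] assms(3)[OF peer_less[OF s]] by (force simp: dead_def)
qed


text \<open>In the proposal phase \<open>B u = hi u\<close> means that \<open>u\<close> holds no proposal yet.\<close>

definition proposing :: "(nat \<Rightarrow> nat) \<Rightarrow> (nat \<Rightarrow> nat) \<Rightarrow> bool" where
  "proposing F B \<longleftrightarrow> pruned F B \<and>
     (\<forall>u<n. F u \<le> B u \<and> (B u = hi u \<or> F (peer (B u)) = opp (B u)))"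

text \<open>Why the proposal phase cannot exhaust a list: if \<open>F x\<close> has met
  \<open>B x\<close>, then either this is the loop of a node holding nothing, or it is the slot of a
  held proposal. Neither of them is dead.\<close>

lemma dead_advance:
  assumes P: "proposing F B" and x: "x < n" and d: "dead B (F x)"
  shows "F x < B x"
proof (rule ccontr)
  assume "\<not> F x < B x"
  with P x have e: "F x = B x" and c: "B x = hi x \<or> F (peer (B x)) = opp (B x)"
    and pr: "pruned F B"
    unfolding proposing_def by (auto simp: not_less dest: le_antisym)
  have s: "slot x (F x)" using pruned_first[OF pr x] .
  from c show False
  proof
    assume "B x = hi x"
    with d e x show False by (simp add: dead_def peer_hi opp_hi)
  next
    assume f: "F (peer (B x)) = opp (B x)"
    have "F (peer (B x)) \<le> B (peer (B x))"
      using P peer_less[OF s] e by (auto simp: proposing_def)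
    with f d e show False by (simp add: dead_def)
  qed
qed

lemma proposing_advance:
  assumes P: "proposing F B" and x: "x < n" and d: "dead B (F x)"
  shows "proposing (F(x := F x + 1)) B"
proof -
  have l: "F x < B x" using dead_advance[OF assms] .
  have pr: "pruned F B" using P by (simp add: proposing_def)
  have "pruned (F(x := F x + 1)) B"
    using pr l x d by (auto simp: pruned_def slot_def less_Suc_eq)
  moreover have "B u = hi u \<or> (F(x := F x + 1)) (peer (B u)) = opp (B u)" if u: "u < n" for u
  proof (cases "B u = hi u")
    case False
    then have f: "F (peer (B u)) = opp (B u)" using P u by (auto simp: proposing_def)
    have s: "slot u (B u)" using pruned_worst[OF pr u] .
    have "peer (B u) \<noteq> x"
    proof
      assume "peer (B u) = x"
      with f s d show False by (auto simp: dead_def slot_opp_opp slot_peer_opp)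
    qed
    with f show ?thesis by simp
  qed simp
  ultimately show ?thesis using P l by (auto simp: proposing_def)
qed

text \<open>In a stable matching within \<open>B\<close>, node \<open>x\<close> has
  \<open>F x\<close> or something worse. In the second case the receiver must be content with
  \<open>opp (F x)\<close> or better, as the edge would block otherwise. So lowering the bound loses
  none of these matchings.\<close>

lemma pruned_propose:
  assumes pr: "pruned F B" and x: "x < n" and a: "opp (F x) \<le> B (peer (F x))"
  shows "pruned F (B(peer (F x) := opp (F x)))"
proof -
  have s: "slot x (F x)" using pruned_first[OF pr x] .
  have "m (peer (F x)) \<le> opp (F x)"
    if m: "stable m" "\<And>u. u < n \<Longrightarrow> m u \<le> B u" for m
  proof -
    have "m x \<le> F x \<or> m (peer (F x)) \<le> opp (F x)" using m(1) s by (simp add: stable_def)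
    moreover have "F x \<le> m x" using first_le_stable[OF pr m x] .
    ultimately show ?thesis using m(1) x unfolding stable_def by (metis le_antisym order_refl)
  qed
  then show ?thesis
    using pr a slot_peer[OF s] unfolding pruned_def dead_def
    by (smt (verit) fun_upd_apply le_less_trans not_le_imp_less)
qed

lemma proposing_propose:
  assumes P: "proposing F B" and x: "x < n" and a: "opp (F x) < B (peer (F x))"
  shows "proposing F (B(peer (F x) := opp (F x)))" "F (peer (F x)) \<le> opp (F x)"
proof -
  have pr: "pruned F B" using P by (simp add: proposing_def)
  have s: "slot x (F x)" using pruned_first[OF pr x] .
  show le: "F (peer (F x)) \<le> opp (F x)"
  proof (rule ccontr)
    assume "\<not> F (peer (F x)) \<le> opp (F x)"
    then have "dead B (opp (F x))" using pruned_dead[OF pr slot_peer[OF s]] by simp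
    then have "B x < F x" by (simp add: dead_def slot_opp_opp[OF s] slot_peer_opp[OF s])
    with P x show False by (auto simp: proposing_def)
  qed
  have "pruned F (B(peer (F x) := opp (F x)))"
    using pruned_propose[OF pr x] a by simp
  moreover have "F (peer (opp (F x))) = opp (opp (F x))"
    by (simp add: slot_opp_opp[OF s] slot_peer_opp[OF s])
  ultimately show "proposing F (B(peer (F x) := opp (F x)))"
    using P le by (auto simp: proposing_def)
qed

text \<open>An accepted proposal can unsettle only the proposer that it displaces; if the receiver
  held nothing, no node is unsettled.\<close>

lemma settled_propose:
  assumes P: "proposing F B" and x: "x < n" and a: "opp (F x) < B (peer (F x))"
    and u: "u < n" "u = x \<or> settled F B u"
    and ne: "u = peer (B (peer (F x))) \<longrightarrow> B (peer (F x)) = hi (peer (F x))"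
  shows "settled F (B(peer (F x) := opp (F x))) u"
proof (cases "u = x")
  case False
  have pr: "pruned F B" using P by (simp add: proposing_def)
  have sx: "slot x (F x)" and s: "slot u (F u)" using pruned_first[OF pr] x u by auto
  let ?v = "peer (F x)"
  have v: "?v < n" using peer_less[OF sx] .
  have "peer (F u) \<noteq> ?v"
  proof
    assume e: "peer (F u) = ?v"
    with u False have b: "B ?v = opp (F u)" by (simp add: settled_def)
    then have "peer (B ?v) = u" by (simp add: slot_peer_opp[OF s])
    \<comment> \<open>With nothing held, \<open>B\<close> points to the loop, so \<open>u\<close>
      would be the receiver itself, proposing along its loop. This contradicts that its first
      pointer does not lie beyond the slot just offered.\<close>
    with ne have h: "B ?v = hi ?v" by simp
    with \<open>peer (B ?v) = u\<close> have "u = ?v" by (simp add: peer_hi[OF v])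
    with b h v slot_opp_opp[OF s] have "F ?v = hi ?v" by (metis opp_hi)
    with a h proposing_propose(2)[OF P x a] show False by simp
  qed
  with u False show ?thesis by (simp add: settled_def)
qed (simp add: settled_def)


text \<open>Irving's table after the first phase, and again after each elimination that leaves no
  list empty.\<close>

definition closed :: "(nat \<Rightarrow> nat) \<Rightarrow> (nat \<Rightarrow> nat) \<Rightarrow> bool" where
  "closed F B \<longleftrightarrow> pruned F B \<and> (\<forall>u<n. F u \<le> B u \<and> settled F B u)"

text \<open>Every node makes a proposal that is held, so by counting every node also holds one.\<close>

lemma settled_surj:
  assumes pr: "pruned F B" and st: "\<And>u. u < n \<Longrightarrow> settled F B u" and v: "v < n"
  shows "peer (B v) < n" "F (peer (B v)) = opp (B v)"
proof -
  have s: "slot u (F u)" if "u < n" for u using pruned_first[OF pr that] .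
  let ?h = "\<lambda>u. peer (F u)"
  have "inj_on ?h {..<n}"
  proof (rule inj_onI)
    fix u u' assume u: "u \<in> {..<n}" "u' \<in> {..<n}" "peer (F u) = peer (F u')"
    then have "opp (F u) = opp (F u')" using st by (metis lessThan_iff settled_def)
    with u s show "u = u'" by (metis lessThan_iff slot_peer_opp)
  qed
  moreover have "?h ` {..<n} \<subseteq> {..<n}" using s peer_less by blast
  ultimately have "?h ` {..<n} = {..<n}" by (simp add: endo_inj_surj)
  then have "v \<in> ?h ` {..<n}" using v by simp
  then obtain u where u: "u < n" "v = peer (F u)" by auto
  then have "B v = opp (F u)" using st by (simp add: settled_def)
  then show "peer (B v) < n" "F (peer (B v)) = opp (B v)"
    using u slot_peer_opp[OF s[OF u(1)]] slot_opp_opp[OF s[OF u(1)]] by auto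
qed

lemma closed_holder:
  assumes "closed F B" "v < n"
  shows "peer (B v) < n" "F (peer (B v)) = opp (B v)"
  using settled_surj[of F B v] assms by (auto simp: closed_def)

text \<open>The other endpoint of \<open>B v\<close> is the proposer held by \<open>v\<close>, and
  there this edge is the first entry.\<close>

lemma worst_alive:
  assumes "closed F B" "v < n"
  shows "\<not> dead B (B v)"
  using closed_holder[OF assms] assms by (auto simp: closed_def dead_def not_less)

text \<open>Makes lazy deletion symmetric: an entry present at one end is not already skipped at the
  other, for otherwise it would be dead seen from there, which means \<open>B u < i\<close>.\<close>

lemma alive_first_le:
  assumes T: "closed F B" and i: "slot u i" "\<not> dead B i" "i \<le> B u"
  shows "F (peer i) \<le> opp i"
proof (rule ccontr)
  assume "\<not> F (peer i) \<le> opp i"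
  then have "dead B (opp i)" using T slot_peer[OF i(1)] pruned_dead by (auto simp: closed_def)
  with i show False by (simp add: dead_def slot_opp_opp[OF i(1)] slot_peer_opp[OF i(1)])
qed

definition second :: "(nat \<Rightarrow> nat) \<Rightarrow> (nat \<Rightarrow> nat) \<Rightarrow> nat \<Rightarrow> nat \<Rightarrow> bool" where
  "second F B u i \<longleftrightarrow> F u < i \<and> i \<le> B u \<and> \<not> dead B i \<and> (\<forall>j. F u < j \<longrightarrow> j < i \<longrightarrow> dead B j)"

definition succ :: "(nat \<Rightarrow> nat) \<Rightarrow> nat \<Rightarrow> nat" where
  "succ B i = peer (B (peer i))"

lemma second_slot:
  assumes "closed F B" "u < n" "second F B u i"
  shows "slot u i"
  using assms pruned_first[of F B u] pruned_worst[of F B u]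
    by (auto simp: closed_def second_def slot_def)

text \<open>Otherwise the receiver would hold a proposal along \<open>i\<close>, and the first
  choice of \<open>u\<close> would be \<open>i\<close>. Hence a rotation strictly improves the bound
  of every receiver.\<close>

lemma second_not_worst:
  assumes T: "closed F B" "u < n" "second F B u i"
  shows "opp i < B (peer i)"
proof (rule ccontr)
  assume "\<not> opp i < B (peer i)"
  with T(3) have e: "B (peer i) = opp i" by (auto simp: second_def dead_def)
  have s: "slot u i" using second_slot[OF T] .
  have "F (peer (B (peer i))) = opp (B (peer i))" using closed_holder(2)[OF T(1) peer_less[OF s]] .
  with e have "F u = i" by (simp add: slot_peer_opp[OF s] slot_opp_opp[OF s])
  with T(3) show False by (simp add: second_def)
qed

lemma succ_less: "closed F B \<Longrightarrow> u < n \<Longrightarrow> second F B u i \<Longrightarrow> succ B i < n"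
  using closed_holder(1) peer_less second_slot by (metis succ_def)

lemma first_succ:
  assumes T: "closed F B" "u < n" "second F B u i"
  shows "F (succ B i) = opp (B (peer i))" "peer (F (succ B i)) = peer i"
proof -
  have v: "peer i < n" using peer_less second_slot[OF T] by blast
  show e: "F (succ B i) = opp (B (peer i))"
    unfolding succ_def using closed_holder(2)[OF T(1) v] .
  show "peer (F (succ B i)) = peer i"
    using T(1) v pruned_worst[of F B "peer i"] by (auto simp: e closed_def slot_peer_opp)
qed

text \<open>If the held proposer had a single entry, then so would its receiver, by
  \<open>closed_holder\<close>. But the list of the receiver contains \<open>opp i\<close> besides
  the strictly worse \<open>B (peer i)\<close>. So the search never steps onto a finished
  node.\<close>

lemma succ_not_single:
  assumes T: "closed F B" "u < n" "second F B u i"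
  shows "F (succ B i) < B (succ B i)"
proof (rule ccontr)
  let ?x = "succ B i"
  have x: "?x < n" using succ_less[OF T] .
  assume "\<not> F ?x < B ?x"
  with T(1) x have e: "F ?x = B ?x" by (auto simp: closed_def dest: le_antisym)
  have v: "peer i < n" using peer_less second_slot[OF T] by blast
  have "F (peer (B ?x)) = opp (B ?x)" using closed_holder(2)[OF T(1) x] .
  with e first_succ[OF T] have "F (peer i) = opp (opp (B (peer i)))" by simp
  also have "\<dots> = B (peer i)" using T(1) v pruned_worst[of F B "peer i"] slot_opp_opp
    by (auto simp: closed_def)
  finally have "F (peer i) = B (peer i)" .
  moreover have "F (peer i) \<le> opp i"
    using alive_first_le[OF T(1) second_slot[OF T]] T(3) by (simp add: second_def)
  ultimately show False using second_not_worst[OF T] by simp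
qed

end

section \<open>Rotations\<close>

text \<open>The cycle is a set; \<open>irred\<close> says that it is one cycle and not a union of
  several. The new pointers are characterised pointwise, so that the arrays left by the program can
  be plugged in directly.\<close>

locale rotation = roommates +
  fixes F B S F' B' :: "nat \<Rightarrow> nat" and X :: "nat set"
  assumes cl: "closed F B"
    and X: "X \<subseteq> {..<n}" "\<And>u. u \<in> X \<Longrightarrow> second F B u (S u)" "(\<lambda>u. succ B (S u)) ` X = X"
    and irred: "\<And>Z. \<lbrakk>Z \<subseteq> X; Z \<noteq> {}; (\<lambda>u. succ B (S u)) ` Z = Z\<rbrakk> \<Longrightarrow> Z = X"
    and F': "\<And>u. u \<in> X \<Longrightarrow> F' u = S u" "\<And>u. u \<notin> X \<Longrightarrow> F' u = F u"
    and B': "\<And>u. u \<in> X \<Longrightarrow> B' (peer (S u)) = opp (S u)"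
      "\<And>v. v \<notin> (\<lambda>u. peer (S u)) ` X \<Longrightarrow> B' v = B v"
begin

lemma node: "u \<in> X \<Longrightarrow> u < n"
  using X(1) by auto

lemma pr: "pruned F B"
  using cl by (simp add: closed_def)

lemma Sslot: "u \<in> X \<Longrightarrow> slot u (S u)"
  using second_slot[OF cl node X(2)] .

lemma succ_inj: "inj_on (\<lambda>u. succ B (S u)) X"
  using X(1,3) by (metis eq_card_imp_inj_on finite_lessThan finite_subset)

lemma peer_inj: "inj_on (\<lambda>u. peer (S u)) X"
  using succ_inj unfolding succ_def inj_on_def by metis

lemma F_le: "u < n \<Longrightarrow> F u \<le> F' u"
  using F' X(2) by (cases "u \<in> X") (force simp: second_def)+

lemma B_le: "B' v \<le> B v"
proof (cases "v \<in> (\<lambda>u. peer (S u)) ` X")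
  case True
  then obtain u where "u \<in> X" "v = peer (S u)" by blast
  with B'(1) second_not_worst[OF cl node X(2)] show ?thesis by force
qed (simp add: B'(2))

lemma pred:
  assumes "x \<in> X"
  obtains u where "u \<in> X" "peer (F x) = peer (S u)" "F x = opp (B (peer (S u)))" "x = succ B (S u)"
proof -
  from assms X(3) obtain u where u: "u \<in> X" "x = succ B (S u)" by blast
  with first_succ[OF cl node X(2)] that show thesis by metis
qed

text \<open>Otherwise \<open>u\<close> would be the proposer held by a second choice of some node of
  the rotation, hence a successor and itself a member.\<close>

lemma peer_first: "u < n \<Longrightarrow> u \<notin> X \<Longrightarrow> peer (F u) \<notin> (\<lambda>u. peer (S u)) ` X"
proof
  assume u: "u < n" "u \<notin> X" and "peer (F u) \<in> (\<lambda>u. peer (S u)) ` X"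
  then obtain x where x: "x \<in> X" "peer (F u) = peer (S x)" by blast
  have "B (peer (F u)) = opp (F u)" using cl u by (simp add: closed_def settled_def)
  with x have "u = succ B (S x)"
    using slot_peer_opp[OF pruned_first[OF pr u(1)]] by (simp add: succ_def)
  with x(1) X(3) u(2) show False by blast
qed

lemma dead_mono: "dead B i \<Longrightarrow> dead B' i"
  using B_le unfolding dead_def by (meson le_less_trans)

lemma settled': "u < n \<Longrightarrow> settled F' B' u"
proof (cases "u \<in> X")
  case False
  moreover assume u: "u < n"
  ultimately have "B' (peer (F u)) = B (peer (F u))" using peer_first B'(2) by blast
  with False u cl F'(2) show ?thesis by (simp add: settled_def closed_def)
qed (simp add: settled_def F' B')

text \<open>The only live slot skipped by a node of the rotation is its old first choice. It dies
  because its receiver is the second choice of the predecessor, whose bound has just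
  improved.\<close>

lemma dead_F':
  assumes "slot u i" "i < F' u"
  shows "dead B' i"
proof (cases "i < F u")
  case True
  then show ?thesis using pruned_dead[OF pr assms(1)] dead_mono by blast
next
  case False
  with assms F' have x: "u \<in> X" "i < S u" by (cases "u \<in> X"; force)+
  show ?thesis
  proof (cases "i = F u")
    case True
    from pred[OF x(1)] obtain w where w: "w \<in> X" "peer (F u) = peer (S w)"
      "F u = opp (B (peer (S w)))" by metis
    have "B' (peer (F u)) < B (peer (F u))"
      using w B'(1) second_not_worst[OF cl node X(2)] by simp
    moreover have "B (peer (F u)) = opp (F u)" using cl node[OF x(1)]
      by (simp add: closed_def settled_def)
    ultimately show ?thesis by (simp add: dead_def True)
  next
    case False
    with \<open>\<not> i < F u\<close> x X(2)[OF x(1)] show ?thesis by (intro dead_mono) (auto simp: second_def)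
  qed
qed

text \<open>If some node of the rotation has its first choice in \<open>m\<close>, then so has its predecessor. Moving
  all these nodes to their second choices keeps the matching stable.\<close>

lemma solvable:
  assumes m: "stable m" and mB: "\<And>u. u < n \<Longrightarrow> m u \<le> B u"
  shows "\<exists>m'. stable m' \<and> (\<forall>u<n. m' u \<le> B' u)"
proof -
  have ms: "slot u (m u)" "m (peer (m u)) = opp (m u)" if "u < n" for u
    using m that by (auto simp: stable_def)
  have mF: "F u \<le> m u" if "u < n" for u
    using first_le_stable[OF pr m mB that] .
  define X1 where "X1 = {u \<in> X. m u = F u}"
  \<comment> \<open>A match strictly between first and second choice would use a dead slot; a match
    beyond the second choice makes that choice block unless its receiver has something at least as
    good.\<close>
  have first_or: "m u = F u \<or> m (peer (S u)) \<le> opp (S u)" if u: "u \<in> X" for u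
  proof (cases "m u = S u")
    case True
    then show ?thesis using ms(2)[OF node[OF u]] by simp
  next
    case False
    have "m u \<le> S u \<or> m (peer (S u)) \<le> opp (S u)" using m Sslot[OF u] by (simp add: stable_def)
    moreover have "m u = F u" if "m u < S u"
    proof (rule ccontr)
      assume "m u \<noteq> F u"
      with that mF[OF node[OF u]] X(2)[OF u] have "dead B (m u)" by (simp add: second_def)
      with ms[OF node[OF u]] mB[OF peer_less[OF ms(1)[OF node[OF u]]]] show False
        by (simp add: dead_def)
    qed
    ultimately show ?thesis using False by auto
  qed
  have worst: "m (peer (F u)) = B (peer (F u))" if "u \<in> X1" for u
    using that ms[of u] node cl by (auto simp: X1_def closed_def settled_def)
  have prev: "u \<in> X1" if "u \<in> X" "succ B (S u) \<in> X1" for u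
  proof -
    have "m (peer (S u)) = B (peer (S u))"
      using worst[OF that(2)] first_succ[OF cl node[OF that(1)] X(2)[OF that(1)]] by simp
    then show ?thesis
      using first_or[OF that(1)] second_not_worst[OF cl node[OF that(1)] X(2)[OF that(1)]] that(1)
      by (auto simp: X1_def)
  qed
  have fX: "finite X1" using X(1) by (simp add: X1_def finite_subset)
  let ?g = "\<lambda>u. succ B (S u)"
  \<comment> \<open>\<open>X1\<close> is closed under predecessors, so it is contained in its image;
    finiteness turns this into equality.\<close>
  have g: "?g ` X1 = X1"
  proof -
    have "X1 \<subseteq> ?g ` X1"
    proof
      fix x assume x: "x \<in> X1"
      then obtain u where "u \<in> X" "x = ?g u" using X(3) by (auto simp: X1_def)
      with prev x show "x \<in> ?g ` X1" by blast
    qed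
    then show ?thesis using fX by (metis card_image_le card_seteq finite_imageI)
  qed
  \<comment> \<open>Nodes of \<open>X1\<close> sit at their first choice, the receivers of their
    second choices at their worst one, and these differ when a second choice exists. So the two
    clauses of \<open>m'\<close> below do not conflict.\<close>
  have disj: "u \<noteq> peer (S w)" if "u \<in> X1" "w \<in> X1" for u w
  proof
    assume e: "u = peer (S w)"
    have "?g w \<in> X1" using g that(2) by blast
    from worst[OF this] have "m (peer (S w)) = B (peer (S w))"
      using first_succ[OF cl node X(2)] that(2) by (simp add: X1_def)
    with e that(1) X(2)[of u] show False by (auto simp: X1_def second_def)
  qed
  have inj: "u = w" if "u \<in> X1" "w \<in> X1" "peer (S u) = peer (S w)" for u w
    using peer_inj that by (auto simp: X1_def inj_on_def)
  define m' where "m' v = (if v \<in> X1 then S v else if v \<in> (\<lambda>u. peer (S u)) ` X1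
      then opp (S (inv_into X1 (\<lambda>u. peer (S u)) v)) else m v)" for v
  have m'1: "m' u = S u" if "u \<in> X1" for u using that by (simp add: m'_def)
  have m'2: "m' (peer (S u)) = opp (S u)" if "u \<in> X1" for u
  proof -
    have "inv_into X1 (\<lambda>u. peer (S u)) (peer (S u)) = u"
      using inj that by (intro inv_into_f_eq) (auto simp: inj_on_def)
    then show ?thesis using that disj[of "peer (S u)" u] by (auto simp: m'_def)
  qed
  have m'3: "m' v = m v" if "v \<notin> X1" "v \<notin> (\<lambda>u. peer (S u)) ` X1" for v using that
    by (simp add: m'_def)
  have X1: "u \<in> X" "u < n" "m u = F u" "slot u (S u)" if "u \<in> X1" for u
    using that node Sslot by (auto simp: X1_def)
  have holder: "\<exists>u\<in>X1. v = peer (S u)" if "x \<in> X1" "v = peer (F x)" for v x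
  proof -
    from g that(1) obtain u where u: "u \<in> X1" "x = ?g u" by blast
    then show ?thesis using first_succ[OF cl node X(2)] that(2) X1(1) by metis
  qed
  have matched_first: "\<exists>x\<in>X1. v = peer (F x) \<and> m v = opp (F x)" if "u \<in> X1" "v = peer (S u)" for u v
  proof -
    have x: "?g u \<in> X1" using g that(1) by blast
    have "v = peer (F (?g u))" using first_succ[OF cl node X(2)] that X1(1) by metis
    moreover have "m (peer (F (?g u))) = opp (F (?g u))" using ms(2)[OF X1(2)[OF x]] X1(3)[OF x]
      by simp
    ultimately show ?thesis using x by blast
  qed
  have better: "m' v \<le> m v" if "v \<notin> X1" for v
  proof (cases "v \<in> (\<lambda>u. peer (S u)) ` X1")
    case True
    then obtain u where u: "u \<in> X1" "v = peer (S u)" by blast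
    have "?g u \<in> X1" using g u(1) by blast
    from worst[OF this] have "m v = B v"
      using first_succ[OF cl node X(2)] u X1(1) by simp
    then show ?thesis
      using u m'2[OF u(1)] second_not_worst[OF cl X1(2) X(2)[OF X1(1)], OF u(1) u(1)] by simp
  qed (use that m'3 in simp)
  have m'B: "m' u \<le> B u" if "u < n" for u
  proof (cases "u \<in> X1")
    case True
    then show ?thesis using m'1[OF True] X(2)[OF X1(1)[OF True]] by (simp add: second_def)
  qed (use better mB that le_trans in blast)
  have "stable m'"
    unfolding stable_def
  proof (intro conjI allI impI)
    fix u assume u: "u < n"
    show "slot u (m' u)"
    proof (cases "u \<in> X1")
      case False
      show ?thesis
      proof (cases "u \<in> (\<lambda>u. peer (S u)) ` X1")
        case True
        then obtain w where w: "w \<in> X1" "u = peer (S w)" by blast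
        then show ?thesis using m'2[OF w(1)] slot_peer[OF X1(4)[OF w(1)]] by simp
      qed (use False m'3 ms u in simp)
    qed (simp add: m'1 X1)
    show "m' (peer (m' u)) = opp (m' u)"
    proof (cases "u \<in> X1")
      case False
      show ?thesis
      proof (cases "u \<in> (\<lambda>u. peer (S u)) ` X1")
        case True
        then obtain w where w: "w \<in> X1" "u = peer (S w)" by blast
        then show ?thesis using m'2[OF w(1)] m'1[OF w(1)] slot_peer_opp[OF X1(4)[OF w(1)]]
          slot_opp_opp[OF X1(4)[OF w(1)]] by simp
      next
        case F: False
        have "peer (m u) \<notin> X1"
        proof
          assume a: "peer (m u) \<in> X1"
          then have "m u = opp (F (peer (m u)))"
            using ms[OF u] X1(3) slot_opp_opp by metis
          then have "u = peer (F (peer (m u)))" using ms(1)[OF u]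
            by (metis peer_def slot_own)
          with holder[OF a] F show False by blast
        qed
        moreover have "peer (m u) \<notin> (\<lambda>u. peer (S u)) ` X1"
        proof
          assume "peer (m u) \<in> (\<lambda>u. peer (S u)) ` X1"
          then obtain w where "w \<in> X1" "peer (m u) = peer (S w)" by blast
          from matched_first[OF this] obtain x where
            x: "x \<in> X1" "peer (m u) = peer (F x)" "m (peer (m u)) = opp (F x)" by blast
          then have "opp (m u) = opp (F x)" using ms[OF u] by simp
          then have "m u = F x" using ms(1)[OF u] pruned_first[OF pr X1(2)[OF x(1)]] slot_opp_opp
            by metis
          then have "u = x" using ms(1)[OF u] pruned_first[OF pr X1(2)[OF x(1)]] slot_own by metis
          with x False show False by simp
        qed
        ultimately show ?thesis using m'3 False F ms[OF u] by simp
      qed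
    qed (simp add: m'1 m'2)
  next
    fix u i assume i: "slot u i"
    \<comment> \<open>Below the second choice, only the old first choice was alive, and its receiver
      has improved strictly. Dead slots cannot block because \<open>m'\<close> respects
      \<open>B\<close>.\<close>
    have case1: "m' w \<le> j \<or> m' (peer j) \<le> opp j" if "w \<in> X1" "slot w j" for w j
    proof (cases "j < S w")
      case True
      show ?thesis
      proof (cases "j = F w")
        case True
        from holder[OF that(1), of "peer j"] True obtain x where x: "x \<in> X1" "peer j = peer (S x)"
          by blast
        then have "m' (peer j) < B (peer j)"
          using m'2[OF x(1)] second_not_worst[OF cl X1(2)[OF x(1)] X(2)[OF X1(1)[OF x(1)]]] by simp
        also have "B (peer j) = opp j" using True cl X1(2)[OF that(1)]
          by (simp add: closed_def settled_def)
        finally show ?thesis by simp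
      next
        case ne: False
        have "dead B j"
          using True ne that pruned_dead[OF pr that(2)] X(2)[OF X1(1)[OF that(1)]]
          by (cases "j < F w") (auto simp: second_def)
        then show ?thesis using m'B[OF peer_less[OF that(2)]] by (simp add: dead_def)
      qed
    qed (simp add: m'1 that)
    show "m' u \<le> i \<or> m' (peer i) \<le> opp i"
    proof (cases "u \<in> X1")
      case True
      then show ?thesis using case1 i by blast
    next
      case u: False
      show ?thesis
      proof (cases "peer i \<in> X1")
        case True
        then show ?thesis using case1[OF True slot_peer[OF i]]
          by (auto simp: slot_opp_opp[OF i] slot_peer_opp[OF i])
      next
        case False
        have "m u \<le> i \<or> m (peer i) \<le> opp i" using m i by (simp add: stable_def)
        then show ?thesis using better[OF u] better[OF False] by linarith
      qed
    qed
  qed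
  moreover have "m' v \<le> B' v" if v: "v < n" for v
  proof (cases "v \<in> (\<lambda>u. peer (S u)) ` X")
    case True
    then obtain u where u: "u \<in> X" "v = peer (S u)" by blast
    show ?thesis
    proof (cases "u \<in> X1")
      case False
      with u first_or[OF u(1)] have le: "m v \<le> opp (S u)" by (auto simp: X1_def)
      \<comment> \<open>Irreducibility excludes a partial shift here: a nonempty invariant
        \<open>X1\<close> would be all of \<open>X\<close>, although \<open>u\<close> is outside
        it.\<close>
      have "v \<notin> X1"
      proof
        assume vX: "v \<in> X1"
        then have "X1 = X" using irred[of X1] g by (auto simp: X1_def)
        with u False show False by simp
      qed
      with better le u B'(1) show ?thesis by (metis le_trans)
    qed (simp add: u B' m'2)
  qed (use m'B v B'(2) in simp)
  ultimately show ?thesis by blast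
qed

lemma pruned': "pruned F' B'"
  unfolding pruned_def
proof (intro conjI allI impI)
  fix u assume u: "u < n"
  show "slot u (F' u)"
    using pruned_first[OF pr u] Sslot[of u] F'[of u] by (cases "u \<in> X") auto
  show "slot u (B' u)"
  proof (cases "u \<in> (\<lambda>u. peer (S u)) ` X")
    case True
    then obtain x where "x \<in> X" "u = peer (S x)" by blast
    then show ?thesis using B'(1)[of x] slot_peer[OF Sslot[of x]] by simp
  qed (use pruned_worst[OF pr u] B'(2) in simp)
  fix i assume "lo u \<le> i" "i < F' u"
  then show "dead B' i" using dead_F'[of u i] \<open>slot u (F' u)\<close> by (simp add: slot_def)
next
  assume "\<exists>m. stable m"
  with pr obtain m where "stable m" "\<And>u. u < n \<Longrightarrow> m u \<le> B u" unfolding pruned_def by blast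
  then show "\<exists>m. stable m \<and> (\<forall>u<n. m u \<le> B' u)" by (rule solvable)
qed

section \<open>The table after a successful elimination\<close>

context
  assumes le: "\<And>u. u < n \<Longrightarrow> F' u \<le> B' u"
begin

lemma closed': "closed F' B'"
  by (simp add: closed_def pruned' settled' le)

lemma single_stays: "u < n \<Longrightarrow> F u = B u \<Longrightarrow> F' u = B' u"
  using B_le[of u] F_le[of u] le[of u] by simp

text \<open>If the bound falls below the second choice, it lands on a slot that is alive in a closed
  table, and all slots between first and second choice are dead.\<close>

lemma becomes_single:
  assumes u: "u < n" "u \<notin> X" and s: "second F B u (S u)" "B' u < S u"
  shows "F' u = B' u"
proof (rule ccontr)
  assume "F' u \<noteq> B' u"
  with le[OF u(1)] F'(2)[OF u(2)] have "F u < B' u" by simp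
  with s have "dead B (B' u)" by (simp add: second_def)
  with worst_alive[OF closed' u(1)] dead_mono show False by blast
qed

text \<open>A link can change only if its receiver gets a new bound, and then the link would lead
  into the rotation.\<close>

lemma link_kept:
  assumes u: "u < n" "u \<notin> X" and s: "second F B u (S u)" and w: "succ B (S u) \<notin> X"
  shows "F' u = B' u \<or> second F' B' u (S u) \<and> succ B' (S u) = succ B (S u)"
proof (cases "B' u < S u")
  case False
  have "peer (S u) \<notin> (\<lambda>u. peer (S u)) ` X"
  proof
    assume "peer (S u) \<in> (\<lambda>u. peer (S u)) ` X"
    then obtain x where "x \<in> X" "peer (S u) = peer (S x)" by blast
    then have "succ B (S u) = succ B (S x)" "succ B (S x) \<in> X"
      using X(3) by (auto simp only: succ_def)
    with w show False by simp
  qed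
  then have "B' (peer (S u)) = B (peer (S u))" using B'(2) by blast
  then have "dead B' (S u) = dead B (S u)" "succ B' (S u) = succ B (S u)"
    by (simp_all add: dead_def succ_def)
  with False s F'(2)[OF u(2)] show ?thesis by (auto simp: second_def intro: dead_mono)
qed (use becomes_single[OF u s] in simp)

text \<open>A single entry of \<open>u\<close> means that its receiver, the second choice of
  \<open>t\<close>, has moved its first pointer up to its old bound. This bound is worse than
  \<open>opp (S t)\<close>, so the second choice of \<open>t\<close> is gone.\<close>

lemma single_down:
  assumes t: "t < n" "t \<notin> X" and s: "second F B t (S t)" and u: "succ B (S t) = u" "u \<notin> X"
    and single: "F' u = B' u"
  shows "F' t = B' t"
proof (rule becomes_single[OF t s])
  let ?v = "peer (S t)"
  have un: "u < n" using succ_less[OF cl t(1) s] u by simp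
  have st: "slot t (S t)" using second_slot[OF cl t(1) s] .
  have e: "F u = opp (B ?v)" "peer (F u) = ?v" using first_succ[OF cl t(1) s] u by auto
  have "F' (peer (B' u)) = opp (B' u)" using closed_holder(2)[OF closed' un] .
  then have "F' ?v = opp (opp (B ?v))" using single F'(2)[OF u(2)] e by simp
  also have "\<dots> = B ?v" using slot_opp_opp[OF pruned_worst[OF pr peer_less[OF st]]] .
  finally have "opp (S t) < F' ?v" using second_not_worst[OF cl t(1) s] by simp
  from dead_F'[OF slot_peer[OF st] this] show "B' t < S t"
    by (simp add: dead_def slot_opp_opp[OF st] slot_peer_opp[OF st])
qed

end

end

section \<open>Second choices and the search path\<close>

context roommates
begin

lemma pruned_initial:
  assumes "\<And>u. u < n \<Longrightarrow> F u = lo u" "\<And>u. u < n \<Longrightarrow> B u = hi u"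
  shows "pruned F B"
  using assms by (auto simp: pruned_def slot_def lo_le_hi stable_def)

text \<open>\<open>S u\<close> may lag behind \<open>F u\<close>, in which case the condition on
  dead slots is vacuous. This makes the predicate survive eliminations without any update of
  \<open>S\<close>.\<close>

definition seeking :: "(nat \<Rightarrow> nat) \<Rightarrow> (nat \<Rightarrow> nat) \<Rightarrow> (nat \<Rightarrow> nat) \<Rightarrow> bool" where
  "seeking F B S \<longleftrightarrow> (\<forall>u<n. slot u (S u) \<and> (\<forall>i. F u < i \<longrightarrow> i < S u \<longrightarrow> dead B i))"

lemma seeking_le:
  assumes T: "closed F B" "u < n" and s: "seeking F B S" "F u < B u" "F u < S u"
  shows "S u \<le> B u"
  using worst_alive[OF T] s T by (force simp: seeking_def not_less)

lemma seeking_first: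
  assumes T: "closed F B" "u < n" and s: "seeking F B S" "F u < B u"
  shows "seeking F B (S(u := F u + 1))"
  using s pruned_first[of F B u] pruned_worst[of F B u] T
  by (auto simp: seeking_def slot_def closed_def)

text \<open>\<open>B u\<close> is alive and acts as a sentinel, which is why the loop of
  \<open>seek\<close> tests only for dead slots.\<close>

lemma seeking_next:
  assumes T: "closed F B" "u < n" and s: "seeking F B S" "F u < B u" "F u < S u"
    and d: "dead B (S u)"
  shows "S u < B u" "seeking F B (S(u := S u + 1))"
proof -
  have "S u \<le> B u" using seeking_le[OF T s] .
  moreover have "S u \<noteq> B u" using worst_alive[OF T] d by auto
  ultimately show l: "S u < B u" by simp
  then show "seeking F B (S(u := S u + 1))"
    using s d pruned_worst[of F B u] T by (auto simp: seeking_def slot_def closed_def less_Suc_eq)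
qed

lemma seeking_found:
  assumes T: "closed F B" "u < n" and s: "seeking F B S" "F u < B u" "F u < S u"
    and d: "\<not> dead B (S u)"
  shows "second F B u (S u)"
  using seeking_le[OF T s] assms by (auto simp: seeking_def second_def)

text \<open>Eliminating a rotation may reduce the list of a node on the search path to a single entry,
  but only together with the lists of all nodes below it. As a node with a single entry is never
  reached again, the rest of the path remains usable.\<close>

definition search_path ::
  "(nat \<Rightarrow> nat) \<Rightarrow> (nat \<Rightarrow> nat) \<Rightarrow> (nat \<Rightarrow> nat) \<Rightarrow> (nat \<Rightarrow> nat) \<Rightarrow> nat \<Rightarrow> bool" where
  "search_path F B S T k \<longleftrightarrow>
     (\<forall>i<k. T i < n) \<and> inj_on T {..<k} \<and>
     (\<forall>i. i + 1 < k \<longrightarrow> F (T i) = B (T i) \<or>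
        second F B (T i) (S (T i)) \<and> succ B (S (T i)) = T (i + 1)) \<and>
     (\<forall>i. i + 2 < k \<longrightarrow> F (T (i + 1)) = B (T (i + 1)) \<longrightarrow> F (T i) = B (T i))"

lemma search_path_node: "search_path F B S T k \<Longrightarrow> i < k \<Longrightarrow> T i < n"
  by (simp add: search_path_def)

lemma search_path_neq: "search_path F B S T k \<Longrightarrow> i < k \<Longrightarrow> j < k \<Longrightarrow> i \<noteq> j \<Longrightarrow> T i \<noteq> T j"
  by (auto simp: search_path_def inj_on_def)

lemma search_path_start: "c < n \<Longrightarrow> search_path F B S (T(0 := c)) 1"
  by (simp add: search_path_def inj_on_def)

lemma search_path_pop: "search_path F B S T k \<Longrightarrow> k' \<le> k \<Longrightarrow> search_path F B S T k'"
  by (auto simp: search_path_def intro: inj_on_subset)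

lemma search_path_second:
  assumes "search_path F B S T (Suc k)"
  shows "search_path F B (S(T k := i)) T (Suc k)"
proof -
  have "T j \<noteq> T k" if "j < k" for j using search_path_neq[OF assms] that by auto
  then show ?thesis using assms by (auto simp: search_path_def)
qed

lemma search_path_push:
  assumes p: "search_path F B S T (Suc k)" and s: "second F B (T k) (S (T k))"
    and x: "succ B (S (T k)) = x" "x < n" "x \<notin> T ` {..<Suc k}"
  shows "search_path F B S (T(Suc k := x)) (Suc (Suc k))"
  unfolding search_path_def
proof (intro conjI allI impI)
  let ?T = "T(Suc k := x)"
  show "?T i < n" if "i < Suc (Suc k)" for i using p that x(2) by (auto simp: search_path_def)
  show "inj_on ?T {..<Suc (Suc k)}"
  proof (rule inj_onI)
    fix i j assume ij: "i \<in> {..<Suc (Suc k)}" "j \<in> {..<Suc (Suc k)}" "?T i = ?T j"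
    show "i = j"
    proof (cases "i = Suc k \<or> j = Suc k")
      case True
      then show ?thesis using ij x(3) by (auto simp: less_Suc_eq split: if_splits)
    next
      case False
      with ij search_path_neq[OF p, of i j] show ?thesis by auto
    qed
  qed
  show "F (?T i) = B (?T i) \<or> second F B (?T i) (S (?T i)) \<and> succ B (S (?T i)) = ?T (i + 1)"
    if "i + 1 < Suc (Suc k)" for i
  proof (cases "i = k")
    case False
    with that p show ?thesis by (auto simp: search_path_def)
  qed (use s x in simp)
  show "F (?T i) = B (?T i)" if "i + 2 < Suc (Suc k)" "F (?T (i + 1)) = B (?T (i + 1))" for i
  proof (cases "i + 1 = k")
    case True
    with that s show ?thesis by (auto simp: second_def)
  next
    case False
    with that p show ?thesis by (auto simp: search_path_def)
  qed
qed

text \<open>\<open>T j\<close> is reached by a link and so is not single. Single nodes are closed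
  downwards on the path, so no node above \<open>T j\<close> is single, and all links of the cycle
  are genuine.\<close>

lemma search_path_links:
  assumes cl: "closed F B" and p: "search_path F B S T (Suc k)" and s: "second F B (T k) (S (T k))"
    and c: "succ B (S (T k)) = T j" "j \<le> k" and i: "j \<le> i" "i \<le> k"
  shows "second F B (T i) (S (T i))" "i < k \<Longrightarrow> succ B (S (T i)) = T (Suc i)"
proof -
  have tk: "T k < n" using search_path_node[OF p] by simp
  have ns: "F (T i) \<noteq> B (T i)" if "j \<le> i" "i \<le> k" for i
    using that
  proof (induction i rule: dec_induct)
    case base
    show ?case using succ_not_single[OF cl tk s] c by simp
  next
    case (step i)
    show ?case
    proof (cases "Suc i = k")
      case True
      with s show ?thesis by (auto simp: second_def)
    next
      case False
      with step p show ?thesis by (auto simp: search_path_def)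
    qed
  qed
  show "second F B (T i) (S (T i))"
    using ns[OF i] p s i by (cases "i = k") (auto simp: search_path_def le_less)
  show "i < k \<Longrightarrow> succ B (S (T i)) = T (Suc i)"
    using ns[OF i] p s i by (auto simp: search_path_def)
qed

lemma search_path_rotation:
  assumes cl: "closed F B" and p: "search_path F B S T (Suc k)" and s: "second F B (T k) (S (T k))"
    and c: "succ B (S (T k)) = T j" "j \<le> k"
    and F': "\<And>u. u \<in> T ` {j..k} \<Longrightarrow> F' u = S u" "\<And>u. u \<notin> T ` {j..k} \<Longrightarrow> F' u = F u"
    and B': "\<And>u. u \<in> T ` {j..k} \<Longrightarrow> B' (peer (S u)) = opp (S u)"
      "\<And>v. v \<notin> (\<lambda>u. peer (S u)) ` T ` {j..k} \<Longrightarrow> B' v = B v"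
  shows "rotation n lo hi own opp F B S F' B' (T ` {j..k})"
proof (rule rotation.intro[OF roommates_axioms], unfold_locales)
  let ?g = "\<lambda>u. succ B (S u)"
  note L = search_path_links[OF cl p s c]
  show "closed F B" by fact
  show "T ` {j..k} \<subseteq> {..<n}" using search_path_node[OF p] by auto
  show "second F B u (S u)" if "u \<in> T ` {j..k}" for u using L(1) that by auto
  show "?g ` T ` {j..k} = T ` {j..k}"
  proof
    show "?g ` T ` {j..k} \<subseteq> T ` {j..k}"
    proof clarify
      fix i assume "i \<in> {j..k}"
      then show "?g (T i) \<in> T ` {j..k}"
        using L(2)[of i] c by (cases "i = k") auto
    qed
    show "T ` {j..k} \<subseteq> ?g ` T ` {j..k}"
    proof clarify
      fix i assume i: "i \<in> {j..k}"
      show "T i \<in> ?g ` T ` {j..k}"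
      proof (cases "i = j")
        case True
        then show ?thesis using c by (metis atLeastAtMost_iff imageI order_refl)
      next
        case False
        with i obtain i' where "i = Suc i'" "j \<le> i'" by (cases i) auto
        then show ?thesis using i L(2)[of i'] by (intro image_eqI[of _ ?g "T i'"]) auto
      qed
    qed
  qed
  \<comment> \<open>From any of its nodes an invariant set climbs to the top of the path, jumps to
    \<open>T j\<close>, and climbs through the whole cycle.\<close>
  show "Z = T ` {j..k}" if Z: "Z \<subseteq> T ` {j..k}" "Z \<noteq> {}" "?g ` Z = Z" for Z
  proof -
    have step: "T (Suc i) \<in> Z" if "T i \<in> Z" "j \<le> i" "i < k" for i
      using L(2)[of i] that Z(3) by (metis imageI less_imp_le_nat)
    have up: "T i' \<in> Z" if "T i \<in> Z" "j \<le> i" "i \<le> i'" "i' \<le> k" for i i'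
      using that(3,4)
    proof (induction i' rule: dec_induct)
      case (step i')
      then show ?case using \<open>\<And>i. \<lbrakk>T i \<in> Z; j \<le> i; i < k\<rbrakk> \<Longrightarrow> T (Suc i) \<in> Z\<close> that(2) by simp
    qed (use that in simp)
    from Z obtain i where i: "i \<in> {j..k}" "T i \<in> Z" by blast
    then have "T k \<in> Z" using up by auto
    then have "T j \<in> Z" using c Z(3) by (metis imageI)
    then show ?thesis using up[of j] Z(1) by auto
  qed
qed (use F' B' in auto)

end

context rotation
begin

text \<open>The node below the rotation becomes the new top, so its link into the rotation is no
  longer required. The remaining links avoid the rotation: \<open>link_kept\<close> preserves them
  and \<open>single_down\<close> the closure of single nodes.\<close>

lemma search_path_kept:
  assumes le: "\<And>u. u < n \<Longrightarrow> F' u \<le> B' u"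
    and p: "search_path F B S T k" and j: "j \<le> k" and X_eq: "X = T ` {j..<k}"
  shows "search_path F' B' S T j"
  unfolding search_path_def
proof (intro conjI allI impI)
  have out: "T i \<notin> X" if i: "i < j" for i
  proof
    assume "T i \<in> X"
    then obtain i' where "T i = T i'" "j \<le> i'" "i' < k" by (auto simp: X_eq)
    with search_path_neq[OF p, of i i'] i show False by simp
  qed
  show tn: "T i < n" if "i < j" for i using search_path_node[OF p] that j by simp
  show "inj_on T {..<j}" using p j by (auto simp: search_path_def intro: inj_on_subset)
  show "F' (T i) = B' (T i) \<or> second F' B' (T i) (S (T i)) \<and> succ B' (S (T i)) = T (i + 1)"
    if i: "i + 1 < j" for i
  proof -
    have "F (T i) = B (T i) \<or> second F B (T i) (S (T i)) \<and> succ B (S (T i)) = T (i + 1)"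
      using p i j by (auto simp: search_path_def)
    then show ?thesis
      using single_stays[OF le tn[of i]] link_kept[OF le tn[of i] out[of i]] out[of "i + 1"] i
        by auto
  qed
  show "F' (T i) = B' (T i)" if i: "i + 2 < j" and s: "F' (T (i + 1)) = B' (T (i + 1))" for i
  proof -
    have "F (T i) = B (T i) \<or> second F B (T i) (S (T i)) \<and> succ B (S (T i)) = T (i + 1)"
      using p i j by (auto simp: search_path_def)
    then show ?thesis
      using single_stays[OF le tn[of i]] single_down[OF le tn[of i] out[of i]] out[of "i + 1"] i s
        by auto
  qed
qed

lemma seeking_kept: "seeking F B S \<Longrightarrow> seeking F' B' S"
  using F_le F' dead_mono unfolding seeking_def by (metis le_less_trans less_asym)

text \<open>Valid for failing eliminations too: a node of the rotation had
  \<open>F u < S u \<le> B u\<close>, so even the truncated difference drops.\<close>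

lemma gap_drop: "(\<Sum>u<n. B' u - F' u) + card X \<le> (\<Sum>u<n. B u - F u)"
proof -
  have "card X = (\<Sum>u<n. if u \<in> X then 1 else 0)"
    using X(1) by (simp add: sum.If_cases inf_absorb2)
  moreover have "(\<Sum>u<n. (B' u - F' u) + (if u \<in> X then 1 else 0)) \<le> (\<Sum>u<n. B u - F u)"
  proof (rule sum_mono)
    fix u assume "u \<in> {..<n}"
    then show "(B' u - F' u) + (if u \<in> X then 1 else 0) \<le> B u - F u"
      using F_le[of u] B_le[of u] X(2)[of u] F'(1)[of u] by (auto simp: second_def)
  qed
  ultimately show ?thesis by (simp add: sum.distrib)
qed

end

section \<open>Irving's algorithm as a program\<close>

notation Seq (infixr ";;" 60)

text \<open>One step in a chain of proposals: a displaced proposer carries on, and the chain ends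
  when a receiver held nothing before. The case of equality arises when a node that holds nothing
  reaches its own loop.\<close>

definition propose_step :: com where
  "propose_step =
    (Assign ''j'' (Load ''opp'' (Load ''first'' (Reg ''x'')));;
     Assign ''v'' (Load ''own'' (Reg ''j''));;
     Cond (Less (Load ''worst'' (Reg ''v'')) (Reg ''j''))
       (Store ''first'' (Reg ''x'') (Plus (Load ''first'' (Reg ''x'')) (Const 1)))
       (Cond (Less (Reg ''j'') (Load ''worst'' (Reg ''v'')))
         (Assign ''q'' (Load ''worst'' (Reg ''v''));;
          Store ''worst'' (Reg ''v'') (Reg ''j'');;
          Cond (Equal (Load ''opp'' (Reg ''q'')) (Reg ''q''))
            (Assign ''run'' (Const 0))
            (Assign ''x'' (Load ''own'' (Load ''opp'' (Reg ''q'')))))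
         (Assign ''run'' (Const 0))))"

definition propose_node :: com where
  "propose_node =
    (Assign ''x'' (Reg ''c'');;
     Assign ''run'' (Const 1);;
     While (Equal (Reg ''run'') (Const 1)) propose_step;;
     Assign ''c'' (Plus (Reg ''c'') (Const 1)))"

definition propose_all :: com where
  "propose_all = (Assign ''c'' (Const 0);; While (Less (Reg ''c'') (Reg ''n'')) propose_node)"

definition seek :: com where
  "seek =
    (Cond (Less (Load ''first'' (Reg ''u'')) (Load ''second'' (Reg ''u'')))
       Skip
       (Store ''second'' (Reg ''u'') (Plus (Load ''first'' (Reg ''u'')) (Const 1)));;
     While (Less (Load ''worst'' (Load ''own'' (Load ''opp'' (Load ''second'' (Reg ''u'')))))
         (Load ''opp'' (Load ''second'' (Reg ''u''))))
       (Store ''second'' (Reg ''u'') (Plus (Load ''second'' (Reg ''u'')) (Const 1))))"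

text \<open>\<open>x\<close> still contains the repeated node, which is the lowest one of the cycle;
  popping it ends the loop.\<close>

definition pop_step :: com where
  "pop_step =
    (Assign ''k'' (Minus (Reg ''k'') (Const 1));;
     Assign ''y'' (Load ''path'' (Reg ''k''));;
     Store ''mark'' (Reg ''y'') (Const 0);;
     Store ''first'' (Reg ''y'') (Load ''second'' (Reg ''y''));;
     Assign ''j'' (Load ''opp'' (Load ''second'' (Reg ''y'')));;
     Assign ''v'' (Load ''own'' (Reg ''j''));;
     Store ''worst'' (Reg ''v'') (Reg ''j'');;
     Cond (Less (Load ''worst'' (Reg ''y'')) (Load ''first'' (Reg ''y''))) (Assign ''fail'' (Const
       1)) Skip;;
     Cond (Less (Load ''worst'' (Reg ''v'')) (Load ''first'' (Reg ''v''))) (Assign ''fail'' (Const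
       1)) Skip;;
     Cond (Equal (Reg ''y'') (Reg ''x'')) (Assign ''run'' (Const 0)) Skip)"

definition eliminate :: com where
  "eliminate = (Assign ''run'' (Const 1);; While (Equal (Reg ''run'') (Const 1)) pop_step)"

definition search_step :: com where
  "search_step =
     Cond (Equal (Reg ''k'') (Const 0))
       (Cond (Equal (Load ''first'' (Reg ''c'')) (Load ''worst'' (Reg ''c'')))
         (Assign ''c'' (Plus (Reg ''c'') (Const 1)))
         (Store ''path'' (Const 0) (Reg ''c'');;
          Store ''mark'' (Reg ''c'') (Const 1);;
          Assign ''k'' (Const 1)))
       (Assign ''u'' (Load ''path'' (Minus (Reg ''k'') (Const 1)));;
        Cond (Equal (Load ''first'' (Reg ''u'')) (Load ''worst'' (Reg ''u'')))
          (Store ''mark'' (Reg ''u'') (Const 0);;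
           Assign ''k'' (Minus (Reg ''k'') (Const 1)))
          (seek;;
           Assign ''x'' (Load ''own'' (Load ''opp'' (Load ''worst'' (Load ''own'' (Load ''opp''
             (Load ''second'' (Reg ''u'')))))));;
           Cond (Equal (Load ''mark'' (Reg ''x'')) (Const 0))
             (Store ''path'' (Reg ''k'') (Reg ''x'');;
              Store ''mark'' (Reg ''x'') (Const 1);;
              Assign ''k'' (Plus (Reg ''k'') (Const 1)))
             eliminate))"

definition search_all :: com where
  "search_all =
    (Assign ''c'' (Const 0);; Assign ''k'' (Const 0);; Assign ''fail'' (Const 0);;
     While (Conj (Less (Reg ''c'') (Reg ''n'')) (Equal (Reg ''fail'') (Const 0))) search_step)"

lemma gap_first:
  fixes F B :: "nat \<Rightarrow> nat"
  assumes "x < n" "F x < B x"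
  shows "(\<Sum>u<n. B u - (F(x := Suc (F x))) u) + 1 = (\<Sum>u<n. B u - F u)"
proof -
  have "(\<Sum>u<n. B u - F' u) = (B x - F' x) + (\<Sum>u\<in>{..<n} - {x}. B u - F' u)" for F'
    using assms by (intro sum.remove) auto
  moreover have "(\<Sum>u\<in>{..<n} - {x}. B u - (F(x := Suc (F x))) u) = (\<Sum>u\<in>{..<n} - {x}. B u - F u)"
    by (rule sum.cong) auto
  ultimately show ?thesis using assms by simp
qed

lemma gap_worst:
  fixes F B :: "nat \<Rightarrow> nat"
  assumes "v < n" "F v \<le> j" "j < B v"
  shows "(\<Sum>u<n. (B(v := j)) u - F u) + 1 \<le> (\<Sum>u<n. B u - F u)"
proof -
  have "(\<Sum>u<n. B' u - F u) = (B' v - F v) + (\<Sum>u\<in>{..<n} - {v}. B' u - F u)" for B' :: "nat \<Rightarrow> nat"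
    using assms by (intro sum.remove) auto
  moreover have "(\<Sum>u\<in>{..<n} - {v}. (B(v := j)) u - F u) = (\<Sum>u\<in>{..<n} - {v}. B u - F u)"
    by (rule sum.cong) auto
  ultimately show ?thesis using assms by simp
qed

context roommates
begin

section \<open>Correctness and cost of the proposal phase\<close>

definition instance_state :: "state \<Rightarrow> bool" where
  "instance_state s \<longleftrightarrow> reg s ''n'' = n \<and> arr s ''own'' = own \<and> arr s ''opp'' = opp"

definition gap :: "state \<Rightarrow> nat" where
  "gap s = (\<Sum>u<n. arr s ''worst'' u - arr s ''first'' u)"

definition propose_inv :: "nat \<Rightarrow> (nat \<Rightarrow> nat) \<Rightarrow> (nat \<Rightarrow> nat) \<Rightarrow> state \<Rightarrow> bool" where
  "propose_inv c S K s \<longleftrightarrow>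
     instance_state s \<and> arr s ''second'' = S \<and> arr s ''mark'' = K \<and> reg s ''c'' = c \<and> reg s ''x''
       < n \<and>
     reg s ''run'' \<le> 1 \<and>
     proposing (arr s ''first'') (arr s ''worst'') \<and>
     (\<forall>u\<le>c. u < n \<longrightarrow> u \<noteq> reg s ''x'' \<or> reg s ''run'' = 0 \<longrightarrow> settled (arr s ''first'') (arr s
       ''worst'') u)"

text \<open>Each step closes the gap by at least one or clears \<open>run\<close>, so
  \<open>50\<close> units for either event cover its cost. The summand \<open>3\<close> is the loop
  test.\<close>

lemma propose_step:
  assumes I: "propose_inv c S K s" and r: "reg s ''run'' = 1"
  shows "wp propose_step
      (\<lambda>t s'. propose_inv c S K s' \<and> 3 + t + (50 * gap s' + 50 * reg s' ''run'') \<le> 50 * gap s + 50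
        * reg s ''run'') s"
proof -
  let ?F = "arr s ''first''" and ?B = "arr s ''worst''" and ?x = "reg s ''x''"
  let ?i = "?F ?x" let ?j = "opp ?i" let ?v = "own ?j" let ?q = "?B ?v"
  have v: "?v = peer ?i" by (simp add: peer_def)
  have st: "reg s ''n'' = n" "arr s ''own'' = own" "arr s ''opp'' = opp"
    and P: "proposing ?F ?B" and x: "?x < n"
    and set: "\<And>u. u \<le> c \<Longrightarrow> u < n \<Longrightarrow> u \<noteq> ?x \<Longrightarrow> settled ?F ?B u"
    and rest: "arr s ''second'' = S" "arr s ''mark'' = K" "reg s ''c'' = c"
    using I r by (auto simp: propose_inv_def instance_state_def)
  have pr: "pruned ?F ?B" using P by (simp add: proposing_def)
  have six: "slot ?x ?i" using pruned_first[OF pr x] .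
  have vn: "?v < n" using peer_less[OF six] v by simp
  consider (dead) "?q < ?j" | (accept) "?j < ?q" | (held) "?q = ?j" by linarith
  then show ?thesis
  proof cases
    case dead
    then have d: "dead ?B ?i" by (simp add: dead_def peer_def)
    have l: "?i < ?B ?x" using dead_advance[OF P x d] .
    have "settled (?F(?x := Suc ?i)) ?B u" if "u \<le> c" "u < n" "u \<noteq> ?x" for u
      using set[OF that] that(3) by (simp add: settled_def)
    with dead st rest x r proposing_advance[OF P x d] gap_first[of ?x n ?F ?B, OF x l] show ?thesis
      by (simp add: propose_step_def propose_inv_def instance_state_def gap_def)
  next
    case accept
    then have a: "?j < ?B (peer ?i)" using v by simp
    note pp = proposing_propose[OF P x a, folded v]
    note g = gap_worst[of ?v n ?F ?j ?B, OF vn pp(2) accept]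
    note se = settled_propose[OF P x a, folded v]
    have s2: "settled ?F (?B(?v := ?j)) u"
      if "u \<le> c" "u < n" "u = peer ?q \<longrightarrow> ?q = hi ?v" for u
      using se[OF that(2)] set[OF that(1,2)] that(3) by blast
    show ?thesis
    proof (cases "opp ?q = ?q")
      case True
      \<comment> \<open>The program recognises the loop by \<open>opp q = q\<close>. Any other
        self-opposite held slot would be the first choice of the receiver itself, but that one does
        not lie beyond the slot just offered.\<close>
      have "?q = hi ?v"
      proof (rule ccontr)
        assume "?q \<noteq> hi ?v"
        with P vn have "?F (peer ?q) = opp ?q" by (auto simp: proposing_def)
        moreover have "peer ?q = ?v" using True slot_own[OF pruned_worst[OF pr vn]]
          by (simp add: peer_def)
        ultimately show False using pp(2) accept True by simp
      qed
      then have "\<forall>u\<le>c. u < n \<longrightarrow> settled ?F (?B(?v := ?j)) u" using s2 by blast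
      with accept st rest x r pp(1) g True show ?thesis
        by (simp add: propose_step_def propose_inv_def instance_state_def gap_def)
    next
      case False
      have "own (opp ?q) < n" using peer_less[OF pruned_worst[OF pr vn]] by (simp add: peer_def)
      moreover have "settled ?F (?B(?v := ?j)) u" if "u \<le> c" "u < n" "u \<noteq> own (opp ?q)" for u
        using s2 that by (simp add: peer_def)
      ultimately show ?thesis using accept st rest x r pp(1) g False
        by (simp add: propose_step_def propose_inv_def instance_state_def gap_def)
    qed
  next
    case held
    then have "settled ?F ?B ?x" by (simp add: settled_def peer_def)
    with set have "\<And>u. u \<le> c \<Longrightarrow> u < n \<Longrightarrow> settled ?F ?B u" by blast
    with held st rest x r P show ?thesis
      by (simp add: propose_step_def propose_inv_def instance_state_def gap_def)
  qed
qed

lemma propose_loop: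
  assumes "propose_inv c S K s"
  shows "wp (While (Equal (Reg ''run'') (Const 1)) propose_step)
    (\<lambda>t s'. propose_inv c S K s' \<and> reg s' ''run'' = 0 \<and>
      t + 50 * gap s' \<le> 50 * gap s + 50 * reg s ''run'' + 3) s"
proof (rule wp_While_strong[of "propose_inv c S K" s _ _ "\<lambda>s. 50 * gap s + 50 * reg s ''run''"])
  show "propose_inv c S K s" by fact
  show "wp propose_step (\<lambda>t s'. propose_inv c S K s' \<and> bcost (Equal (Reg ''run'') (Const 1)) + t +
      (50 * gap s' + 50 * reg s' ''run'') \<le> 50 * gap s + 50 * reg s ''run'') s"
    if "propose_inv c S K s" "bval (Equal (Reg ''run'') (Const 1)) s" for s
    using propose_step[OF that(1)] that(2) by simp
next
  fix t s'
  assume "propose_inv c S K s'" "\<not> bval (Equal (Reg ''run'') (Const 1)) s'"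
    "t + (50 * gap s' + 50 * reg s' ''run'')
      \<le> 50 * gap s + 50 * reg s ''run'' + bcost (Equal (Reg ''run'') (Const 1))"
  moreover from this have "reg s' ''run'' = 0" by (simp add: propose_inv_def)
  ultimately show "propose_inv c S K s' \<and> reg s' ''run'' = 0 \<and>
      t + 50 * gap s' \<le> 50 * gap s + 50 * reg s ''run'' + 3" by simp
qed

lemma propose_all:
  assumes s: "instance_state s" "arr s ''second'' = S" "arr s ''mark'' = K"
    and init: "\<And>u. u < n \<Longrightarrow> arr s ''first'' u = lo u" "\<And>u. u < n \<Longrightarrow> arr s ''worst'' u = hi u"
  shows "wp propose_all (\<lambda>t s'. instance_state s' \<and> arr s' ''second'' = S \<and> arr s' ''mark'' = K \<and>
      closed (arr s' ''first'') (arr s' ''worst'') \<and> t + 50 * gap s' \<le> 50 * gap s + 100 * n + 10) s"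
proof -
  define I where "I s \<longleftrightarrow> instance_state s \<and> arr s ''second'' = S \<and> arr s ''mark'' = K \<and>
    reg s ''c'' \<le> n \<and>
     proposing (arr s ''first'') (arr s ''worst'') \<and>
     (\<forall>u<reg s ''c''. settled (arr s ''first'') (arr s ''worst'') u)" for s
  have "proposing (arr s ''first'') (arr s ''worst'')"
    using init pruned_initial[OF init] by (simp add: proposing_def lo_le_hi)
  then have I0: "I (assign ''c'' 0 s)" using s by (simp add: I_def instance_state_def)
  have step: "wp propose_node
      (\<lambda>t s'. I s' \<and> bcost (Less (Reg ''c'') (Reg ''n'')) + t + (50 * gap s' + 100 * (n - reg s'
        ''c''))
        \<le> 50 * gap s + 100 * (n - reg s ''c'')) s"
    if I: "I s" and bv: "bval (Less (Reg ''c'') (Reg ''n'')) s" for s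
  proof -
    have b: "reg s ''c'' < n" using I bv by (simp add: I_def instance_state_def)
    let ?s = "assign ''run'' (Suc 0) (assign ''x'' (reg s ''c'') s)"
    have "propose_inv (reg s ''c'') S K ?s"
      using I b by (auto simp: I_def propose_inv_def instance_state_def)
    from propose_loop[OF this] show ?thesis
      unfolding propose_node_def
      by (simp, elim wp_mono) (use b in \<open>auto simp: I_def propose_inv_def instance_state_def
        gap_def less_Suc_eq_le\<close>)
  qed
  have "wp (While (Less (Reg ''c'') (Reg ''n'')) propose_node) (\<lambda>t s'. instance_state s' \<and>
      arr s' ''second'' = S \<and> arr s' ''mark'' = K \<and> closed (arr s' ''first'') (arr s' ''worst'') \<and>
      2 + t + 50 * gap s' \<le> 50 * gap s + 100 * n + 10) (assign ''c'' 0 s)"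
    by (rule wp_While_strong[OF I0 step])
      (auto simp: I_def instance_state_def closed_def proposing_def gap_def)
  then show ?thesis by (simp add: propose_all_def)
qed

text \<open>The distance that the second-choice pointers can still travel. It pays for
  \<open>seek\<close> and is untouched by eliminations, which never move these pointers.\<close>

definition slack :: "(nat \<Rightarrow> nat) \<Rightarrow> nat" where
  "slack S = (\<Sum>u<n. Suc (hi u) - S u)"

lemma slack_advance: "seeking F B S \<Longrightarrow> u < n \<Longrightarrow> slack (S(u := Suc (S u))) + 1 = slack S"
  using gap_first[of u n S "\<lambda>u. Suc (hi u)"]
    by (simp add: slack_def seeking_def slot_def less_Suc_eq_le)

lemma slack_antimono: "S u \<le> i \<Longrightarrow> slack (S(u := i)) \<le> slack S"
  unfolding slack_def by (intro sum_mono) auto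

lemma seek:
  assumes s: "instance_state s" "arr s ''first'' = F" "arr s ''worst'' = B" "arr s ''second'' = S"
      "reg s ''u'' = u"
    and T: "closed F B" "u < n" and S: "seeking F B S" "F u < B u"
  shows "wp seek (\<lambda>t s'. \<exists>i. reg s' = reg s \<and> arr s' = (arr s)(''second'' := S(u := i)) \<and>
    seeking F B (S(u := i)) \<and> second F B u i \<and> t + 20 * slack (S(u := i)) \<le> 20 * slack S + 30) s"
proof -
  let ?b = "Less (Load ''worst'' (Load ''own'' (Load ''opp'' (Load ''second'' (Reg ''u'')))))
         (Load ''opp'' (Load ''second'' (Reg ''u'')))"
  let ?c = "Store ''second'' (Reg ''u'') (Plus (Load ''second'' (Reg ''u'')) (Const 1))"
  define I where "I s' \<longleftrightarrow> (\<exists>i. reg s' = reg s \<and> arr s' = (arr s)(''second'' := S(u := i)) \<and>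
    seeking F B (S(u := i)) \<and> F u < i)" for s'
  let ?\<Phi> = "\<lambda>s. 20 * slack (arr s ''second'')"
  have step: "wp ?c (\<lambda>t s'. I s' \<and> bcost ?b + t + ?\<Phi> s' \<le> ?\<Phi> s0) s0" if I: "I s0"
    and b: "bval ?b s0" for s0
  proof -
    from I obtain i where i: "reg s0 = reg s" "arr s0 = (arr s)(''second'' := S(u := i))"
      "seeking F B (S(u := i))" "F u < i" by (auto simp: I_def)
    then have "dead B i" using b s by (simp add: dead_def peer_def instance_state_def)
    then have n: "seeking F B (S(u := i + 1))"
      using seeking_next(2)[OF T i(3)] i(4) S(2) by simp
    have "slack (S(u := Suc i)) + 1 = slack (S(u := i))" using slack_advance[OF i(3) T(2)] by simp
    then show ?thesis using i n s by (auto simp: I_def intro!: exI[of _ "Suc i"])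
  qed
  have post: "\<exists>i. reg s' = reg s \<and> arr s' = (arr s)(''second'' := S(u := i)) \<and>
    seeking F B (S(u := i)) \<and> second F B u i" if I: "I s'" and b: "\<not> bval ?b s'" for s'
  proof -
    from I obtain i where i: "reg s' = reg s" "arr s' = (arr s)(''second'' := S(u := i))"
      "seeking F B (S(u := i))" "F u < i" by (auto simp: I_def)
    then have "\<not> dead B i" using b s by (simp add: dead_def peer_def instance_state_def)
    then show ?thesis using seeking_found[OF T i(3)] i S(2) by auto
  qed
  have loop: "wp (While ?b ?c) (\<lambda>t s'. \<exists>i. reg s' = reg s \<and>
    arr s' = (arr s)(''second'' := S(u := i)) \<and>
    seeking F B (S(u := i)) \<and> second F B u i \<and> t + 20 * slack (S(u := i)) \<le> ?\<Phi> s0 + 12) s0" if "I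
      s0" for s0
    by (rule wp_While_strong[OF that step]) (auto dest!: post)
  show ?thesis
  proof (cases "F u < S u")
    case True
    then have "I s" using s S by (auto simp: I_def intro!: exI[of _ "S u"])
    from loop[OF this] show ?thesis unfolding seek_def using True s by (auto elim!: wp_mono)
  next
    case False
    let ?s = "store ''second'' u (Suc (F u)) s"
    have "seeking F B (S(u := Suc (F u)))" using seeking_first[OF T S] by simp
    then have "I ?s" using s by (auto simp: I_def)
    moreover have "slack (S(u := Suc (F u))) \<le> slack S" using slack_antimono False by simp
    ultimately show ?thesis unfolding seek_def using False s loop[of ?s] by (auto elim!: wp_mono)
  qed
qed

text \<open>Equal receivers would give equal successors, but the path has no repeated node. So the
  updates of \<open>worst\<close> along the cycle do not overwrite one another.\<close>

lemma search_path_peer_inj: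
  assumes cl: "closed F B" and p: "search_path F B S T (Suc k)" and s: "second F B (T k) (S (T k))"
    and c: "succ B (S (T k)) = T j" "j \<le> k"
    and i: "j \<le> i" "i < i'" "i' \<le> k"
  shows "peer (S (T i)) \<noteq> peer (S (T i'))"
proof
  assume "peer (S (T i)) = peer (S (T i'))"
  then have e: "succ B (S (T i)) = succ B (S (T i'))" by (simp add: succ_def)
  note L = search_path_links(2)[OF cl p s c]
  have "succ B (S (T i)) = T (Suc i)" using L i by simp
  moreover have "succ B (S (T i')) = (if i' = k then T j else T (Suc i'))" using L c i by simp
  ultimately have "T (Suc i) = T (if i' = k then j else Suc i')" using e by (simp split: if_splits)
  moreover have "Suc i \<noteq> (if i' = k then j else Suc i')" "(if i' = k then j else Suc i') < Suc k"
    using i by auto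
  ultimately show False using search_path_neq[OF p, of "Suc i" "if i' = k then j else Suc i'"] i
    by simp
qed

text \<open>A half-finished elimination: the popped nodes of the cycle and their receivers have new
  pointers, everything else has the old ones. \<open>fail\<close> records exactly whether some list
  is empty by now.\<close>

definition pop_inv ::
  "(nat \<Rightarrow> nat) \<Rightarrow> (nat \<Rightarrow> nat) \<Rightarrow> (nat \<Rightarrow> nat) \<Rightarrow> (nat \<Rightarrow> nat) \<Rightarrow> nat \<Rightarrow> nat \<Rightarrow> nat \<Rightarrow> state \<Rightarrow> bool" where
  "pop_inv F B S T k j c s \<longleftrightarrow>
     instance_state s \<and> arr s ''second'' = S \<and> arr s ''path'' = T \<and> reg s ''x'' = T j \<and> reg s
       ''c'' = c \<and>
     j \<le> reg s ''k'' \<and> reg s ''k'' \<le> Suc k \<and>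
     (reg s ''run'' = 1 \<and> j < reg s ''k'' \<or> reg s ''run'' = 0 \<and> reg s ''k'' = j) \<and>
     (\<forall>u. arr s ''first'' u = (if u \<in> T ` {reg s ''k''..k} then S u else F u)) \<and>
     (\<forall>u\<in>T ` {reg s ''k''..k}. arr s ''worst'' (peer (S u)) = opp (S u)) \<and>
     (\<forall>v. v \<notin> (\<lambda>u. peer (S u)) ` T ` {reg s ''k''..k} \<longrightarrow> arr s ''worst'' v = B v) \<and>
     (\<forall>u<n. arr s ''mark'' u = (if u \<in> T ` {..<reg s ''k''} then 1 else 0)) \<and>
     (if reg s ''fail'' = 0 then \<forall>u<n. arr s ''first'' u \<le> arr s ''worst'' u
      else \<exists>u<n. arr s ''worst'' u < arr s ''first'' u)"

lemma pop_step:
  assumes cl: "closed F B" and p: "search_path F B S T (Suc k)"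
    and sec: "second F B (T k) (S (T k))"
    and c: "succ B (S (T k)) = T j" "j \<le> k"
    and I: "pop_inv F B S T k j c0 s" and r: "reg s ''run'' = 1"
  shows "wp pop_step (\<lambda>t s'. pop_inv F B S T k j c0 s' \<and>
    3 + t + 100 * reg s' ''k'' \<le> 100 * reg s ''k'') s"
proof -
  obtain k' where k': "reg s ''k'' = Suc k'" using I r
    by (cases "reg s ''k''") (auto simp: pop_inv_def)
  let ?y = "T k'"
  let ?v = "own (opp (S ?y))"
  let ?F = "arr s ''first''" and ?B = "arr s ''worst''"
  have v: "?v = peer (S ?y)" by (simp add: peer_def)
  have k: "j \<le> k'" "k' \<le> k" using I k' r by (auto simp: pop_inv_def)
  have st: "reg s ''n'' = n" "arr s ''own'' = own" "arr s ''opp'' = opp" "arr s ''second'' = S"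
    "arr s ''path'' = T" "reg s ''x'' = T j" "reg s ''c'' = c0"
    and F0: "\<forall>u. ?F u = (if u \<in> T ` {Suc k'..k} then S u else F u)"
    and B10: "\<forall>u\<in>T ` {Suc k'..k}. ?B (peer (S u)) = opp (S u)"
    and B20: "\<forall>v. v \<notin> (\<lambda>u. peer (S u)) ` T ` {Suc k'..k} \<longrightarrow> ?B v = B v"
    and K0: "\<forall>u<n. arr s ''mark'' u = (if u \<in> T ` {..<Suc k'} then 1 else 0)"
    and fl: "if reg s ''fail'' = 0 then \<forall>u<n. ?F u \<le> ?B u else \<exists>u<n. ?B u < ?F u"
    using I[unfolded pop_inv_def instance_state_def k'] by - (elim conjE, assumption)+
  have F: "?F u = (if u \<in> T ` {Suc k'..k} then S u else F u)" for u using F0 by blast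
  have Bpop: "?B (peer (S (T i))) = opp (S (T i))" if "Suc k' \<le> i" "i \<le> k" for i using B10 that
    by simp
  have B2: "?B v = B v" if "v \<notin> (\<lambda>u. peer (S u)) ` T ` {Suc k'..k}" for v using B20 that by blast
  have K: "arr s ''mark'' u = (if u \<in> T ` {..<Suc k'} then 1 else 0)" if "u < n" for u
    using K0 that by blast
  have ins: "{k'..k} = insert k' {Suc k'..k}" using k by auto
  have yn: "?y < n" using search_path_node[OF p] k by simp
  have s2: "second F B ?y (S ?y)" using search_path_links(1)[OF cl p sec c] k by simp
  have out: "?y \<notin> T ` A" if "k' \<notin> A" "A \<subseteq> {..k}" for A
  proof
    assume "?y \<in> T ` A"
    then obtain i where "?y = T i" "i \<in> A" by blast
    moreover from this that have "i < Suc k" "k' \<noteq> i" by auto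
    ultimately show False using search_path_neq[OF p, of k' i] k by simp
  qed
  have y: "?y \<notin> T ` {Suc k'..k}" "?y \<notin> T ` {..<k'}"
    by (rule out; use k in auto)+
  have vn: "?v < n" using peer_less[OF second_slot[OF cl yn s2]] v by simp
  have vout: "?v \<notin> (\<lambda>u. peer (S u)) ` T ` {Suc k'..k}"
  proof
    assume "?v \<in> (\<lambda>u. peer (S u)) ` T ` {Suc k'..k}"
    then obtain i where "peer (S ?y) = peer (S (T i))" "k' < i" "i \<le> k" by (auto simp: v)
    then show False using search_path_peer_inj[OF cl p sec c k(1)] by blast
  qed
  \<comment> \<open>No popped node shares this receiver, so its cell still contains the bound from
    before the elimination.\<close>
  have vlt: "opp (S ?y) < ?B ?v" using second_not_worst[OF cl yn s2] B2[OF vout] v by simp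
  have ylt: "?F ?y < S ?y" using F[of ?y] y(1) s2 by (simp add: second_def)
  define F1 where "F1 = ?F(?y := S ?y)"
  define B1 where "B1 = ?B(?v := opp (S ?y))"
  have F': "F1 u = (if u \<in> T ` {k'..k} then S u else F u)" for u
    by (simp add: F1_def ins F)
  have BP: "B1 (peer (S (T i))) = opp (S (T i))" if "k' \<le> i" "i \<le> k" for i
  proof (cases "i = k'")
    case False
    then have "i \<in> {Suc k'..k}" using that by simp
    then have "peer (S (T i)) \<in> (\<lambda>u. peer (S u)) ` T ` {Suc k'..k}" by blast
    with vout have "peer (S (T i)) \<noteq> ?v" by metis
    then show ?thesis using Bpop[of i] that False by (simp add: B1_def)
  qed (simp add: B1_def v)
  have B2': "B1 w = B w" if "w \<notin> (\<lambda>u. peer (S u)) ` T ` {k'..k}" for w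
    using that B2[of w] by (auto simp: B1_def ins v)
  have K': "((arr s ''mark'')(?y := 0)) u = (if u \<in> T ` {..<k'} then 1 else 0)" if "u < n" for u
    using K[OF that] y(2) by (auto simp: lessThan_Suc)
  have run: "?y = T j \<longleftrightarrow> k' = j" using search_path_neq[OF p, of k' j] k by auto
  \<comment> \<open>First pointers only rise and bounds only fall, so a violation persists, and a
    new one can arise only at the two nodes just touched. Testing these two is enough.\<close>
  have fl': "if reg s ''fail'' = 0 \<and> F1 ?y \<le> B1 ?y \<and> F1 ?v \<le> B1 ?v
      then \<forall>u<n. F1 u \<le> B1 u else \<exists>u<n. B1 u < F1 u"
  proof (cases "reg s ''fail'' = 0")
    case True
    show ?thesis
    proof (cases "F1 ?y \<le> B1 ?y \<and> F1 ?v \<le> B1 ?v")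
      case c: True
      have "F1 u \<le> B1 u" if "u < n" for u
      proof (cases "u = ?y \<or> u = ?v")
        case False
        then show ?thesis using fl True that by (simp add: F1_def B1_def)
      qed (use c in blast)
      with c True show ?thesis by simp
    next
      case c: False
      then have "\<exists>u<n. B1 u < F1 u" using yn vn by (metis not_le)
      then show ?thesis by (subst if_not_P) (use c in blast)
    qed
  next
    case False
    then obtain u where u: "u < n" "?B u < ?F u" using fl by auto
    have "B1 u \<le> ?B u" "?F u \<le> F1 u" using vlt ylt by (auto simp: F1_def B1_def)
    with u have "B1 u < F1 u" by linarith
    with u(1) False show ?thesis by auto
  qed
  have fin: "pop_inv F B S T k j c0 s'"
    if "reg s' ''n'' = n" "arr s' ''own'' = own" "arr s' ''opp'' = opp" "arr s' ''second'' = S"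
      "arr s' ''path'' = T" "reg s' ''x'' = T j" "reg s' ''c'' = c0" "reg s' ''k'' = k'"
      "reg s' ''run'' = (if k' = j then 0 else 1)"
      "arr s' ''first'' = F1" "arr s' ''worst'' = B1" "arr s' ''mark'' = (arr s ''mark'')(?y := 0)"
      "reg s' ''fail'' = 0 \<longleftrightarrow> reg s ''fail'' = 0 \<and> F1 ?y \<le> B1 ?y \<and> F1 ?v \<le> B1 ?v" for s'
  proof -
    have "(if k' = j then 0 else 1 :: nat) = 1 \<and> j < k' \<or> (if k' = j then 0 else 1 :: nat) = 0 \<and>
      k' = j"
      using k by auto
    moreover have "k' \<le> Suc k" using k by simp
    moreover have "\<forall>u. F1 u = (if u \<in> T ` {k'..k} then S u else F u)" using F' by blast
    moreover have "\<forall>u\<in>T ` {k'..k}. B1 (peer (S u)) = opp (S u)" using BP by auto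
    moreover have "\<forall>u<n. ((arr s ''mark'')(?y := 0)) u = (if u \<in> T ` {..<k'} then 1 else 0)"
      using K' by blast
    moreover have "\<forall>v. v \<notin> (\<lambda>u. peer (S u)) ` T ` {k'..k} \<longrightarrow> B1 v = B v" using B2' by blast
    ultimately show ?thesis
      unfolding pop_inv_def instance_state_def that
      by (intro conjI refl k(1) fl'; assumption?)
  qed
  show ?thesis
    unfolding pop_step_def
    by (simp add: k' st r run, intro conjI impI; rule fin; simp add: st r run F1_def B1_def)
qed

lemma pop_inv_run:
  "pop_inv F B S T k j c s \<Longrightarrow> reg s ''run'' = 1 \<and> j < reg s ''k'' \<or> reg s ''run'' = 0 \<and>
    reg s ''k'' = j"
  unfolding pop_inv_def by (elim conjE)

lemma eliminate:
  assumes cl: "closed F B" and p: "search_path F B S T (Suc k)"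
    and sec: "second F B (T k) (S (T k))"
    and c: "succ B (S (T k)) = T j" "j \<le> k"
    and s: "instance_state s" "arr s ''first'' = F" "arr s ''worst'' = B" "arr s ''second'' = S"
      "arr s ''path'' = T" "reg s ''x'' = T j" "reg s ''c'' = c0" "reg s ''k'' = Suc k"
        "reg s ''fail'' = 0"
      "\<And>u. u < n \<Longrightarrow> arr s ''mark'' u = (if u \<in> T ` {..<Suc k} then 1 else 0)"
  shows "wp eliminate (\<lambda>t s'. pop_inv F B S T k j c0 s' \<and> reg s' ''k'' = j \<and>
    t \<le> 100 * (Suc k - j) + 10) s"
proof -
  let ?b = "Equal (Reg ''run'') (Const 1)"
  have I0: "pop_inv F B S T k j c0 (assign ''run'' 1 s)"
    using s c(2) cl by (simp add: pop_inv_def instance_state_def closed_def)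
  have step: "wp pop_step (\<lambda>t s'. pop_inv F B S T k j c0 s' \<and>
      bcost ?b + t + 100 * (reg s' ''k'' - j) \<le> 100 * (reg s ''k'' - j)) s"
    if I: "pop_inv F B S T k j c0 s" and "bval ?b s" for s
  proof -
    have r: "reg s ''run'' = 1" using that by simp
    show ?thesis
      by (rule wp_mono[OF pop_step[OF cl p sec c I r]])
        (use pop_inv_run[OF I] r in \<open>auto dest: pop_inv_run\<close>)
  qed
  have "wp (While ?b pop_step) (\<lambda>t s'. pop_inv F B S T k j c0 s' \<and> reg s' ''k'' = j \<and>
      2 + t \<le> 100 * (Suc k - j) + 10) (assign ''run'' 1 s)"
    by (rule wp_While_strong[OF I0 step]) (use s in \<open>auto dest: pop_inv_run\<close>)
  then show ?thesis by (simp add: eliminate_def)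
qed

section \<open>The search loop and its amortised cost\<close>

definition marks :: "(nat \<Rightarrow> nat) \<Rightarrow> (nat \<Rightarrow> nat) \<Rightarrow> nat \<Rightarrow> bool" where
  "marks K T k \<longleftrightarrow> (\<forall>u<n. K u = (if u \<in> T ` {..<k} then 1 else 0))"

definition search_inv :: "state \<Rightarrow> bool" where
  "search_inv s \<longleftrightarrow> instance_state s \<and>
     (if reg s ''fail'' = 0
      then closed (arr s ''first'') (arr s ''worst'') \<and>
        seeking (arr s ''first'') (arr s ''worst'') (arr s ''second'') \<and>
        search_path (arr s ''first'') (arr s ''worst'') (arr s ''second'') (arr s ''path'') (reg s
          ''k'') \<and>
        marks (arr s ''mark'') (arr s ''path'') (reg s ''k'') \<and>
        reg s ''c'' \<le> n \<and> (\<forall>u<reg s ''c''. arr s ''first'' u = arr s ''worst'' u)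
      else \<forall>m. \<not> stable m)"

definition fresh :: "state \<Rightarrow> nat set" where
  "fresh s = {u. u < n \<and> arr s ''mark'' u = 0 \<and> arr s ''first'' u < arr s ''worst'' u}"

text \<open>
  A node with a single remaining entry is never put on the path again. Hence putting a node on the
  path is paid by the fresh nodes, taking it off by the height of the path, and an elimination,
  which makes the removed nodes fresh again, by the gap.
\<close>

definition search_pot :: "state \<Rightarrow> nat" where
  "search_pot s =
     (if reg s ''fail'' = 0
      then 1500 * gap s + 700 * card (fresh s) + 300 * reg s ''k'' + 20 * slack (arr s ''second'') +
        300 * (n - reg s ''c'')
      else 0)"

lemma finite_fresh: "finite (fresh s)"
  by (simp add: fresh_def)

lemma fresh_mark:
  assumes "u \<in> fresh s" "arr s' ''mark'' = (arr s ''mark'')(u := 1)"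
    "arr s' ''first'' = arr s ''first''" "arr s' ''worst'' = arr s ''worst''"
  shows "Suc (card (fresh s')) = card (fresh s)"
proof -
  have "fresh s' = fresh s - {u}" using assms by (auto simp: fresh_def)
  then show ?thesis using assms(1) finite_fresh by (metis card_Suc_Diff1)
qed

text \<open>A push gains \<open>700\<close> from the fresh nodes and deposits \<open>300\<close> as
  path height, which pays for a later pop. Eliminating \<open>r\<close> nodes gains
  \<open>1500 * r\<close> from the gap, which covers \<open>700 * r\<close> for nodes becoming fresh
  again and \<open>100 * r\<close> for the pops. Advancing \<open>c\<close> is paid by its own term,
  and \<open>7\<close> is the loop test.\<close>

lemma search_step:
  assumes I: "search_inv s" and b: "reg s ''c'' < n" "reg s ''fail'' = 0"
  shows "wp search_step (\<lambda>t s'. search_inv s' \<and> 7 + t + search_pot s' \<le> search_pot s) s"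
proof -
  let ?F = "arr s ''first''" and ?B = "arr s ''worst''" and ?S = "arr s ''second''"
    and ?T = "arr s ''path''"
  let ?c = "reg s ''c''"
  have st: "reg s ''n'' = n" "arr s ''own'' = own" "arr s ''opp'' = opp"
    and cl: "closed ?F ?B" and sk: "seeking ?F ?B ?S" and p: "search_path ?F ?B ?S ?T (reg s ''k'')"
    and K: "marks (arr s ''mark'') ?T (reg s ''k'')"
    and single: "\<forall>u<?c. ?F u = ?B u"
    using I b by (auto simp: search_inv_def instance_state_def)
  have le: "?F u \<le> ?B u" if "u < n" for u using cl that by (simp add: closed_def)
  show ?thesis
  proof (cases "reg s ''k''")
    case k: 0
    show ?thesis
    proof (cases "?F ?c = ?B ?c")
      case True
      then show ?thesis using b st cl sk p K single k
        by (simp add: search_step_def search_inv_def instance_state_def search_pot_def gap_def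
          fresh_def
            less_Suc_eq)
    next
      case False
      have mk: "arr s ''mark'' ?c = 0" using K b k by (simp add: marks_def)
      let ?s = "assign ''k'' 1 (store ''mark'' ?c 1 (store ''path'' 0 ?c s))"
      have "?c \<in> fresh s" using mk False le[OF b(1)] b by (simp add: fresh_def)
      then have f: "Suc (card (fresh ?s)) = card (fresh s)" by (rule fresh_mark) simp_all
      have "marks ((arr s ''mark'')(?c := 1)) (?T(0 := ?c)) 1" using K k by (auto simp: marks_def)
      moreover have "search_path ?F ?B ?S (?T(0 := ?c)) 1" using search_path_start[OF b(1)] .
      moreover have "gap ?s = gap s" by (simp add: gap_def)
      ultimately show ?thesis using b st cl sk single k False f
        by (simp add: search_step_def search_inv_def instance_state_def search_pot_def)
    qed
  next
    case k: (Suc k)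
    let ?u = "?T k"
    have u: "?u < n" using search_path_node[OF p] k by simp
    have pk: "search_path ?F ?B ?S ?T (Suc k)" using p k by simp
    have nin: "?u \<notin> ?T ` {..<k}"
    proof
      assume "?u \<in> ?T ` {..<k}"
      then obtain i where "i < k" "?T k = ?T i" by blast
      then show False using search_path_neq[OF pk, of i k] by simp
    qed
    show ?thesis
    proof (cases "?F ?u = ?B ?u")
      case True
      let ?s = "assign ''k'' k (store ''mark'' ?u 0 (assign ''u'' ?u s))"
      have "fresh ?s = fresh s" using True by (auto simp: fresh_def)
      moreover have "marks ((arr s ''mark'')(?u := 0)) ?T k"
        using K k nin by (auto simp: marks_def lessThan_Suc)
      moreover have "search_path ?F ?B ?S ?T k" using search_path_pop[OF p] k by simp
      moreover have "gap ?s = gap s" by (simp add: gap_def)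
      ultimately show ?thesis using b st cl sk single k True
        by (simp add: search_step_def search_inv_def instance_state_def search_pot_def)
    next
      case False
      then have lt: "?F ?u < ?B ?u" using le[OF u] by simp
      let ?s1 = "assign ''u'' ?u s"
      define rest
        where "rest =
        (Assign ''x'' (Load ''own'' (Load ''opp'' (Load ''worst'' (Load ''own'' (Load ''opp''
             (Load ''second'' (Reg ''u'')))))));;
           Cond (Equal (Load ''mark'' (Reg ''x'')) (Const 0))
             (Store ''path'' (Reg ''k'') (Reg ''x'');;
              Store ''mark'' (Reg ''x'') (Const 1);;
              Assign ''k'' (Plus (Reg ''k'') (Const 1)))
             eliminate)"
      have main: "wp rest (\<lambda>t' s''. search_inv s'' \<and>
        25 + t + t' + search_pot s'' \<le> search_pot s) s'"
        if i: "reg s' = reg ?s1" "arr s' = (arr s)(''second'' := ?S(?u := i))"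
          "seeking ?F ?B (?S(?u := i))" "second ?F ?B ?u i"
          "t + 20 * slack (?S(?u := i)) \<le> 20 * slack ?S + 30" for t s' i
      proof -
        let ?S' = "?S(?u := i)"
        let ?x = "succ ?B i"
        have x: "own (opp (?B (own (opp i)))) = ?x" by (simp add: succ_def peer_def)
        have p': "search_path ?F ?B ?S' ?T (Suc k)" using search_path_second[OF pk] .
        have sec: "second ?F ?B ?u (?S' ?u)" using i by simp
        have xn: "?x < n" using succ_less[OF cl u i(4)] .
        let ?s2 = "assign ''x'' ?x s'"
        show ?thesis
        proof (cases "arr s ''mark'' ?x = 0")
          case True
          let ?s3 = "assign ''k'' (Suc (Suc k)) (store ''mark'' ?x 1 (store ''path'' (Suc k) ?x
            ?s2))"
          have out: "?x \<notin> ?T ` {..<Suc k}" using True K xn k by (auto simp: marks_def)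
          \<comment> \<open>A node reached by a link is not single, so being unmarked is enough for
            being fresh.\<close>
          have "?x \<in> fresh s" using True xn succ_not_single[OF cl u i(4)] by (simp add: fresh_def)
          then have "Suc (card (fresh ?s3)) = card (fresh s)" by (rule fresh_mark) (simp_all add: i)
          moreover have "search_path ?F ?B ?S' (?T(Suc k := ?x)) (Suc (Suc k))"
            by (rule search_path_push[OF p' sec _ xn out]) simp
          moreover have "marks ((arr s ''mark'')(?x := 1)) (?T(Suc k := ?x)) (Suc (Suc k))"
            using K out k by (auto simp: marks_def lessThan_Suc)
          moreover have "gap ?s3 = gap s" by (simp add: gap_def i)
          ultimately show ?thesis using b st cl single i k True x
            by (simp add: rest_def search_inv_def instance_state_def search_pot_def)
        next
          case mk: False
          then have "?x \<in> ?T ` {..<Suc k}" using K xn k by (auto simp: marks_def split: if_splits)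
          then obtain j where j: "?x = ?T j" "j \<le> k" by (auto simp: less_Suc_eq_le)
          have sj: "succ ?B (?S' ?u) = ?T j" using j by simp
          let ?X = "?T ` {j..k}"
          have fin: "search_inv s'' \<and> 70 + t + t'' + search_pot s'' \<le> search_pot s"
            if I': "pop_inv ?F ?B ?S' ?T k j ?c s''" "reg s'' ''k'' = j"
              "t'' \<le> 100 * (Suc k - j) + 10" for t'' s''
          proof -
            let ?F' = "arr s'' ''first''" and ?B' = "arr s'' ''worst''"
            have st': "instance_state s''" "arr s'' ''second'' = ?S'" "arr s'' ''path'' = ?T"
              "reg s'' ''c'' = ?c"
              and F0: "\<forall>u. ?F' u = (if u \<in> ?X then ?S' u else ?F u)"
              and B0: "\<forall>u\<in>?X. ?B' (peer (?S' u)) = opp (?S' u)"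
                "\<forall>v. v \<notin> (\<lambda>u. peer (?S' u)) ` ?X \<longrightarrow> ?B' v = ?B v"
              and K': "\<forall>u<n. arr s'' ''mark'' u = (if u \<in> ?T ` {..<j} then 1 else 0)"
              and fl: "if reg s'' ''fail'' = 0 then \<forall>u<n. ?F' u \<le> ?B' u else \<exists>u<n. ?B' u < ?F' u"
              using I'(1)[unfolded pop_inv_def I'(2)] by - (elim conjE, assumption)+
            have rot: "rotation n lo hi own opp ?F ?B ?S' ?F' ?B' ?X"
              by (rule search_path_rotation[OF cl p' sec sj j(2)]) (use F0 B0 in \<open>auto simp del:
                fun_upd_apply\<close>)
            show ?thesis
            proof (cases "reg s'' ''fail'' = 0")
              case False
              with fl obtain w where "w < n" "?B' w < ?F' w" by auto
              then have "\<not> stable m" for m using pruned_infeasible[OF rotation.pruned'[OF rot]]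
                by blast
              then have "search_inv s''" using st' False by (simp add: search_inv_def)
              \<comment> \<open>The potential after a failure is zero. The pops are paid by the path
                height, \<open>300\<close> per node against \<open>100\<close> per pop, and the
                constants by the term for \<open>c\<close>, as \<open>c < n\<close>.\<close>
              moreover have "70 + t + t'' \<le> search_pot s"
                using i(5) I'(3) b k j by (simp add: search_pot_def)
              ultimately show ?thesis using False by (simp add: search_pot_def)
            next
              case True
              with fl have le': "\<And>u. u < n \<Longrightarrow> ?F' u \<le> ?B' u" by simp
              have XX: "?X = ?T ` {j..<Suc k}" by (simp add: atLeastLessThanSuc_atLeastAtMost)
              have "search_path ?F' ?B' ?S' ?T j"
                by (rule rotation.search_path_kept[OF rot le' p' _ XX]) (use j in auto)
              moreover have "closed ?F' ?B'" using rotation.closed'[OF rot le'] .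
              moreover have "seeking ?F' ?B' ?S'" using rotation.seeking_kept[OF rot i(3)] .
              moreover have "\<forall>u<?c. ?F' u = ?B' u"
                using rotation.single_stays[OF rot le'] single b by auto
              moreover have "marks (arr s'' ''mark'') ?T j" using K' by (simp add: marks_def)
              ultimately have inv: "search_inv s''" using st' I'(2) True b
                by (simp add: search_inv_def)
              have "inj_on ?T {j..k}" using pk by (auto simp: search_path_def intro: inj_on_subset)
              then have cX: "card ?X = Suc k - j" by (simp add: card_image)
              have "gap s'' + card ?X \<le> gap s" using rotation.gap_drop[OF rot]
                by (simp add: gap_def)
              moreover have "card (fresh s'') \<le> card (fresh s) + card ?X"
              proof -
                \<comment> \<open>Outside the rotation no mark is erased and no gap grows.\<close>
                have "fresh s'' \<subseteq> fresh s \<union> ?X"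
                proof
                  fix w assume w: "w \<in> fresh s''"
                  show "w \<in> fresh s \<union> ?X"
                  proof (cases "w \<in> ?X")
                    case False
                    moreover have "w \<notin> ?T ` {..<j}"
                      using w K' by (auto simp: fresh_def split: if_splits)
                    moreover have "{..<Suc k} = {..<j} \<union> {j..k}" using j(2) by auto
                    ultimately have "w \<notin> ?T ` {..<Suc k}" by (simp only: image_Un Un_iff) simp
                    then have "arr s ''mark'' w = 0" using w K k by (simp add: fresh_def marks_def)
                    moreover have "?F w < ?B w"
                      using w rotation.F_le[OF rot, of w] rotation.B_le[OF rot, of w]
                        by (simp add: fresh_def)
                    ultimately show ?thesis using w by (simp add: fresh_def)
                  qed simp
                qed
                then have "card (fresh s'') \<le> card (fresh s \<union> ?X)"
                  by (rule card_mono[rotated]) (simp add: finite_fresh)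
                also have "\<dots> \<le> card (fresh s) + card ?X" by (rule card_Un_le)
                finally show ?thesis .
              qed
              ultimately have "70 + t + t'' + search_pot s'' \<le> search_pot s"
                using i(5) I'(2,3) b k j cX True st' by (simp add: search_pot_def)
              with inv show ?thesis by simp
            qed
          qed
          have "wp eliminate (\<lambda>t s''. pop_inv ?F ?B ?S' ?T k j ?c s'' \<and> reg s'' ''k'' = j \<and>
              t \<le> 100 * (Suc k - j) + 10) ?s2"
            by (rule eliminate[OF cl p' sec sj j(2)])
              (use i st b k K j in \<open>auto simp: instance_state_def marks_def\<close>)
          then have "wp eliminate (\<lambda>t'' s''. search_inv s'' \<and>
            70 + t + t'' + search_pot s'' \<le> search_pot s) ?s2"
            by (rule wp_mono) (use fin in blast)
          then show ?thesis using i st mk x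
            by (simp add: rest_def) (erule wp_mono, simp)
        qed
      qed
      have "wp seek (\<lambda>t s'. \<exists>i. reg s' = reg ?s1 \<and> arr s' = (arr ?s1)(''second'' := ?S(?u := i)) \<and>
        seeking ?F ?B (?S(?u := i)) \<and> second ?F ?B ?u i \<and> t + 20 * slack (?S(?u := i)) \<le> 20 *
          slack ?S + 30) ?s1"
        by (rule seek) (use st cl sk u lt in \<open>simp_all add: instance_state_def\<close>)
      then have "wp seek (\<lambda>t. wp rest (\<lambda>t' s''. search_inv s'' \<and>
        25 + t + t' + search_pot s'' \<le> search_pot s)) ?s1"
        by (rule wp_mono) (elim exE conjE, rule main, simp_all)
      then show ?thesis using k st False
        unfolding search_step_def rest_def[symmetric]
        by simp (erule wp_mono, erule wp_mono, simp)
    qed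
  qed
qed

end

section \<open>Reading off the matching\<close>

definition report_node :: com where
  "report_node =
    (Cond (Equal (Load ''opp'' (Load ''first'' (Reg ''u''))) (Load ''first'' (Reg ''u'')))
       (Store ''mate'' (Reg ''u'') (Const 0))
       (Store ''mate'' (Reg ''u'') (Plus (Load ''own'' (Load ''opp'' (Load ''first'' (Reg
         ''u'')))) (Const 1)));;
     Assign ''u'' (Plus (Reg ''u'') (Const 1)))"

definition report :: com where
  "report =
     Cond (Equal (Reg ''fail'') (Const 0))
       (Assign ''u'' (Const 0);; While (Less (Reg ''u'') (Reg ''n'')) report_node;; Assign
         ''answer'' (Const 1))
       (Assign ''answer'' (Const 0))"

context roommates
begin

lemma search_all:
  assumes s: "instance_state s" "arr s ''mark'' = (\<lambda>_. 0)" "\<And>u. u < n \<Longrightarrow> arr s ''second'' u = lo u"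
    and cl: "closed (arr s ''first'') (arr s ''worst'')"
  shows "wp search_all (\<lambda>t s'. instance_state s' \<and>
      (if reg s' ''fail'' = 0 then stable (arr s' ''first'') else \<forall>m. \<not> stable m) \<and>
      t \<le> 1500 * gap s + 1000 * n + 20 * slack lo + 20) s"
proof -
  let ?b = "Conj (Less (Reg ''c'') (Reg ''n'')) (Equal (Reg ''fail'') (Const 0))"
  let ?s = "assign ''fail'' 0 (assign ''k'' 0 (assign ''c'' 0 s))"
  have lo: "lo u \<le> arr s ''first'' u" if "u < n" for u
    using cl that by (auto simp: closed_def pruned_def slot_def)
  have "seeking (arr s ''first'') (arr s ''worst'') (arr s ''second'')"
    using s(3) lo_le_hi lo by (force simp: seeking_def slot_def)
  then have I0: "search_inv ?s"
    using s(1,2) cl by (simp add: search_inv_def instance_state_def search_path_def marks_def)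
  have "fresh ?s \<subseteq> {..<n}" by (auto simp: fresh_def)
  then have "card (fresh ?s) \<le> n" using card_mono[of "{..<n}"] by fastforce
  moreover have "slack (arr s ''second'') = slack lo" using s(3) by (simp add: slack_def)
  ultimately have pot: "search_pot ?s \<le> 1500 * gap s + 1000 * n + 20 * slack lo"
    by (simp add: search_pot_def gap_def)
  have step: "wp search_step (\<lambda>t s'. search_inv s' \<and> bcost ?b + t + search_pot s' \<le> search_pot s) s"
    if "search_inv s" "bval ?b s" for s
    by (rule wp_mono[OF search_step[OF that(1)]])
      (use that in \<open>auto simp: search_inv_def instance_state_def\<close>)
  have fin: "instance_state s' \<and>
    (if reg s' ''fail'' = 0 then stable (arr s' ''first'') else \<forall>m. \<not> stable m)"
    if I: "search_inv s'" and b: "\<not> bval ?b s'" for s'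
  proof -
    have "stable (arr s' ''first'')" if f: "reg s' ''fail'' = 0"
    proof (rule stable_first)
      show "pruned (arr s' ''first'') (arr s' ''worst'')" using I f
        by (simp add: search_inv_def closed_def)
      show "settled (arr s' ''first'') (arr s' ''worst'') u" if "u < n" for u
        using I f that by (simp add: search_inv_def closed_def)
      show "arr s' ''first'' u = arr s' ''worst'' u" if "u < n" for u
        using I f that b by (auto simp: search_inv_def instance_state_def)
    qed
    then show ?thesis using I by (simp add: search_inv_def)
  qed
  have "wp (While ?b search_step) (\<lambda>t s'. instance_state s' \<and>
      (if reg s' ''fail'' = 0 then stable (arr s' ''first'') else \<forall>m. \<not> stable m) \<and>
      6 + t \<le> 1500 * gap s + 1000 * n + 20 * slack lo + 20) ?s"
    by (rule wp_While_strong[OF I0 step]) (use fin pot in auto)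
  then show ?thesis by (simp add: search_all_def)
qed

lemma report:
  assumes s: "instance_state s"
  shows "wp report (\<lambda>t s'. t \<le> 50 * n + 20 \<and>
    (if reg s ''fail'' = 0
     then reg s' ''answer'' = 1 \<and> (\<forall>u<n. arr s' ''mate'' u =
       (if opp (arr s ''first'' u) = arr s ''first'' u then 0 else peer (arr s ''first'' u) + 1))
     else reg s' ''answer'' = 0)) s"
proof (cases "reg s ''fail'' = 0")
  case True
  let ?b = "Less (Reg ''u'') (Reg ''n'')" and ?F = "arr s ''first''"
  define I where "I s' \<longleftrightarrow> instance_state s' \<and> arr s' ''first'' = ?F \<and> reg s' ''u'' \<le> n \<and>
    (\<forall>u<reg s' ''u''. arr s' ''mate'' u = (if opp (?F u) = ?F u then 0 else peer (?F u) +
      1))" for s'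
  let ?s = "assign ''u'' 0 s"
  have I0: "I ?s" using s by (simp add: I_def instance_state_def)
  have step: "wp report_node (\<lambda>t s'. I s' \<and>
    bcost ?b + t + 50 * (n - reg s' ''u'') \<le> 50 * (n - reg s ''u'')) s"
    if "I s" "bval ?b s" for s
    using that by (simp add: report_node_def I_def instance_state_def peer_def less_Suc_eq) linarith
  have "wp (While ?b report_node) (\<lambda>t s'. t \<le> 50 * n + 3 \<and>
      (\<forall>u<n. arr s' ''mate'' u = (if opp (?F u) = ?F u then 0 else peer (?F u) + 1))) ?s"
    by (rule wp_While_strong[OF I0 step]) (auto simp: I_def instance_state_def)
  then show ?thesis using True by (simp add: report_def) (erule wp_mono, auto)
qed (simp add: report_def)

end

section \<open>Building the roommates instance\<close>

text \<open>
  The array \<open>pos\<close> is a matrix with rows of length \<open>n\<close>: the cell of \<open>(u, v)\<close> receives the position of \<open>v\<close>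
  in the list of \<open>u\<close>. The matrix is never initialised, and only the cells of edges are written
    and read.
\<close>

definition index_entry :: com where
  "index_entry =
    (Store ''pos'' (Plus (Reg ''row'') (Load ''adj'' (Reg ''i''))) (Reg ''i'');;
     Store ''own'' (Plus (Plus (Load ''off'' (Reg ''u'')) (Reg ''u'')) (Reg ''i'')) (Reg ''u'');;
     Store ''own'' (Plus (Plus (Load ''off'' (Plus (Reg ''u'') (Const 1))) (Reg ''u'')) (Reg
       ''i'')) (Reg ''u'');;
     Assign ''i'' (Plus (Reg ''i'') (Const 1)))"

text \<open>\<open>row\<close> runs through the multiples of \<open>n\<close> by repeated addition,
  and \<open>rows\<close> stores them for the second pass, as the machine cannot multiply.\<close>

definition index_node :: com where
  "index_node =
    (Store ''rows'' (Reg ''u'') (Reg ''row'');;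
     Assign ''lo'' (Plus (Plus (Load ''off'' (Reg ''u'')) (Load ''off'' (Reg ''u''))) (Reg ''u''));;
     Store ''first'' (Reg ''u'') (Reg ''lo'');;
     Store ''second'' (Reg ''u'') (Reg ''lo'');;
     Assign ''i'' (Load ''off'' (Plus (Reg ''u'') (Const 1)));;
     Assign ''hi'' (Plus (Plus (Reg ''i'') (Reg ''i'')) (Reg ''u''));;
     Store ''worst'' (Reg ''u'') (Reg ''hi'');;
     Store ''opp'' (Reg ''hi'') (Reg ''hi'');;
     Store ''own'' (Reg ''hi'') (Reg ''u'');;
     Assign ''i'' (Load ''off'' (Reg ''u''));;
     While (Less (Reg ''i'') (Load ''off'' (Plus (Reg ''u'') (Const 1)))) index_entry;;
     Assign ''row'' (Plus (Reg ''row'') (Reg ''n''));;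
     Assign ''u'' (Plus (Reg ''u'') (Const 1)))"

definition index_all :: com where
  "index_all =
    (Assign ''u'' (Const 0);; Assign ''row'' (Const 0);; While (Less (Reg ''u'') (Reg ''n''))
      index_node)"

text \<open>A separate pass, since the position of \<open>u\<close> in the list of \<open>v\<close>
  may be unknown until all lists are indexed. \<open>q\<close> already includes
  \<open>off v\<close>, so both opposite slots need additions only.\<close>

definition link_entry :: com where
  "link_entry =
    (Assign ''v'' (Load ''adj'' (Reg ''i''));;
     Assign ''q'' (Load ''pos'' (Plus (Load ''rows'' (Reg ''v'')) (Reg ''u'')));;
     Store ''opp'' (Plus (Plus (Load ''off'' (Reg ''u'')) (Reg ''u'')) (Reg ''i''))
       (Plus (Plus (Load ''off'' (Plus (Reg ''v'') (Const 1))) (Reg ''v'')) (Reg ''q''));;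
     Store ''opp'' (Plus (Plus (Load ''off'' (Plus (Reg ''u'') (Const 1))) (Reg ''u'')) (Reg ''i''))
       (Plus (Plus (Load ''off'' (Reg ''v'')) (Reg ''v'')) (Reg ''q''));;
     Assign ''i'' (Plus (Reg ''i'') (Const 1)))"

definition link_node :: com where
  "link_node =
    (Assign ''i'' (Load ''off'' (Reg ''u''));;
     While (Less (Reg ''i'') (Load ''off'' (Plus (Reg ''u'') (Const 1)))) link_entry;;
     Assign ''u'' (Plus (Reg ''u'') (Const 1)))"

definition link_all :: com where
  "link_all = (Assign ''u'' (Const 0);; While (Less (Reg ''u'') (Reg ''n'')) link_node)"

section \<open>Memory layout of the slots\<close>

locale adjacency_lists =
  fixes n :: nat and adj :: "nat \<Rightarrow> nat list"
  assumes adj_distinct: "u < n \<Longrightarrow> distinct (adj u)"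
    and adj_less: "u < n \<Longrightarrow> v \<in> set (adj u) \<Longrightarrow> v < n"
    and adj_sym: "u < n \<Longrightarrow> v \<in> set (adj u) \<Longrightarrow> u \<in> set (adj v)"
begin

definition deg :: "nat \<Rightarrow> nat" where
  "deg u = length (adj u)"

definition off :: "nat \<Rightarrow> nat" where
  "off u = length (concat (map adj [0..<u]))"

text \<open>A block has \<open>2 * deg u + 1\<close> cells: the options in \<open>R\<close>, those
  in \<open>L\<close>, and the loop. All addresses are written as the sums that the program
  computes, where register \<open>i\<close> contains \<open>off u + a\<close>.\<close>

definition lo :: "nat \<Rightarrow> nat" where
  "lo u = off u + off u + u"

definition hi :: "nat \<Rightarrow> nat" where
  "hi u = off (Suc u) + off (Suc u) + u"

text \<open>\<open>rslot u a\<close> and \<open>lslot u a\<close> are the options of \<open>u\<close> to be matched to the neighbour at position \<open>a\<close>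
  of its list while belonging to \<open>R\<close>
    and to \<open>L\<close>, respectively; \<open>hi u\<close> is the option to stay unmatched.\<close>

definition rslot :: "nat \<Rightarrow> nat \<Rightarrow> nat" where
  "rslot u a = off u + u + (off u + a)"

definition lslot :: "nat \<Rightarrow> nat \<Rightarrow> nat" where
  "lslot u a = off (Suc u) + u + (off u + a)"

definition rank :: "nat \<Rightarrow> nat \<Rightarrow> nat" where
  "rank u v = (THE a. a < deg u \<and> adj u ! a = v)"

lemma off_0: "off 0 = 0"
  by (simp add: off_def)

lemma off_Suc: "off (Suc u) = off u + deg u"
  by (simp add: off_def deg_def)

lemma off_mono: "u \<le> v \<Longrightarrow> off u \<le> off v"
  by (induction v rule: dec_induct) (auto simp: off_Suc)

lemma off_less: "u < v \<Longrightarrow> a < deg u \<Longrightarrow> off u + a < off v"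
  using off_mono[of "Suc u" v] by (simp add: off_Suc)

lemma rank_nth: "u < n \<Longrightarrow> a < deg u \<Longrightarrow> rank u (adj u ! a) = a"
  unfolding rank_def
  by (rule the_equality) (use adj_distinct in \<open>auto simp: deg_def nth_eq_iff_index_eq\<close>)

lemma nth_rank:
  assumes "u < n" "v \<in> set (adj u)"
  shows "rank u v < deg u" "adj u ! rank u v = v"
  using assms rank_nth by (auto simp: in_set_conv_nth deg_def)

lemma nth_mem_adj: "a < deg u \<Longrightarrow> adj u ! a \<in> set (adj u)"
  by (simp add: deg_def)

lemma nth_adj_less: "u < n \<Longrightarrow> a < deg u \<Longrightarrow> adj u ! a < n"
  using adj_less nth_mem_adj by blast

lemma hi_less_lo: "u < v \<Longrightarrow> hi u < lo v"
  using off_mono[of "Suc u" v] by (simp add: hi_def lo_def)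

lemma slot_bounds:
  assumes "a < deg u"
  shows "lo u \<le> rslot u a" "rslot u a < lslot u b" "lslot u a < hi u" "lo u \<le> lslot u a"
    "rslot u a < hi u"
  using assms by (auto simp: lo_def hi_def rslot_def lslot_def off_Suc)

lemma block_unique: "lo u \<le> i \<Longrightarrow> i \<le> hi u \<Longrightarrow> lo v \<le> i \<Longrightarrow> i \<le> hi v \<Longrightarrow> u = v"
  using hi_less_lo[of u v] hi_less_lo[of v u] by (cases u v rule: linorder_cases) auto

lemma slot_cases:
  assumes "lo u \<le> i" "i \<le> hi u"
  obtains (r) a where "a < deg u" "i = rslot u a" | (l) a where "a < deg u" "i = lslot u a" | (h)
    "i = hi u"
proof -
  consider "i < lo u + deg u" | "lo u + deg u \<le> i" "i < hi u" | "i = hi u" using assms by linarith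
  then show thesis
  proof cases
    case 1
    with assms show ?thesis by (intro r[of "i - lo u"]) (auto simp: rslot_def lo_def)
  next
    case 2
    with assms show ?thesis
      by (intro l[of "i - lo u - deg u"]) (auto simp: lslot_def lo_def hi_def off_Suc)
  qed (rule h)
qed

lemma rslot_eq: 
  assumes "a < deg u" "b < deg v" "rslot u a = rslot v b" shows "u = v \<and> a = b"
proof -
  have "u = v"
    by (rule block_unique[of _ "rslot u a"]) (use slot_bounds[OF assms(1)]
    slot_bounds[OF assms(2)] assms(3) in auto)
  then show ?thesis using assms(3) by (simp add: rslot_def)
qed

lemma lslot_eq: 
  assumes "a < deg u" "b < deg v" "lslot u a = lslot v b" shows "u = v \<and> a = b"
proof -
  have "u = v"
    by (rule block_unique[of _ "lslot u a"]) (use slot_bounds[OF assms(1)]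
    slot_bounds[OF assms(2)] assms(3) in auto)
  then show ?thesis using assms(3) by (simp add: lslot_def)
qed

lemma rslot_neq_lslot: 
  assumes "a < deg u" "b < deg v" shows "rslot u a \<noteq> lslot v b"
proof
  assume e: "rslot u a = lslot v b"
  have "u = v"
    by (rule block_unique[of _ "rslot u a"]) (use slot_bounds[OF assms(1)]
    slot_bounds[OF assms(2)] e in auto)
  then show False using e assms by (simp add: lslot_def rslot_def off_Suc)
qed

lemma slot_neq_hi: 
  assumes "a < deg u" shows "rslot u a \<noteq> hi v" "lslot u a \<noteq> hi v"
proof -
  have "lo v \<le> hi v" by (simp add: lo_def hi_def off_Suc)
  then show "rslot u a \<noteq> hi v" "lslot u a \<noteq> hi v"
    using block_unique[of u "hi v" v] slot_bounds[OF assms]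
      by (metis less_imp_le less_irrefl order_refl)+
qed

lemma hi_inj: "hi u = hi v \<Longrightarrow> u = v"
  by (rule block_unique[of _ "hi u"]) (auto simp: lo_def hi_def off_Suc)

text \<open>\<open>opp\<close> exchanges the two kinds of slots, because an edge of the new instance
  has one endpoint in \<open>R\<close> and the other in \<open>L\<close>.\<close>

definition layout :: "(nat \<Rightarrow> nat) \<Rightarrow> (nat \<Rightarrow> nat) \<Rightarrow> bool" where
  "layout own opp \<longleftrightarrow>
     (\<forall>u<n. own (hi u) = u \<and> opp (hi u) = hi u \<and>
       (\<forall>a<deg u. own (rslot u a) = u \<and> own (lslot u a) = u \<and>
          opp (rslot u a) = lslot (adj u ! a) (rank (adj u ! a) u) \<and>
          opp (lslot u a) = rslot (adj u ! a) (rank (adj u ! a) u)))"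

lemma roommates_layout:
  assumes "layout own opp"
  shows "roommates n lo hi own opp"
proof
  fix u i assume u: "u < n" and i: "lo u \<le> i" "i \<le> hi u"
  from i show "own i = u"
    by (cases rule: slot_cases) (use assms u in \<open>auto simp: layout_def\<close>)
  from i show "own (opp i) < n \<and> lo (own (opp i)) \<le> opp i \<and> opp i \<le> hi (own (opp i)) \<and>
    opp (opp i) = i"
  proof (cases rule: slot_cases)
    case (r a)
    let ?v = "adj u ! a"
    have v: "?v < n" "u \<in> set (adj ?v)" using nth_adj_less adj_sym nth_mem_adj u r by auto
    note q = nth_rank[OF this]
    show ?thesis using assms u r v q slot_bounds[OF q(1)] rank_nth[OF u r(1)]
      by (auto simp: layout_def)
  next
    case (l a)
    let ?v = "adj u ! a"
    have v: "?v < n" "u \<in> set (adj ?v)" using nth_adj_less adj_sym nth_mem_adj u l by auto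
    note q = nth_rank[OF this]
    show ?thesis using assms u l v q slot_bounds[OF q(1)] rank_nth[OF u l(1)]
      by (auto simp: layout_def)
  next
    case h
    then show ?thesis using assms u i by (auto simp: layout_def)
  qed
next
  show "lo u \<le> hi u" for u by (simp add: lo_def hi_def off_Suc)
  show "u < n \<Longrightarrow> opp (hi u) = hi u" for u using assms by (simp add: layout_def)
qed

section \<open>The indexing pass\<close>

definition input_arrays :: "state \<Rightarrow> bool" where
  "input_arrays s \<longleftrightarrow> reg s ''n'' = n \<and> arr s ''mark'' = (\<lambda>_. 0) \<and>
     (\<forall>u\<le>n. arr s ''off'' u = off u) \<and>
     (\<forall>u<n. \<forall>a<deg u. arr s ''adj'' (off u + a) = adj u ! a)"

definition node_indexed :: "state \<Rightarrow> nat \<Rightarrow> bool" where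
  "node_indexed s u \<longleftrightarrow> arr s ''rows'' u = u * n \<and> arr s ''first'' u = lo u \<and>
    arr s ''second'' u = lo u \<and>
     arr s ''worst'' u = hi u \<and> arr s ''own'' (hi u) = u \<and> arr s ''opp'' (hi u) = hi u"

definition entry_indexed :: "state \<Rightarrow> nat \<Rightarrow> nat \<Rightarrow> bool" where
  "entry_indexed s u a \<longleftrightarrow> arr s ''own'' (rslot u a) = u \<and> arr s ''own'' (lslot u a) = u \<and>
     arr s ''pos'' (u * n + adj u ! a) = off u + a"

definition entry_linked :: "state \<Rightarrow> nat \<Rightarrow> nat \<Rightarrow> bool" where
  "entry_linked s u a \<longleftrightarrow>
     arr s ''opp'' (rslot u a) = lslot (adj u ! a) (rank (adj u ! a) u) \<and>
     arr s ''opp'' (lslot u a) = rslot (adj u ! a) (rank (adj u ! a) u)"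

lemma pos_inj:
  assumes "v < n" "v' < n" "u * n + v = u' * n + v'"
  shows "u = u' \<and> v = v'"
proof -
  have "(u * n + v) div n = u" "(u * n + v) mod n = v" "(u' * n + v') div n = u'"
    "(u' * n + v') mod n = v'"
    using assms(1,2) by auto
  then show ?thesis using assms(3) by metis
qed

definition index_inv :: "nat \<Rightarrow> state \<Rightarrow> bool" where
  "index_inv u s \<longleftrightarrow> input_arrays s \<and> reg s ''u'' = u \<and> reg s ''row'' = u * n \<and>
     off u \<le> reg s ''i'' \<and> reg s ''i'' \<le> off (Suc u) \<and> (\<forall>w\<le>u. node_indexed s w) \<and>
     (\<forall>w\<le>u. \<forall>a<deg w. off w + a < reg s ''i'' \<longrightarrow> entry_indexed s w a)"

text \<open>No write hits a cell filled earlier: slots of different nodes or entries are distinct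
  and differ from the loops, and a matrix cell determines its pair of nodes.\<close>

lemma index_entry:
  assumes u: "u < n" and I: "index_inv u s" and b: "reg s ''i'' < off (Suc u)"
  shows "wp index_entry (\<lambda>t s'. index_inv u s' \<and> t \<le> 40 \<and> reg s' ''i'' = Suc (reg s ''i'')) s"
proof -
  define a where "a = reg s ''i'' - off u"
  have i: "reg s ''i'' = off u + a" and a: "a < deg u" using I b
    by (auto simp: index_inv_def a_def off_Suc)
  have A: "input_arrays s" "reg s ''u'' = u" "reg s ''row'' = u * n"
    and nd: "\<And>w. w \<le> u \<Longrightarrow> node_indexed s w"
    and en: "\<And>w b. w \<le> u \<Longrightarrow> b < deg w \<Longrightarrow> off w + b < off u + a \<Longrightarrow> entry_indexed s w b"
    using I by (auto simp: index_inv_def i)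
  have ld: "arr s ''off'' u = off u" "arr s ''off'' (Suc u) = off (Suc u)"
    "arr s ''adj'' (off u + a) = adj u ! a"
    using A(1) u a by (auto simp: input_arrays_def)
  define P where "P = (arr s ''pos'')(u * n + adj u ! a := off u + a)"
  define W where "W = (arr s ''own'')(rslot u a := u, lslot u a := u)"
  have W: "W i = (if i = rslot u a \<or> i = lslot u a then u else arr s ''own'' i)" for i
    by (simp add: W_def)
  have Wh: "W (hi w) = w" if "w \<le> u" for w
    using nd[OF that] slot_neq_hi[OF a, of w, symmetric] by (simp add: W node_indexed_def)
  have new: "W (rslot w b) = w \<and> W (lslot w b) = w \<and> P (w * n + adj w ! b) = off w + b"
    if w: "w \<le> u" "b < deg w" "off w + b < off u + Suc a" for w b
  proof (cases "w = u \<and> b = a")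
    case False
    have wn: "w < n" using w u by simp
    have "off w + b \<noteq> off u + a"
      using False off_less[of w u b] w by (cases "w = u") auto
    then have e: "entry_indexed s w b" using en[OF w(1,2)] w(3) by simp
    have "w * n + adj w ! b \<noteq> u * n + adj u ! a"
      using pos_inj[OF nth_adj_less[OF wn w(2)] nth_adj_less[OF u a], of w u] False rank_nth[OF u]
        a w(2) by metis
    moreover have "rslot w b \<noteq> rslot u a" "lslot w b \<noteq> lslot u a"
      using rslot_eq[OF w(2) a] lslot_eq[OF w(2) a] False by auto
    ultimately show ?thesis
      using e rslot_neq_lslot[OF a w(2)] rslot_neq_lslot[OF w(2) a]
        by (auto simp: W P_def entry_indexed_def)
  qed (auto simp: W P_def)
  show ?thesis
    unfolding index_entry_def
    using A ld nd Wh new i a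
    by (simp add: index_inv_def input_arrays_def node_indexed_def entry_indexed_def off_Suc
        rslot_def[symmetric] lslot_def[symmetric, unfolded off_Suc] W_def[symmetric]
          P_def[symmetric])
qed

lemma index_loop:
  assumes u: "u < n" and I: "index_inv u s"
  shows "wp (While (Less (Reg ''i'') (Load ''off'' (Plus (Reg ''u'') (Const 1)))) index_entry)
    (\<lambda>t s'. index_inv u s' \<and> reg s' ''i'' = off (Suc u) \<and> t \<le> 50 * (off (Suc u) - reg s ''i'') +
      10) s"
proof -
  let ?b = "Less (Reg ''i'') (Load ''off'' (Plus (Reg ''u'') (Const 1)))"
  have b: "bval ?b s \<longleftrightarrow> reg s ''i'' < off (Suc u)" if "index_inv u s" for s
    using that u by (simp add: index_inv_def input_arrays_def)
  have step: "wp index_entry (\<lambda>t s'. index_inv u s' \<and>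
    bcost ?b + t + 50 * (off (Suc u) - reg s' ''i'')
      \<le> 50 * (off (Suc u) - reg s ''i'')) s" if "index_inv u s" "bval ?b s" for s
    by (rule wp_mono[OF index_entry[OF u that(1)]]) (use b that in auto)
  show ?thesis
    by (rule wp_While_strong[OF I step]) (use b in \<open>auto simp: index_inv_def\<close>)
qed

definition indexed :: "nat \<Rightarrow> state \<Rightarrow> bool" where
  "indexed u s \<longleftrightarrow> input_arrays s \<and> (\<forall>w<u. node_indexed s w \<and> (\<forall>a<deg w. entry_indexed s w a))"

lemma index_node:
  assumes u: "reg s ''u'' = u" "u < n" and r: "reg s ''row'' = u * n" and I: "indexed u s"
  shows "wp index_node (\<lambda>t s'. indexed (Suc u) s' \<and> reg s' ''u'' = Suc u \<and>
    reg s' ''row'' = Suc u * n \<and>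
    t \<le> 50 * deg u + 100) s"
proof -
  let ?s = "assign ''i'' (off u) (store ''own'' (hi u) u (store ''opp'' (hi u) (hi u) (store
    ''worst'' u (hi u)
    (assign ''hi'' (hi u) (assign ''i'' (off (Suc u)) (store ''second'' u (lo u) (store ''first''
      u (lo u)
    (assign ''lo'' (lo u) (store ''rows'' u (u * n) s)))))))))"
  have A: "input_arrays ?s" using I by (simp add: indexed_def input_arrays_def)
  have "node_indexed ?s w" if "w \<le> u" for w
    using that I hi_inj[of w u] by (auto simp: indexed_def node_indexed_def)
  moreover have "entry_indexed ?s w a" if w: "w \<le> u" "a < deg w" "off w + a < off u" for w a
  proof -
    have "w < u" using w by (cases "w = u") auto
    then show ?thesis using I w slot_neq_hi[OF w(2), of u]
      by (simp add: indexed_def entry_indexed_def)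
  qed
  ultimately have J: "index_inv u ?s" using A u r by (simp add: index_inv_def off_Suc)
  have ld: "arr s ''off'' u = off u" "arr s ''off'' (Suc u) = off (Suc u)"
    using I u by (simp_all add: indexed_def input_arrays_def)
  have fin: "indexed (Suc u) (assign ''u'' (Suc u) (assign ''row'' (u * n + n) s'))"
    "reg s' ''u'' = u" "reg s' ''row'' = u * n" "reg s' ''n'' = n"
    if "index_inv u s'" "reg s' ''i'' = off (Suc u)" for s'
  proof -
    have "off w + a < off (Suc u)" if "w \<le> u" "a < deg w" for w a
      using off_less[of w "Suc u" a] that by simp
    then show "indexed (Suc u) (assign ''u'' (Suc u) (assign ''row'' (u * n + n) s'))"
      using that by (simp add: indexed_def index_inv_def input_arrays_def node_indexed_def
        entry_indexed_def
          less_Suc_eq_le)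
  qed (use that in \<open>auto simp: index_inv_def input_arrays_def\<close>)
  show ?thesis
    unfolding index_node_def
    using u r ld index_loop[OF u(2) J]
    by (simp add: lo_def[symmetric] hi_def[symmetric]) (erule wp_mono, auto simp: fin off_Suc)
qed

lemma index_all:
  assumes s: "input_arrays s"
  shows "wp index_all (\<lambda>t s'. indexed n s' \<and> t \<le> 50 * off n + 110 * n + 10) s"
proof -
  let ?b = "Less (Reg ''u'') (Reg ''n'')"
  define I where "I s \<longleftrightarrow> indexed (reg s ''u'') s \<and> reg s ''u'' \<le> n \<and>
    reg s ''row'' = reg s ''u'' * n" for s
  let ?\<Phi> = "\<lambda>s. 50 * (off n - off (reg s ''u'')) + 110 * (n - reg s ''u'')"
  let ?s = "assign ''row'' 0 (assign ''u'' 0 s)"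
  have I0: "I ?s" using s by (simp add: I_def indexed_def input_arrays_def)
  have b: "bval ?b s \<longleftrightarrow> reg s ''u'' < n" if "I s" for s
    using that by (simp add: I_def indexed_def input_arrays_def)
  have step: "wp index_node (\<lambda>t s'. I s' \<and> bcost ?b + t + ?\<Phi> s' \<le> ?\<Phi> s) s" if "I s" "bval ?b s"
    for s
  proof -
    have u: "reg s ''u'' < n" using b that by simp
    have "off (Suc (reg s ''u'')) \<le> off n" using off_mono u by simp
    then show ?thesis
      by (intro wp_mono[OF index_node[OF refl u]]) (use that u in \<open>auto simp: I_def off_Suc\<close>)
  qed
  have "wp (While ?b index_node) (\<lambda>t s'. indexed n s' \<and> 4 + t \<le> 50 * off n + 110 * n + 10) ?s"
    by (rule wp_While_strong[OF I0 step]) (use b in \<open>auto simp: I_def off_0\<close>)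
  then show ?thesis by (simp add: index_all_def)
qed

section \<open>The linking pass\<close>

definition link_inv :: "nat \<Rightarrow> state \<Rightarrow> bool" where
  "link_inv u s \<longleftrightarrow> indexed n s \<and> reg s ''u'' = u \<and>
     off u \<le> reg s ''i'' \<and> reg s ''i'' \<le> off (Suc u) \<and>
     (\<forall>w\<le>u. \<forall>a<deg w. off w + a < reg s ''i'' \<longrightarrow> entry_linked s w a)"

lemma link_entry:
  assumes u: "u < n" and I: "link_inv u s" and b: "reg s ''i'' < off (Suc u)"
  shows "wp link_entry (\<lambda>t s'. link_inv u s' \<and> t \<le> 50 \<and> reg s' ''i'' = Suc (reg s ''i'')) s"
proof -
  define a where "a = reg s ''i'' - off u"
  have i: "reg s ''i'' = off u + a" and a: "a < deg u" using I b
    by (auto simp: link_inv_def a_def off_Suc)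
  let ?v = "adj u ! a"
  have v: "?v < n" "u \<in> set (adj ?v)" using nth_adj_less adj_sym nth_mem_adj u a by auto
  note q = nth_rank[OF this]
  have X: "indexed n s" "reg s ''u'' = u"
    and en: "\<And>w b. w \<le> u \<Longrightarrow> b < deg w \<Longrightarrow> off w + b < off u + a \<Longrightarrow> entry_linked s w b"
    using I by (auto simp: link_inv_def i)
  have ld: "arr s ''off'' u = off u" "arr s ''off'' (Suc u) = off (Suc u)"
    "arr s ''adj'' (off u + a) = ?v"
    "arr s ''off'' ?v = off ?v" "arr s ''off'' (Suc ?v) = off (Suc ?v)" "arr s ''rows'' ?v = ?v * n"
    using X(1) u a v by (auto simp: indexed_def input_arrays_def node_indexed_def)
  have "entry_indexed s ?v (rank ?v u)" using X(1) v q by (simp add: indexed_def)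
  then have ps: "arr s ''pos'' (?v * n + u) = off ?v + rank ?v u" using q
    by (simp add: entry_indexed_def)
  define W where "W = (arr s ''opp'')(rslot u a := lslot ?v (rank ?v u), lslot u a :=
    rslot ?v (rank ?v u))"
  have W: "W i = (if i = lslot u a then rslot ?v (rank ?v u) else if i =
    rslot u a then lslot ?v (rank ?v u)
    else arr s ''opp'' i)" for i by (simp add: W_def)
  have Wh: "W (hi w) = arr s ''opp'' (hi w)" for w using slot_neq_hi[OF a, of w, symmetric]
    by (simp add: W)
  have new: "W (rslot w b) = lslot (adj w ! b) (rank (adj w ! b) w) \<and>
      W (lslot w b) = rslot (adj w ! b) (rank (adj w ! b) w)"
    if w: "w \<le> u" "b < deg w" "off w + b < off u + Suc a" for w b
  proof (cases "w = u \<and> b = a")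
    case False
    have "off w + b \<noteq> off u + a"
      using False off_less[of w u b] w by (cases "w = u") auto
    then have e: "entry_linked s w b" using en[OF w(1,2)] w(3) by simp
    have "rslot w b \<noteq> rslot u a" "lslot w b \<noteq> lslot u a"
      using rslot_eq[OF w(2) a] lslot_eq[OF w(2) a] False by auto
    then show ?thesis
      using e rslot_neq_lslot[OF a w(2)] rslot_neq_lslot[OF w(2) a]
        by (auto simp: W entry_linked_def)
  qed (use rslot_neq_lslot[OF a a] in \<open>auto simp: W\<close>)
  let ?s = "assign ''i'' (Suc (off u + a)) (store ''opp'' (lslot u a) (rslot ?v (rank ?v u))
    (store ''opp'' (rslot u a) (lslot ?v (rank ?v u)) (assign ''q'' (off ?v + rank ?v u) (assign
      ''v'' ?v s))))"
  have "arr ?s ''opp'' = W" by (simp add: W_def)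
  then have "link_inv u ?s"
    using X new Wh a
      by (simp add: link_inv_def indexed_def input_arrays_def node_indexed_def entry_indexed_def
        entry_linked_def off_Suc del: arr_store)
     (simp add: indexed_def)
  then show ?thesis
    unfolding link_entry_def
    using X ld ps i by (simp add: rslot_def lslot_def)
qed

lemma link_loop:
  assumes u: "u < n" and I: "link_inv u s"
  shows "wp (While (Less (Reg ''i'') (Load ''off'' (Plus (Reg ''u'') (Const 1)))) link_entry)
    (\<lambda>t s'. link_inv u s' \<and> reg s' ''i'' = off (Suc u) \<and> t \<le> 60 * (off (Suc u) - reg s ''i'') +
      10) s"
proof -
  let ?b = "Less (Reg ''i'') (Load ''off'' (Plus (Reg ''u'') (Const 1)))"
  have b: "bval ?b s \<longleftrightarrow> reg s ''i'' < off (Suc u)" if "link_inv u s" for s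
    using that u by (simp add: link_inv_def indexed_def input_arrays_def)
  have step: "wp link_entry (\<lambda>t s'. link_inv u s' \<and> bcost ?b + t + 60 * (off (Suc u) - reg s' ''i'')
      \<le> 60 * (off (Suc u) - reg s ''i'')) s" if "link_inv u s" "bval ?b s" for s
    by (rule wp_mono[OF link_entry[OF u that(1)]]) (use b that in auto)
  show ?thesis
    by (rule wp_While_strong[OF I step]) (use b in \<open>auto simp: link_inv_def\<close>)
qed

definition linked :: "nat \<Rightarrow> state \<Rightarrow> bool" where
  "linked u s \<longleftrightarrow> indexed n s \<and> (\<forall>w<u. \<forall>a<deg w. entry_linked s w a)"

lemma link_node:
  assumes u: "reg s ''u'' = u" "u < n" and I: "linked u s"
  shows "wp link_node (\<lambda>t s'. linked (Suc u) s' \<and> reg s' ''u'' = Suc u \<and> t \<le> 60 * deg u + 50) s"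
proof -
  let ?s = "assign ''i'' (off u) s"
  have "entry_linked ?s w a" if w: "w \<le> u" "a < deg w" "off w + a < off u" for w a
  proof -
    have "w < u" using w by (cases "w = u") auto
    then show ?thesis using I w by (simp add: linked_def entry_linked_def)
  qed
  moreover have "indexed n ?s"
    using I by (simp add: linked_def indexed_def input_arrays_def node_indexed_def
      entry_indexed_def)
  ultimately have J: "link_inv u ?s" using u by (simp add: link_inv_def off_Suc)
  have ld: "arr s ''off'' u = off u"
    using I u by (simp add: linked_def indexed_def input_arrays_def)
  have fin: "linked (Suc u) (assign ''u'' (Suc u) s')" "reg s' ''u'' = u"
    if "link_inv u s'" "reg s' ''i'' = off (Suc u)" for s'
  proof -
    have "off w + a < off (Suc u)" if "w \<le> u" "a < deg w" for w a
      using off_less[of w "Suc u" a] that by simp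
    then show "linked (Suc u) (assign ''u'' (Suc u) s')"
      using that by (simp add: linked_def link_inv_def indexed_def input_arrays_def node_indexed_def
          entry_indexed_def entry_linked_def less_Suc_eq_le)
  qed (use that in \<open>auto simp: link_inv_def\<close>)
  show ?thesis
    unfolding link_node_def
    using u ld link_loop[OF u(2) J]
    by simp (erule wp_mono, auto simp: fin off_Suc)
qed

lemma link_all:
  assumes s: "indexed n s"
  shows "wp link_all (\<lambda>t s'. linked n s' \<and> t \<le> 60 * off n + 60 * n + 10) s"
proof -
  let ?b = "Less (Reg ''u'') (Reg ''n'')"
  define I where "I s \<longleftrightarrow> linked (reg s ''u'') s \<and> reg s ''u'' \<le> n" for s
  let ?\<Phi> = "\<lambda>s. 60 * (off n - off (reg s ''u'')) + 60 * (n - reg s ''u'')"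
  let ?s = "assign ''u'' 0 s"
  have I0: "I ?s" using s
    by (simp add: I_def linked_def indexed_def input_arrays_def node_indexed_def entry_indexed_def)
  have b: "bval ?b s \<longleftrightarrow> reg s ''u'' < n" if "I s" for s
    using that by (simp add: I_def linked_def indexed_def input_arrays_def)
  have step: "wp link_node (\<lambda>t s'. I s' \<and> bcost ?b + t + ?\<Phi> s' \<le> ?\<Phi> s) s" if "I s" "bval ?b s" for s
  proof -
    have u: "reg s ''u'' < n" using b that by simp
    have "off (Suc (reg s ''u'')) \<le> off n" using off_mono u by simp
    then show ?thesis
      by (intro wp_mono[OF link_node[OF refl u]]) (use that u in \<open>auto simp: I_def off_Suc\<close>)
  qed
  have "wp (While ?b link_node) (\<lambda>t s'. linked n s' \<and> 2 + t \<le> 60 * off n + 60 * n + 10) ?s"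
    by (rule wp_While_strong[OF I0 step]) (use b in \<open>auto simp: I_def off_0\<close>)
  then show ?thesis by (simp add: link_all_def)
qed

lemma linked_layout: "linked n s \<Longrightarrow> layout (arr s ''own'') (arr s ''opp'')"
  by (simp add: linked_def indexed_def layout_def node_indexed_def entry_indexed_def
    entry_linked_def)

lemma nth_concat_adj:
  assumes "u < n" "a < deg u"
  shows "concat (map adj [0..<n]) ! (off u + a) = adj u ! a"
proof -
  have "[0..<n] = [0..<u] @ u # [Suc u..<n]"
    using assms(1)
      by (metis le_add_same_cancel1 less_imp_add_positive upt_add_eq_append upt_conv_Cons zero_le)
  then have "concat (map adj [0..<n]) =
    concat (map adj [0..<u]) @ adj u @ concat (map adj [Suc u..<n])"
    by simp
  then show ?thesis using assms(2) by (simp add: off_def deg_def nth_append)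
qed

lemma input_arrays_input_state: "input_arrays (input_state n adj)"
  using nth_concat_adj off_less by (simp add: input_arrays_def input_state_def Let_def off_def)

end

section \<open>Strongly dominant matchings as stable matchings\<close>

locale preference_instance =
  fixes n :: nat and E :: "nat set set" and pref :: "nat \<Rightarrow> nat \<Rightarrow> nat \<Rightarrow> bool"
    and adj :: "nat \<Rightarrow> nat list"
  assumes graph: "simple_graph {..<n} E"
    and prefs: "strict_preferences {..<n} E pref"
    and lists: "preference_lists n E pref adj"
begin

lemma edge_nodes: "{u, v} \<in> E \<Longrightarrow> u < n \<and> v < n \<and> u \<noteq> v"
  using graph by (fastforce simp: simple_graph_def doubleton_eq_iff)

lemma set_adj: "u < n \<Longrightarrow> v \<in> set (adj u) \<longleftrightarrow> {u, v} \<in> E"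
  using lists by (simp add: preference_lists_def neighbours_def)

sublocale adjacency_lists n adj
proof
  show "u < n \<Longrightarrow> distinct (adj u)" for u using lists by (simp add: preference_lists_def)
  show "v < n" if "u < n" "v \<in> set (adj u)" for u v using that edge_nodes by (simp add: set_adj)
  show "u \<in> set (adj v)" if "u < n" "v \<in> set (adj u)" for u v
    using that edge_nodes[of u v] by (simp add: set_adj insert_commute)
qed

text \<open>The list entries correspond to ordered pairs of adjacent nodes, and at most two such
  pairs have the same underlying edge.\<close>

lemma off_le_edges: "off n \<le> 2 * card E"
proof -
  have "finite E"
    using graph by (auto simp: simple_graph_def intro!: finite_subset[of E "Pow {..<n}"])
  let ?A = "SIGMA u:{..<n}. set (adj u)"
  have "off n = (\<Sum>u<n. length (adj u))"
    by (simp add: off_def length_concat comp_def sum_list_distinct_conv_sum_set atLeast0LessThan)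
  also have "\<dots> = (\<Sum>u<n. card (set (adj u)))"
    by (simp add: adj_distinct distinct_card)
  also have "\<dots> = card ?A" by simp
  also have "\<dots> \<le> card (\<Union>e\<in>E. {p. {fst p, snd p} = e})"
  proof (rule card_mono)
    have "finite {p. {fst p, snd p} = e}" for e :: "nat set"
    proof (cases "finite e")
      case True
      have "{p. {fst p, snd p} = e} \<subseteq> e \<times> e" by auto
      then show ?thesis using True finite_subset by blast
    next
      case False
      then have "{p. {fst p, snd p} = e} = {}" by auto
      then show ?thesis by simp
    qed
    then show "finite (\<Union>e\<in>E. {p. {fst p, snd p} = e})" using \<open>finite E\<close> by blast
  qed (auto simp: set_adj)
  also have "\<dots> \<le> (\<Sum>e\<in>E. card {p. {fst p, snd p} = e})"
    by (rule card_UN_le) fact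
  also have "\<dots> \<le> (\<Sum>e\<in>E. 2)"
  proof (rule sum_mono)
    fix e assume "e \<in> E"
    then obtain u v where e: "e = {u, v}" using graph by (auto simp: simple_graph_def)
    have "{p. {fst p, snd p} = e} \<subseteq> {(u, v), (v, u)}" by (auto simp: e doubleton_eq_iff)
    then have "card {p. {fst p, snd p} = e} \<le> card {(u, v), (v, u)}" by (intro card_mono) auto
    then show "card {p. {fst p, snd p} = e} \<le> 2" by (auto simp: card_insert_if split: if_splits)
  qed
  finally show ?thesis by simp
qed

text \<open>Sortedness gives one direction. The other follows because a strict order cannot prefer
  both ways and equal positions mean equal nodes.\<close>

lemma pref_iff:
  assumes "{u, v} \<in> E" "{u, w} \<in> E"
  shows "pref u v w \<longleftrightarrow> rank u v < rank u w"
proof -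
  have u: "u < n" using edge_nodes[OF assms(1)] by simp
  have v: "v \<in> set (adj u)" and w: "w \<in> set (adj u)" using assms u by (simp_all add: set_adj)
  have less: "pref u x y" if "x \<in> set (adj u)" "y \<in> set (adj u)" "rank u x < rank u y" for x y
  proof -
    have "sorted_wrt (pref u) (adj u)" using lists u by (simp add: preference_lists_def)
    from sorted_wrt_nth_less[OF this that(3)] show ?thesis
      using nth_rank[OF u that(1)] nth_rank[OF u that(2)] by (simp add: deg_def)
  qed
  have irr: "irreflp_on (neighbours E u) (pref u)" and tr: "transp_on (neighbours E u) (pref u)"
    using prefs u by (auto simp: strict_preferences_def)
  have nb: "v \<in> neighbours E u" "w \<in> neighbours E u" using assms by (auto simp: neighbours_def)
  have "\<not> pref u v v" using irreflp_onD[OF irr nb(1)] .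
  moreover from this have "\<not> (pref u v w \<and> pref u w v)" using transp_onD[OF tr nb(1,2,1)] by blast
  moreover have "v = w" if "rank u v = rank u w"
  proof -
    have "v = adj u ! rank u w" using nth_rank(2)[OF u v] unfolding that by (rule sym)
    with nth_rank(2)[OF u w] show ?thesis by (rule trans[rotated])
  qed
  ultimately show ?thesis
    using less[OF v w] less[OF w v] by (cases "rank u v" "rank u w" rule: linorder_cases) auto
qed

definition RS :: "nat \<Rightarrow> nat \<Rightarrow> nat" where
  "RS u v = rslot u (rank u v)"

definition LS :: "nat \<Rightarrow> nat \<Rightarrow> nat" where
  "LS u v = lslot u (rank u v)"

lemma rank_less: "{u, v} \<in> E \<Longrightarrow> rank u v < deg u"
  using nth_rank set_adj edge_nodes by blast

lemma rank_eq: "{u, v} \<in> E \<Longrightarrow> {u, w} \<in> E \<Longrightarrow> rank u v = rank u w \<Longrightarrow> v = w"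
  using nth_rank(2) set_adj edge_nodes by metis

lemma RS_less: "RS u v < RS u w \<longleftrightarrow> rank u v < rank u w"
  by (simp add: RS_def rslot_def)

lemma LS_less: "LS u v < LS u w \<longleftrightarrow> rank u v < rank u w"
  by (simp add: LS_def lslot_def)

lemma RS_LS: "{u, v} \<in> E \<Longrightarrow> RS u v < LS u w"
  using slot_bounds(2)[OF rank_less] by (simp add: RS_def LS_def)

lemma LS_hi: "{u, v} \<in> E \<Longrightarrow> LS u v < hi u"
  using slot_bounds(3)[OF rank_less] by (simp add: LS_def)

lemma RS_hi: "{u, v} \<in> E \<Longrightarrow> RS u v < hi u"
  using slot_bounds(5)[OF rank_less] by (simp add: RS_def)

context
  fixes own opp
  assumes lay: "layout own opp"
begin

interpretation roommates n lo hi own opp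
  using roommates_layout[OF lay] .

lemma opp_RS: "{u, v} \<in> E \<Longrightarrow> opp (RS u v) = LS v u \<and> peer (RS u v) = v"
  and opp_LS: "{u, v} \<in> E \<Longrightarrow> opp (LS u v) = RS v u \<and> peer (LS u v) = v"
proof -
  assume e: "{u, v} \<in> E"
  then have uv: "u < n" "v < n" "{v, u} \<in> E" using edge_nodes[OF e] by (auto simp: insert_commute)
  have "adj u ! rank u v = v" using nth_rank e uv by (simp add: set_adj)
  then show "opp (RS u v) = LS v u \<and> peer (RS u v) = v" "opp (LS u v) = RS v u \<and> peer (LS u v) = v"
    using lay uv rank_less[OF e] rank_less[OF uv(3)]
      by (auto simp: layout_def RS_def LS_def peer_def)
qed

lemma slot_iff: "slot u i \<longleftrightarrow> u < n \<and> (i = hi u \<or> (\<exists>v. {u, v} \<in> E \<and> (i = RS u v \<or> i = LS u v)))"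
proof
  assume "slot u i"
  then have u: "u < n" and i: "lo u \<le> i" "i \<le> hi u" by (auto simp: slot_def)
  have ex: "\<exists>v. {u, v} \<in> E \<and> rank u v = a" if "a < deg u" for a
    using that rank_nth[OF u] nth_mem_adj set_adj[OF u] by blast
  from i show "u < n \<and> (i = hi u \<or> (\<exists>v. {u, v} \<in> E \<and> (i = RS u v \<or> i = LS u v)))"
    by (cases rule: slot_cases) (use u ex in \<open>auto simp: RS_def LS_def\<close>)
next
  assume "u < n \<and> (i = hi u \<or> (\<exists>v. {u, v} \<in> E \<and> (i = RS u v \<or> i = LS u v)))"
  then show "slot u i"
    using slot_bounds[OF rank_less] by (auto simp: slot_def RS_def LS_def lo_le_hi less_imp_le)
qed

lemma partner_eq:
  assumes "matching E M" "{u, v} \<in> M"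
  shows "partner M u = v"
  unfolding partner_def
proof (rule the_equality)
  fix w assume w: "{u, w} \<in> M"
  have "\<not> disjnt {u, w} {u, v}" by (simp add: disjnt_def)
  moreover have "pairwise disjnt M" using assms(1) by (simp add: matching_def)
  ultimately have "{u, w} = {u, v}" using pairwiseD[of disjnt M "{u, w}" "{u, v}"] w assms(2)
    by argo
  then show "w = v" by (auto simp: doubleton_eq_iff)
qed fact

lemma matched_partner:
  assumes "matching E M" "matched M u"
  shows "{u, partner M u} \<in> M"
proof -
  obtain e where e: "e \<in> M" "u \<in> e" using assms(2) by (auto simp: matched_def)
  then have "e \<in> E" using assms(1) by (auto simp: matching_def)
  then obtain a b where "e = {a, b}" using graph by (auto simp: simple_graph_def)
  with e have "\<exists>v. {u, v} \<in> M" by (auto simp: insert_commute)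
  then show ?thesis using partner_eq[OF assms(1)] by auto
qed

text \<open>It suffices to test the options with \<open>u\<close> wanted in \<open>R\<close> and
  \<open>v\<close> in \<open>L\<close>. If \<open>v\<close> is in \<open>R\<close>, it is matched by
  (ii) and its slot beats any option in \<open>L\<close>. If \<open>v\<close> is in \<open>L\<close>
  and \<open>u\<close> in \<open>R\<close>, condition (iii) yields a \<open>-\<close> at one end. If
  both are in \<open>L\<close>, condition (iv) yields a \<open>-\<close> at
  \<open>v\<close>.\<close>

lemma stable_of_strongly_dominant:
  assumes "strongly_dominant {..<n} E pref M"
  shows "\<exists>m. stable m"
proof -
  from assms[unfolded strongly_dominant_def] obtain L R where mat: "matching E M"
    and V: "L \<union> R = {..<n}" "L \<inter> R = {}"
    and LR: "\<forall>e\<in>M. \<exists>u\<in>L. \<exists>v\<in>R. e = {u, v}" and Rm: "\<forall>v\<in>R. matched M v"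
    and pp: "\<forall>u v. plus_plus_edge E pref M u v \<longrightarrow> u \<in> R \<and> v \<in> R"
    and mm: "\<forall>u\<in>L. \<forall>v\<in>L. {u, v} \<in> E \<longrightarrow> minus_minus_edge E pref M u v"
    by (elim conjE exE)
  have ME: "e \<in> M \<Longrightarrow> e \<in> E" for e using mat by (auto simp: matching_def)
  define m where "m u =
    (if \<not> matched M u then hi u else if u \<in> R then RS u (partner M u) else LS u (partner M
    u))" for u
  have pe: "{u, partner M u} \<in> E" if "matched M u" for u using matched_partner[OF mat that] ME
    by blast
  have side: "u \<in> L \<and> v \<in> R \<or> v \<in> L \<and> u \<in> R" if "{u, v} \<in> M" for u v
    using LR that by (fastforce simp: doubleton_eq_iff)
  have mM: "m u = (if u \<in> R then RS u v else LS u v)" if "{u, v} \<in> M" for u v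
    using that partner_eq[OF mat that] by (auto simp: m_def matched_def)
  have "slot u (m u) \<and> m (peer (m u)) = opp (m u)" if u: "u < n" for u
  proof (cases "matched M u")
    case False
    then show ?thesis using u by (simp add: m_def slot_hi peer_hi opp_hi)
  next
    case True
    let ?v = "partner M u"
    have e: "{u, ?v} \<in> M" "{?v, u} \<in> M" "{u, ?v} \<in> E"
      using matched_partner[OF mat True] ME by (auto simp: insert_commute)
    then show ?thesis
      using mM[OF e(1)] mM[OF e(2)] opp_RS[OF e(3)] opp_LS[OF e(3)] side[OF e(1)] V(2) u
        slot_iff[of u "m u"]
      by (cases "u \<in> R") auto
  qed
  moreover have RSok: "m u \<le> RS u v \<or> m v \<le> LS v u" if e: "{u, v} \<in> E" for u v
  proof -
    have e': "{v, u} \<in> E" using e by (simp add: insert_commute)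
    have uv: "u < n" "v < n" using edge_nodes[OF e] by auto
    show ?thesis
    proof (cases "{u, v} \<in> M")
      case True
      then have "{v, u} \<in> M" by (simp add: insert_commute)
      then show ?thesis using mM[OF True] mM[of v u] side[OF True] V(2) RS_LS[OF e', of u] by force
    next
      case False
      have Lv: "m v < LS v u" if "minus_label pref M v u" "v \<in> L"
        using that V(2) pe[of v] pref_iff[OF pe e'] by (auto simp: minus_label_def m_def LS_less)
      \<comment> \<open>Outside \<open>M\<close> the two labels are complementary: the partner
        differs from \<open>y\<close>, so their positions differ.\<close>
      have minus: "minus_label pref M x y" if "\<not> plus_label pref M x y" "{x, y} \<in> E" "{x, y} \<notin> M"
        for x y
      proof -
        have mx: "matched M x" using that(1) by (simp add: plus_label_def)
        have "partner M x \<noteq> y" using matched_partner[OF mat mx] that(3) by auto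
        then have "rank x (partner M x) \<noteq> rank x y" using rank_eq[OF pe[OF mx] that(2)] by blast
        then show ?thesis
          using that(1) mx pref_iff[OF pe[OF mx] that(2)] pref_iff[OF that(2) pe[OF mx]]
          by (auto simp: minus_label_def plus_label_def)
      qed
      show ?thesis
      proof (cases "v \<in> R")
        case True
        then have "matched M v" using Rm by blast
        then show ?thesis using True RS_LS[OF pe, of v u] by (simp add: m_def)
      next
        case v: False
        then have vL: "v \<in> L" using V uv by auto
        show ?thesis
        proof (cases "u \<in> R")
          case True
          then have mu: "matched M u" using Rm by blast
          have "\<not> plus_plus_edge E pref M u v" using pp v by blast
          then consider "\<not> plus_label pref M u v" | "\<not> plus_label pref M v u"
            using e False by (auto simp: plus_plus_edge_def)
          then show ?thesis
          proof cases
            case 1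
            from minus[OF this e False] have "RS u (partner M u) < RS u v"
              using pref_iff[OF pe[OF mu] e] by (simp add: minus_label_def RS_less)
            then show ?thesis using True mu by (simp add: m_def)
          next
            case 2
            from minus[OF this e'] False Lv vL show ?thesis by (simp add: insert_commute)
          qed
        next
          case False
          then have "u \<in> L" using V uv by auto
          then have "minus_label pref M v u" using mm vL e by (auto simp: minus_minus_edge_def)
          then show ?thesis using Lv vL by simp
        qed
      qed
    qed
  qed
  moreover have "m u \<le> i \<or> m (peer i) \<le> opp i" if "slot u i" for u i
  proof -
    from that consider "u < n" "i = hi u" | v where "{u, v} \<in> E"
      "i = RS u v" | v where "{u, v} \<in> E" "i = LS u v"
      by (auto simp: slot_iff)
    then show ?thesis
    proof cases
      case 1
      then show ?thesis using calculation(1)[of u] by (auto simp: slot_def)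
    next
      case (2 v)
      then show ?thesis using opp_RS RSok by simp
    next
      case (3 v)
      then show ?thesis using opp_LS RSok[of v u] by (auto simp: insert_commute)
    qed
  qed
  ultimately have "stable m" unfolding stable_def by blast
  then show ?thesis by blast
qed

text \<open>\<open>R\<close> consists of the nodes using an option in \<open>R\<close>, and
  \<open>L\<close> takes the rest, including the unmatched nodes. The last conjunct connects the
  loop test of \<open>report\<close> with the output format.\<close>

lemma strongly_dominant_of_stable:
  assumes st: "stable m"
  shows "\<exists>M. strongly_dominant {..<n} E pref M \<and>
    (\<forall>u<n. (if opp (m u) = m u then 0 else peer (m u) + 1) = (if matched M u then partner M u + 1
      else 0))"
proof -
  define M where "M = {{u, v} | u v. {u, v} \<in> E \<and> m u = RS u v}"
  define R where "R = {u. u < n \<and> (\<exists>v. {u, v} \<in> E \<and> m u = RS u v)}"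
  define L where "L = {..<n} - R"
  have ms: "slot u (m u)" "m (peer (m u)) = opp (m u)" if "u < n" for u
    using st that by (auto simp: stable_def)
  have sym: "{u, v} \<in> E \<Longrightarrow> {v, u} \<in> E" for u v by (simp add: insert_commute)
  have RL: "m v = LS v u" if "{u, v} \<in> E" "m u = RS u v" for u v
    using that ms(2)[of u] opp_RS[OF that(1)] edge_nodes[OF that(1)] by auto
  have LR: "m v = RS v u" if "{u, v} \<in> E" "m u = LS u v" for u v
    using that ms(2)[of u] opp_LS[OF that(1)] edge_nodes[OF that(1)] by auto
  have Linj: "v = w" if "{u, v} \<in> E" "{u, w} \<in> E" "LS u v = LS u w" for u v w
    using that rank_eq by (auto simp: LS_def lslot_def)
  have Rinj: "v = w" if "{u, v} \<in> E" "{u, w} \<in> E" "RS u v = RS u w" for u v w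
    using that rank_eq by (auto simp: RS_def rslot_def)
  have RLne: "RS u v \<noteq> LS u w" if "{u, v} \<in> E" for u v w using RS_LS[OF that, of w] by simp
  have M_iff: "{u, v} \<in> M \<longleftrightarrow> {u, v} \<in> E \<and> (m u = RS u v \<or> m u = LS u v)" for u v
  proof
    assume "{u, v} \<in> M"
    then obtain a b where ab: "{u, v} = {a, b}" "{a, b} \<in> E" "m a = RS a b" by (auto simp: M_def)
    then show "{u, v} \<in> E \<and> (m u = RS u v \<or> m u = LS u v)"
      using RL[OF ab(2,3)] sym[OF ab(2)] by (auto simp: doubleton_eq_iff)
  next
    assume a: "{u, v} \<in> E \<and> (m u = RS u v \<or> m u = LS u v)"
    then show "{u, v} \<in> M"
    proof (cases "m u = RS u v")
      case False
      then have "m v = RS v u" "{v, u} \<in> E" using a LR sym by auto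
      then have "{v, u} \<in> M" by (auto simp: M_def)
      then show ?thesis by (simp add: insert_commute)
    qed (auto simp: M_def)
  qed
  have uniq: "v = w" if "{u, v} \<in> M" "{u, w} \<in> M" for u v w
    using that Linj Rinj RLne by (metis M_iff)
  have mat: "matching E M"
    unfolding matching_def pairwise_def disjnt_def
  proof (intro conjI ballI impI)
    show "M \<subseteq> E" by (auto simp: M_def)
    fix d e assume de: "d \<in> M" "e \<in> M" "d \<noteq> e"
    show "d \<inter> e = {}"
    proof (rule ccontr)
      assume "d \<inter> e \<noteq> {}"
      then obtain x where x: "x \<in> d" "x \<in> e" by blast
      have "\<exists>y. f = {x, y}" if "f \<in> M" "x \<in> f" for f
        using that by (auto simp: M_def)
      then obtain y z where "d = {x, y}" "e = {x, z}" using x de by meson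
      with de uniq show False by auto
    qed
  qed
  have matched_iff: "matched M u \<longleftrightarrow> m u \<noteq> hi u" if u: "u < n" for u
  proof
    assume "matched M u"
    from matched_partner[OF mat this] have p: "{u, partner M u} \<in> E"
      "m u = RS u (partner M u) \<or> m u = LS u (partner M u)" by (auto simp: M_iff)
    then show "m u \<noteq> hi u" using RS_hi[OF p(1)] LS_hi[OF p(1)] by auto
  next
    assume "m u \<noteq> hi u"
    then obtain v where "{u, v} \<in> M" using ms(1)[OF u] by (auto simp: slot_iff M_iff)
    then show "matched M u" by (auto simp: matched_def)
  qed
  have out: "(if opp (m u) = m u then 0 else peer (m u) + 1) = (if matched M u then partner M u +
    1 else 0)"
    if u: "u < n" for u
  proof (cases "m u = hi u")
    case True
    then show ?thesis using u matched_iff[OF u] by (simp add: opp_hi)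
  next
    case False
    then obtain v where v: "{u, v} \<in> E" "m u = RS u v \<or> m u = LS u v" using ms(1)[OF u]
      by (auto simp: slot_iff)
    have p: "peer (m u) = v" using v opp_RS opp_LS by auto
    have s: "slot v (opp (m u))" using slot_peer[OF ms(1)[OF u]] p by simp
    have "opp (m u) \<noteq> m u"
      using slot_own[OF s] slot_own[OF ms(1)[OF u]] edge_nodes[OF v(1)] by auto
    moreover have "{u, v} \<in> M" using v by (simp add: M_iff)
    ultimately show ?thesis using p partner_eq[OF mat] matched_iff[OF u] False by auto
  qed
  have RinR: "u \<in> R" if "{u, v} \<in> E" "m u = RS u v" for u v using that edge_nodes
    by (auto simp: R_def)
  have LinL: "u \<in> L" if e: "{u, v} \<in> E" and m: "m u = LS u v" for u v
    using edge_nodes[OF e] RLne[of u _ v, symmetric] m by (auto simp: L_def R_def)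
  have Lcase: "m u = hi u \<or> (\<exists>v. {u, v} \<in> E \<and> m u = LS u v)" if "u \<in> L" for u
    using that ms(1)[of u] by (auto simp: L_def R_def slot_iff)
  \<comment> \<open>Stability for the option with \<open>v\<close> in \<open>R\<close> and
    \<open>u\<close> in \<open>L\<close>. Both alternatives contradict a \<open>(+,+)\<close> edge;
    if \<open>v\<close> is in \<open>L\<close> too, only the second one is left, and it yields the
    label \<open>-\<close> at \<open>u\<close>.\<close>
  have key: "\<exists>w. {v, w} \<in> E \<and> m v = RS v w \<and> rank v w \<le> rank v u \<or>
       {u, w} \<in> E \<and> m u = LS u w \<and> rank u w \<le> rank u v"
    if e: "{u, v} \<in> E" and u: "u \<in> L" for u v
  proof -
    have uv: "u < n" "v < n" using edge_nodes[OF e] by auto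
    have "slot v (RS v u)" using slot_iff sym[OF e] uv by blast
    then have "m v \<le> RS v u \<or> m u \<le> LS u v"
      using st opp_RS[OF sym[OF e]] unfolding stable_def by metis
    then show ?thesis
    proof
      assume le: "m v \<le> RS v u"
      then obtain w where w: "{v, w} \<in> E" "m v = RS v w"
        using ms(1)[OF uv(2)] RS_hi[OF sym[OF e]] RS_LS[OF sym[OF e]]
          by (auto simp: slot_iff not_le[symmetric])
      then show ?thesis using le by (auto simp: RS_def rslot_def)
    next
      assume le: "m u \<le> LS u v"
      then obtain w where "{u, w} \<in> E" "m u = LS u w" using Lcase[OF u] LS_hi[OF e] by auto
      then show ?thesis using le by (auto simp: LS_def lslot_def)
    qed
  qed
  have plus_rank: "rank x y < rank x w" if "plus_label pref M x y" "{x, y} \<in> E" "{x, w} \<in> M"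
    for x y w
  proof -
    have "matched M x" using that(3) by (auto simp: matched_def)
    moreover have "{x, w} \<in> E" using that(3) by (simp add: M_iff)
    ultimately show ?thesis
      using that(1) pref_iff[OF that(2)] partner_eq[OF mat that(3)] by (simp add: plus_label_def)
  qed
  have ppR: "u \<in> R" if "plus_plus_edge E pref M u v" for u v
  proof (rule ccontr)
    have e: "{u, v} \<in> E" "plus_label pref M u v" "plus_label pref M v u"
      using that by (auto simp: plus_plus_edge_def)
    assume "u \<notin> R"
    then have "u \<in> L" using edge_nodes[OF e(1)] by (simp add: L_def)
    from key[OF e(1) this] show False
      using plus_rank[OF e(3) sym[OF e(1)]] plus_rank[OF e(2,1)]
        by (auto simp: M_iff not_le[symmetric])
  qed
  have minus: "minus_label pref M u v" if e: "{u, v} \<in> E" and LL: "u \<in> L" "v \<in> L" for u v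
  proof -
    have "m v \<noteq> RS v w" if "{v, w} \<in> E" for w using RinR[OF that] LL(2) by (auto simp: L_def)
    with key[OF e LL(1)] obtain w where w: "{u, w} \<in> E" "m u = LS u w" "rank u w \<le> rank u v"
      by blast
    have "w \<noteq> v" using LR[OF w(1,2)] RinR[OF sym[OF e]] LL(2) by (auto simp: L_def)
    then have "rank u w < rank u v" using rank_eq[OF w(1) e] w(3) by linarith
    moreover have wM: "{u, w} \<in> M" using w by (simp add: M_iff)
    moreover have "matched M u" using wM by (auto simp: matched_def)
    ultimately show ?thesis using pref_iff[OF w(1) e] partner_eq[OF mat wM]
      by (simp add: minus_label_def)
  qed
  have "strongly_dominant {..<n} E pref M"
    unfolding strongly_dominant_def
  proof (rule conjI[OF mat], rule exI[of _ L], rule exI[of _ R], intro conjI ballI allI impI)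
    show "L \<union> R = {..<n}" "L \<inter> R = {}" by (auto simp: L_def R_def)
    show "\<exists>u\<in>L. \<exists>v\<in>R. e = {u, v}" if "e \<in> M" for e
    proof -
      from that obtain a b where ab: "e = {a, b}" "{a, b} \<in> E" "m a = RS a b" by (auto simp: M_def)
      then have "a \<in> R" "b \<in> L" using RinR LinL[OF sym[OF ab(2)]] RL by auto
      then show ?thesis using ab(1) by (auto simp: insert_commute)
    qed
    show "matched M v" if "v \<in> R" for v using that by (auto simp: R_def matched_def M_def)
    show "u \<in> R" if "plus_plus_edge E pref M u v" for u v using ppR[OF that] .
    show "v \<in> R" if "plus_plus_edge E pref M u v" for u v
      using ppR[of v u] that by (auto simp: plus_plus_edge_def insert_commute)
    show "minus_minus_edge E pref M u v" if "u \<in> L" "v \<in> L" "{u, v} \<in> E" for u v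
    proof -
      have "{u, v} \<notin> M" using that RinR LR[of u v] sym by (auto simp: M_iff L_def)
      then show ?thesis using minus[OF that(3,1,2)] minus[OF sym[OF that(3)] that(2,1)] that(3)
        by (simp add: minus_minus_edge_def)
    qed
  qed
  then show ?thesis using out by blast
qed

end

end

section \<open>The algorithm\<close>

definition strongly_dominant_algorithm :: com where
  "strongly_dominant_algorithm = (index_all;; link_all;; propose_all;; search_all;; report)"

context preference_instance
begin

lemma sum_width: "(\<Sum>u<n. hi u - lo u) = 2 * off n"
proof -
  have "(\<Sum>u<k. hi u - lo u) = 2 * off k" for k
    by (induction k) (simp_all add: off_0 off_Suc hi_def lo_def)
  then show ?thesis .
qed

text \<open>The initial gap is \<open>2 * off n\<close>, weighted by \<open>50\<close> for proposals
  and \<open>1500\<close> for the search; with \<open>20\<close> for the slack this makes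
  \<open>3140\<close>. Indexing and linking add \<open>50\<close> and \<open>60\<close> per
  entry.\<close>

lemma algorithm_correct:
  "wp strongly_dominant_algorithm
     (\<lambda>t s. correct_output n E pref s \<and> t \<le> 3250 * off n + 1340 * n + 90) (input_state n adj)"
proof -
  have solve: "wp (propose_all;; search_all;; report)
      (\<lambda>t s'. correct_output n E pref s' \<and> t \<le> 3140 * off n + 1170 * n + 70) s" if l: "linked n
        s" for s
  proof -
    let ?own = "arr s ''own''" and ?opp = "arr s ''opp''"
    have lay: "layout ?own ?opp" using linked_layout[OF l] .
    interpret roommates n lo hi ?own ?opp using roommates_layout[OF lay] .
    have init: "\<And>u. u < n \<Longrightarrow> arr s ''first'' u = lo u" "\<And>u. u < n \<Longrightarrow> arr s ''worst'' u = hi u"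
        "\<And>u. u < n \<Longrightarrow> arr s ''second'' u = lo u" "arr s ''mark'' = (\<lambda>_. 0)" "reg s ''n'' = n"
      using l by (auto simp: linked_def indexed_def node_indexed_def input_arrays_def)
    have inst: "instance_state s" using init(5) by (simp add: instance_state_def)
    have g: "gap s = 2 * off n" using init(1,2) sum_width by (simp add: gap_def)
    have sl: "slack lo = 2 * off n + n"
    proof -
      have "slack lo = (\<Sum>u<n. (hi u - lo u) + 1)"
        unfolding slack_def by (rule sum.cong) (use lo_le_hi in \<open>auto simp: Suc_diff_le\<close>)
      also have "\<dots> = (\<Sum>u<n. hi u - lo u) + n" by (simp only: sum.distrib) simp
      finally show ?thesis by (simp add: sum_width)
    qed
    have out: "correct_output n E pref s''"
      if st: "if reg s' ''fail'' = 0 then stable (arr s' ''first'') else \<forall>m. \<not> stable m"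
        and rep: "if reg s' ''fail'' = 0
         then reg s'' ''answer'' = 1 \<and> (\<forall>u<n. arr s'' ''mate'' u =
           (if ?opp (arr s' ''first'' u) = arr s' ''first'' u then 0 else peer (arr s' ''first''
             u) + 1))
         else reg s'' ''answer'' = 0" for s' s''
    proof (cases "reg s' ''fail'' = 0")
      case True
      with st have "stable (arr s' ''first'')" by simp
      from strongly_dominant_of_stable[OF lay this] obtain M where
        "strongly_dominant {..<n} E pref M" "output_matching n s'' M"
        using rep True by (auto simp: output_matching_def)
      then show ?thesis using rep True by (auto simp: correct_output_def)
    next
      case False
      then have "\<not> strongly_dominant {..<n} E pref M" for M
        using st stable_of_strongly_dominant[OF lay] by auto
      then show ?thesis using rep False by (simp add: correct_output_def)
    qed
    have "wp propose_all (\<lambda>t1. wp search_all (\<lambda>t2. wp report (\<lambda>t3 s'. correct_output n E pref s' \<and>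
        t1 + (t2 + t3) \<le> 3140 * off n + 1170 * n + 70))) s"
    proof (rule wp_mono[OF propose_all[OF inst refl init(4)]], goal_cases)
      case (3 t1 s1)
      then have s1: "instance_state s1" "arr s1 ''second'' = arr s ''second''"
        "arr s1 ''mark'' = (\<lambda>_. 0)"
        "closed (arr s1 ''first'') (arr s1 ''worst'')"
          "t1 + 50 * gap s1 \<le> 50 * gap s + 100 * n + 10"
        by auto
      \<comment> \<open>Proved from the block bounds and not from the time bound of
        \<open>propose_all\<close>, so that no additional term in \<open>n\<close> gets multiplied
        by \<open>1500\<close>.\<close>
      have g1: "gap s1 \<le> 2 * off n"
      proof -
        have "gap s1 \<le> (\<Sum>u<n. hi u - lo u)"
          unfolding gap_def
        proof (rule sum_mono)
          fix u assume "u \<in> {..<n}"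
          then have "lo u \<le> arr s1 ''first'' u" "arr s1 ''worst'' u \<le> hi u"
            using s1(4) by (simp_all add: closed_def pruned_def slot_def)
          then show "arr s1 ''worst'' u - arr s1 ''first'' u \<le> hi u - lo u" by linarith
        qed
        then show ?thesis by (simp add: sum_width)
      qed
      show ?case
      proof (rule wp_mono[OF search_all[OF s1(1,3) _ s1(4)]], goal_cases)
        case (2 t2 s2)
        then have s2: "instance_state s2"
          "if reg s2 ''fail'' = 0 then stable (arr s2 ''first'') else \<forall>m. \<not> stable m"
          "t2 \<le> 1500 * gap s1 + 1000 * n + 20 * slack lo + 20"
          by auto
        show ?case
          by (rule wp_mono[OF report[OF s2(1)]], elim conjE)
            (use out[OF s2(2)] s1(5) s2(3) g g1 sl in simp)
      qed (simp add: s1(2) init(3))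
    qed (simp_all add: init)
    then show ?thesis by (simp add: wp_Seq_fun)
  qed
  have "wp index_all (\<lambda>t1. wp link_all (\<lambda>t2. wp (propose_all;; search_all;; report)
      (\<lambda>t3 s'. correct_output n E pref s' \<and> t1 + (t2 + t3) \<le> 3250 * off n + 1340 * n + 90)))
      (input_state n adj)"
    by (rule wp_mono[OF index_all[OF input_arrays_input_state]], elim conjE,
        rule wp_mono[OF link_all], assumption, elim conjE, rule wp_mono[OF solve], assumption) simp
  then show ?thesis by (simp add: strongly_dominant_algorithm_def wp_Seq_fun)
qed

end

theorem theorem6:
  "\<exists>(algorithm :: com) (C :: nat).
     \<forall>(n :: nat) (E :: nat set set) (pref :: nat \<Rightarrow> nat \<Rightarrow> nat \<Rightarrow> bool) (adj :: nat \<Rightarrow> nat list).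
       simple_graph {..<n} E \<and> strict_preferences {..<n} E pref \<and> preference_lists n E pref adj \<longrightarrow>
       (\<exists>t s. exec algorithm (input_state n adj) t s \<and>
              t \<le> C * (card {..<n} + card E + 1) \<and>
              correct_output n E pref s)"
proof (rule exI[of _ strongly_dominant_algorithm], rule exI[of _ 6500], intro allI impI)
  fix n E pref adj
  assume "simple_graph {..<n} E \<and> strict_preferences {..<n} E pref \<and> preference_lists n E pref adj"
  then interpret preference_instance n E pref adj by unfold_locales auto
  obtain t s where "exec strongly_dominant_algorithm (input_state n adj) t s"
    "correct_output n E pref s" "t \<le> 3250 * off n + 1340 * n + 90"
    using algorithm_correct by (auto simp: wp_def)
  then show "\<exists>t s. exec strongly_dominant_algorithm (input_state n adj) t s \<and>
      t \<le> 6500 * (card {..<n} + card E + 1) \<and> correct_output n E pref s"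
    \<comment> \<open>\<open>6500\<close> is twice \<open>3250\<close> because \<open>off n\<close>
      is at most \<open>2 * card E\<close>; it also dominates the coefficient of \<open>n\<close>
      and the constant.\<close>
    using off_le_edges by (intro exI[of _ t] exI[of _ s]) auto
qed

end
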